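(* Let $H$ be a finite group and let $\chi$ be an irreducible (complex) character of $H$ of degree $d$. Suppose that $q$ and $q'$ are prime powers such that $q'\equiv -q \bmod |H|$, and such that $q$ and $|H|$ are coprime. If $H$ embeds in $\mathrm{GL}_d(q)$ with (Brauer) character $\chi$, then $H$ embeds in $\mathrm{GU}_d(q')$ with (Brauer) character $\chi$.
   Context: $\mathrm{GU}_d(q)\le \mathrm{GL}_d(q^2)$ denotes the full isometry group of a non-degenerate Hermitian form on $\mathbb{F}_{q^2}^d$. For a prime $p$, let $k$ be an algebraically closed field of characteristic $p$; one fixes a primitive root of unity of order $|H|_{p'}$ (the $p'$-part of $|H|$) in $k$ and identifies it with $\mathrm{e}^{2\pi \mathrm{i}/|H|_{p'}}\in\mathbb{C}$, and Brauer characters in characteristic $p$ are computed with respect to this identification (any fixed choice for each prime $p$ is allowed). If $G$ is a subgroup of $\mathrm{GL}_d(k)$, then "$H$ embeds in $G$ with (Brauer) character $\chi$" means that there is an injective homomorphism $H\to G\le \mathrm{GL}_d(k)$ whose Brauer character is the restriction of $\chi$ to the $p$-regular elements of $H$ (when $p\nmid |H|$ these are all elements of $H$). *)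

theory Defs
  imports
    "Jordan_Normal_Form.Char_Poly"
    "Jordan_Normal_Form.VS_Connect"
    "HOL-Number_Theory.Number_Theory"
    "HOL-Algebra.Elementary_Groups"
begin

definition GL :: "nat \<Rightarrow> 'a::comm_ring_1 mat monoid" where
  "GL d = units_of (ring_mat TYPE('a) d ())"

definition irreducible_rep ::
    "('h, 'b) monoid_scheme \<Rightarrow> nat \<Rightarrow> ('h \<Rightarrow> 'a::field mat) \<Rightarrow> bool" where
  "irreducible_rep H d \<rho> \<longleftrightarrow>
     0 < d \<and> \<rho> \<in> hom H (GL d) \<and>
     (\<forall>W. VectorSpace.subspace class_ring W (module_vec TYPE('a) d) \<and>
          (\<forall>g \<in> carrier H. \<forall>w \<in> W. \<rho> g *\<^sub>v w \<in> W) \<longrightarrow>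
          W = {0\<^sub>v d} \<or> W = carrier_vec d)"

definition mat_trace :: "'a::comm_monoid_add mat \<Rightarrow> 'a" where
  "mat_trace A = (\<Sum>i<dim_row A. A $$ (i, i))"

text \<open>Irreducible complex characters of degree \<open>d\<close>. Only the values of \<open>\<chi>\<close> on the
  carrier of \<open>H\<close> matter.\<close>

definition irreducible_character ::
    "('h, 'b) monoid_scheme \<Rightarrow> nat \<Rightarrow> ('h \<Rightarrow> complex) \<Rightarrow> bool" where
  "irreducible_character H d \<chi> \<longleftrightarrow>
     (\<exists>\<rho>. irreducible_rep H d \<rho> \<and> (\<forall>g \<in> carrier H. \<chi> g = mat_trace (\<rho> g)))"

definition prime_to_part :: "nat \<Rightarrow> nat \<Rightarrow> nat" where
  "prime_to_part p n = n div p ^ multiplicity p n"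

definition primitive_root_of_unity :: "nat \<Rightarrow> 'a::monoid_mult \<Rightarrow> bool" where
  "primitive_root_of_unity n \<zeta> \<longleftrightarrow>
     0 < n \<and> \<zeta> ^ n = 1 \<and> (\<forall>m. 0 < m \<and> m < n \<longrightarrow> \<zeta> ^ m \<noteq> 1)"

text \<open>The identification of \<open>n\<close>-th roots of unity in \<open>k\<close> with those in the complex numbers
  that sends a chosen primitive root \<open>\<zeta>\<close> to \<open>exp (2 \<pi> \<i> / n)\<close>. It is unspecified on elements
  that are not powers of \<open>\<zeta>\<close>.\<close>

definition root_lift :: "nat \<Rightarrow> 'k::field \<Rightarrow> 'k \<Rightarrow> complex" where
  "root_lift n \<zeta> x = cis (2 * pi / real n) ^ (THE i. i < n \<and> \<zeta> ^ i = x)"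

text \<open>The sum of the lifted eigenvalues of \<open>A\<close>, counted with algebraic multiplicity.\<close>

definition brauer_value :: "nat \<Rightarrow> 'k::alg_closed_field \<Rightarrow> 'k mat \<Rightarrow> complex" where
  "brauer_value n \<zeta> A = sum_mset (image_mset (root_lift n \<zeta>) (proots (char_poly A)))"

definition embeds_with_brauer_character ::
    "('h, 'b) monoid_scheme \<Rightarrow> nat \<Rightarrow> 'k::alg_closed_field mat set \<Rightarrow> 'k \<Rightarrow>
      ('h \<Rightarrow> complex) \<Rightarrow> bool" where
  "embeds_with_brauer_character H d G \<zeta> \<chi> \<longleftrightarrow>
     (\<exists>\<phi> \<in> hom H (GL d). inj_on \<phi> (carrier H) \<and> \<phi> ` carrier H \<subseteq> G \<and>
        (\<forall>g \<in> carrier H. coprime (group.ord H g) CHAR('k) \<longrightarrow>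
           brauer_value (prime_to_part CHAR('k) (order H)) \<zeta> (\<phi> g) = \<chi> g))"

text \<open>If \<open>k\<close> is algebraically closed of characteristic \<open>p\<close> and \<open>q\<close> is a power of \<open>p\<close>
  with positive exponent, this is the unique subfield of \<open>k\<close> of order \<open>q\<close>.\<close>

definition GF :: "nat \<Rightarrow> 'k::field set" where
  "GF q = {x. x ^ q = x}"

definition GF_vec :: "nat \<Rightarrow> nat \<Rightarrow> 'k::field vec set" where
  "GF_vec d q = {v \<in> carrier_vec d. \<forall>i<d. v $ i \<in> GF q}"

definition GL_GF :: "nat \<Rightarrow> nat \<Rightarrow> 'k::field mat set" where
  "GL_GF d q = {A \<in> carrier (GL d). \<forall>i<d. \<forall>j<d. A $$ (i, j) \<in> GF q}"

text \<open>Hermitian forms on the \<open>d\<close>-dimensional column space over the field of order \<open>q\<^sup>2\<close>, with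
  respect to the involution \<open>x \<mapsto> x ^ q\<close>; they are linear in the first argument, hence
  semilinear in the second. Values outside \<open>GF_vec d (q\<^sup>2)\<close> are irrelevant.\<close>

definition hermitian_form ::
    "nat \<Rightarrow> nat \<Rightarrow> ('k::field vec \<Rightarrow> 'k vec \<Rightarrow> 'k) \<Rightarrow> bool" where
  "hermitian_form d q h \<longleftrightarrow>
     (\<forall>v \<in> GF_vec d (q\<^sup>2). \<forall>w \<in> GF_vec d (q\<^sup>2).
        h v w \<in> GF (q\<^sup>2) \<and>
        (\<forall>u \<in> GF_vec d (q\<^sup>2). h (u + v) w = h u w + h v w) \<and>
        (\<forall>c \<in> GF (q\<^sup>2). h (c \<cdot>\<^sub>v v) w = c * h v w) \<and>
        h w v = h v w ^ q)"

definition nondegenerate_form ::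
    "nat \<Rightarrow> nat \<Rightarrow> ('k::field vec \<Rightarrow> 'k vec \<Rightarrow> 'k) \<Rightarrow> bool" where
  "nondegenerate_form d q h \<longleftrightarrow>
     (\<forall>v \<in> GF_vec d (q\<^sup>2). (\<forall>w \<in> GF_vec d (q\<^sup>2). h v w = 0) \<longrightarrow> v = 0\<^sub>v d)"

definition GU_GF ::
    "nat \<Rightarrow> nat \<Rightarrow> ('k::field vec \<Rightarrow> 'k vec \<Rightarrow> 'k) \<Rightarrow> 'k mat set" where
  "GU_GF d q h = {A \<in> GL_GF d (q\<^sup>2).
     \<forall>v \<in> GF_vec d (q\<^sup>2). \<forall>w \<in> GF_vec d (q\<^sup>2). h (A *\<^sub>v v) (A *\<^sub>v w) = h v w}"

end

theory Submission
  imports Defs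
begin

text \<open>Let \<open>\<rho>\<close> be a complex representation affording \<open>\<chi>\<close>. A ring homomorphism into the algebraically
  closed field \<open>'l\<close> that sends \<open>cis (2 * pi / order H)\<close> to \<open>\<zeta>'\<close>, extended to a maximal subring of the
  complex numbers, has a valuation ring as its domain. Hence \<open>\<rho>\<close> can be conjugated into that ring,
  and its reduction \<open>\<psi>\<close> has Brauer character \<open>\<chi>\<close>. Schur's relations survive the reduction because
  \<open>order H\<close> is nonzero in \<open>'l\<close>.

  Eigenvalues of matrices over the field of order \<open>q\<close> are permuted by \<open>x \<mapsto> x\<^sup>q\<close>, so the given embedding
  yields \<open>\<chi> (g\<^sup>q) = \<chi> g\<close>. As \<open>q'\<close> is congruent to \<open>- q\<close>, the twist of \<open>\<psi>\<close> by \<open>x \<mapsto> x\<^sup>q\<^sup>'\<close> has the same trace as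
  the dual of \<open>\<psi>\<close>, and averaging produces an invertible \<open>M\<close> for which \<open>\<psi>\<close> preserves the sesquilinear
  form of \<open>M\<close>. No symmetry or rationality of \<open>M\<close> is needed: by a unitary version of Lang's theorem
  every invertible \<open>M\<close> is \<open>S\<^sup>T F(S)\<close>, and likewise for the Gram matrix of the given form. So \<open>\<psi>\<close> is
  conjugate to a representation that preserves the given Hermitian form, and a matrix preserving
  that form automatically has entries in the field of order \<open>q'\<^sup>2\<close>.

  The embedding is faithful since an element with \<open>\<chi> g = \<chi> 1\<close> acts unipotently under the given
  embedding, and a unipotent matrix of finite order prime to the characteristic is trivial.\<close>

section \<open>Lang's theorem over an algebraically closed field\<close>

hide_const (open) UnivPoly.monom up_ring.monom up_ring.coeff

text \<open>The characteristics of \<open>'k\<close> and \<open>'l\<close> may differ, so the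
  complex numbers are the only bridge between the two embeddings, and the root
  \<open>\<zeta>'\<close> is prescribed. A place of the complex numbers only yields some primitive
  root as an image; that it can be made \<open>\<zeta>'\<close> rests on Dedekind's argument that
  primitive roots of unity of the same order are conjugate.

  The congruence enters as \<open>order H dvd q' + q\<close>. The twist of \<open>\<psi> g\<close>
  has the trace of \<open>\<psi> (g^q')\<close>, the element \<open>g^q'\<close> is the
  \<open>q\<close>-th power of \<open>inv g\<close>, and \<open>\<chi>\<close> does not notice
  \<open>q\<close>-th powers; so this is the trace of \<open>\<psi> (inv g)\<close>.

  Schur's relations take the place of irreducibility of \<open>\<psi>\<close>. Being identities with
  integer coefficients between matrix entries, they pass through every ring homomorphism, and they
  suffice both to find a nonzero invariant form by averaging and to show that it is
  invertible.\<close>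

lemma nonzero_det_inverse:
  fixes A :: "'a::field mat"
  assumes A: "A \<in> carrier_mat d d" and "det A \<noteq> 0"
  obtains B where "B \<in> carrier_mat d d" "A * B = 1\<^sub>m d" "B * A = 1\<^sub>m d"
proof -
  from det_non_zero_imp_unit[OF assms, of "()"] obtain B
    where "B \<in> carrier_mat d d" "A * B = 1\<^sub>m d" "B * A = 1\<^sub>m d"
    unfolding Units_def ring_mat_def by auto
  then show ?thesis by (rule that)
qed

lemma inverse_imp_nonzero_det:
  fixes A :: "'a::field mat"
  assumes "A \<in> carrier_mat d d" "B \<in> carrier_mat d d" "A * B = 1\<^sub>m d"
  shows "det A \<noteq> 0" "det B \<noteq> 0"
  using det_mult[OF assms(1,2)] assms(3) by auto

lemma four_block_first:
  assumes "C \<in> carrier_mat (Suc d) (Suc d)"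
  shows "C = four_block_mat (mat 1 1 (\<lambda>_. C $$ (0,0))) (mat 1 d (\<lambda>(i,j). C $$ (0, Suc j)))
     (mat d 1 (\<lambda>(i,j). C $$ (Suc i, 0))) (mat d d (\<lambda>(i,j). C $$ (Suc i, Suc j)))"
  by (rule eq_matI) (use assms in auto)

text \<open>Some coordinate \<open>v $ k\<close> is nonzero, so \<open>v\<close> can replace the
  \<open>k\<close>-th unit vector in the standard basis; \<open>unit_vec 0\<close> then moves to
  column \<open>k\<close>. The entries 0 and 1 are recorded because every power of Frobenius fixes
  them, which makes \<open>P\<close> as rational as \<open>v\<close>.\<close>

lemma nonzero_vec_basis_completion:
  fixes v :: "'a::field vec"
  assumes v: "v \<in> carrier_vec (Suc d)" "v \<noteq> 0\<^sub>v (Suc d)"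
  obtains P where "P \<in> carrier_mat (Suc d) (Suc d)" "det P \<noteq> 0" "col P 0 = v"
    "\<And>i j. i < Suc d \<Longrightarrow> 0 < j \<Longrightarrow> j < Suc d \<Longrightarrow> P $$ (i, j) \<in> {0, 1}"
proof -
  from v obtain k where k: "k < Suc d" "v $ k \<noteq> 0"
    by (metis carrier_vecD eq_vecI index_zero_vec)
  define P where "P = mat (Suc d) (Suc d) (\<lambda>(i,j). if j = 0 then v $ i
     else if j = k then (if i = 0 then 1 else 0) else if i = j then 1 else 0)"
  have P: "P \<in> carrier_mat (Suc d) (Suc d)" by (simp add: P_def)
  have "det P \<noteq> 0"
  proof
    assume "det P = 0"
    then obtain x where x: "x \<in> carrier_vec (Suc d)" "x \<noteq> 0\<^sub>v (Suc d)" "P *\<^sub>v x = 0\<^sub>v (Suc d)"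
      using det_0_iff_vec_prod_zero_field[OF P] by auto
    have eq: "(\<Sum>j<Suc d. P $$ (i,j) * x $ j) = 0" if "i < Suc d" for i
      using arg_cong[OF x(3), of "\<lambda>w. w $ i"] that x(1) P
      by (simp add: scalar_prod_def atLeast0LessThan)
    have sp: "(\<Sum>j<Suc d. P $$ (i,j) * x $ j) = v $ i * x $ 0 + 
        (\<Sum>j\<in>{0<..<Suc d}. P $$ (i,j) * x $ j)" if "i < Suc d" for i
    proof -
      have "{..<Suc d} = insert 0 {0<..<Suc d}" by auto
      then show ?thesis using that by (simp add: P_def)
    qed
    \<comment> \<open>Row \<open>k\<close> of \<open>P\<close> is zero outside column 0, which
      forces \<open>x $ 0 = 0\<close>; each other row then isolates one coordinate of
      \<open>x\<close>.\<close>
    have "(\<Sum>j\<in>{0<..<Suc d}. P $$ (k,j) * x $ j) = 0"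
      by (rule sum.neutral) (use k in \<open>auto simp: P_def\<close>)
    with sp[OF k(1)] eq[OF k(1)] k have x0: "x $ 0 = 0" by simp
    have "x $ i = 0" if i: "i < Suc d" "i \<noteq> 0" "i \<noteq> k" for i
    proof -
      have "(\<Sum>j\<in>{0<..<Suc d}. P $$ (i,j) * x $ j) = (\<Sum>j\<in>{0<..<Suc d}. if i = j then x $ j else 0)"
        by (rule sum.cong) (use i in \<open>auto simp: P_def\<close>)
      also have "\<dots> = x $ i" using i by simp
      finally show ?thesis using sp[OF i(1)] eq[OF i(1)] x0 by simp
    qed
    moreover have "x $ k = 0"
    proof (cases "k = 0")
      case False
      have "(\<Sum>j\<in>{0<..<Suc d}. P $$ (0,j) * x $ j) = (\<Sum>j\<in>{0<..<Suc d}. if k = j then x $ j else 0)"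
        by (rule sum.cong) (auto simp: P_def)
      also have "\<dots> = x $ k" using False k by simp
      finally show ?thesis using sp[of 0] eq[of 0] x0 by simp
    qed (use x0 in simp)
    ultimately have "x $ i = 0" if "i < Suc d" for i using x0 that by metis
    then have "x = 0\<^sub>v (Suc d)" using x(1) by (intro eq_vecI) auto
    with x(2) show False by simp
  qed
  moreover have "col P 0 = v" using v by (auto simp: P_def)
  ultimately show ?thesis using P that[of P] by (auto simp: P_def)
qed

section \<open>Powers of the Frobenius map\<close>

locale frobenius_power =
  fixes F :: "'a::field \<Rightarrow> 'a" and q :: nat
  assumes char_prime: "prime CHAR('a)"
    and q_gt_1: "1 < q"
    and q_pow: "\<exists>k. q = CHAR('a) ^ k"
    and F_eq: "\<And>x. F x = x ^ q"
begin

sublocale field_hom F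
  using q_pow char_prime q_gt_1
  by unfold_locales (auto simp: F_eq power_mult_distrib freshmans_dream')

end

lemma frobenius_powerI:
  assumes "CHAR('a::field) = aprimedivisor q" "primepow q"
  shows "frobenius_power (\<lambda>x::'a. x ^ q) q"
proof
  show "prime CHAR('a)" 
    using assms primepow_gt_Suc_0[OF assms(2)] by (simp add: prime_aprimedivisor')
  show "1 < q" using assms primepow_gt_Suc_0 by auto
  show "\<exists>k. q = CHAR('a) ^ k"
    using assms(1) primepow_decompose[OF assms(2)] by metis
qed auto

text \<open>The map \<open>F\<close> is a locale parameter so that its square can be an instance
  too; \<open>unitary_lang\<close> applies Lang's theorem to this square.\<close>

lemma (in frobenius_power) frobenius_power_square: "frobenius_power (\<lambda>x. F (F x)) (q\<^sup>2)"
proof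
  show "prime CHAR('a)" by (rule char_prime)
  show "1 < q\<^sup>2" using q_gt_1 by (rule one_less_power) simp
  show "\<exists>k. q\<^sup>2 = CHAR('a) ^ k" using q_pow by (metis power_mult)
  show "F (F x) = x ^ q\<^sup>2" for x by (simp add: F_eq power_mult[symmetric] power2_eq_square)
qed

locale alg_closed_frobenius_power = frobenius_power F q
  for F :: "'a::alg_closed_field \<Rightarrow> 'a" and q
begin

text \<open>If \<open>f\<close> is \<open>F\<close>-semilinear and the iterate \<open>f\<^sup>m\<^sup>+\<^sup>1 u\<close> is the combination of the lower iterates with
  coefficients \<open>a i\<close>, these equations make the combination with coefficients \<open>x i\<close> a fixed vector.\<close>

lemma fixed_vector_coefficients_exist:
  fixes a :: "nat \<Rightarrow> 'a"
  assumes k: "k \<le> m" "a k \<noteq> 0"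
  obtains x where "x m \<noteq> 0" "x 0 = F (x m) * a 0"
    "\<And>i. i < m \<Longrightarrow> x (Suc i) = F (x m) * a (Suc i) + F (x i)"
proof -
  \<comment> \<open>With \<open>y = x m\<close> as the only unknown, the equations give
    \<open>x i = poly (p i) y\<close> one after the other. What remains is
    \<open>poly (p m) y = y\<close> with \<open>y\<close> nonzero.\<close>
  define p where "p = rec_nat (monom (a 0) q) (\<lambda>i g. monom (a (Suc i)) q + g ^ q)"
  have p0: "p 0 = monom (a 0) q" and pS: "p (Suc i) = monom (a (Suc i)) q + p i ^ q" for i
    by (simp_all add: p_def)
  have dvd: "monom 1 q dvd p i" for i
  proof (induction i)
    case 0
    show ?case by (simp add: p0 monom_1_dvd_iff')
  next
    case (Suc i)
    have "p i dvd p i ^ q" using q_gt_1 by (simp add: dvd_power)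
    with Suc have "monom 1 q dvd p i ^ q" by (rule dvd_trans)
    moreover have "monom 1 q dvd monom (a (Suc i)) q" by (simp add: monom_1_dvd_iff')
    ultimately show ?case unfolding pS by (rule dvd_add[rotated])
  qed
  \<comment> \<open>All terms of \<open>p i\<close> have degree at least \<open>q\<close>, so those
    of \<open>p i ^ q\<close> have degree at least \<open>q * q\<close> and cannot cancel the term
    with \<open>a (Suc i)\<close>. Hence \<open>p m = 0\<close> would make all coefficients up to
    \<open>a m\<close> zero.\<close>
  have zero: "\<forall>j\<le>i. a j = 0" if "p i = 0" for i
    using that
  proof (induction i)
    case 0
    then show ?case by (simp add: p0)
  next
    case (Suc i)
    have "monom 1 q ^ q dvd p i ^ q" using dvd by (rule dvd_power_same)
    then have d: "monom 1 (q * q) dvd p i ^ q" by (simp add: monom_power)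
    have "q < q * q" using q_gt_1 by simp
    with d have "coeff (p i ^ q) q = 0" by (simp add: monom_1_dvd_iff')
    with Suc.prems have "a (Suc i) = 0" unfolding pS
      by (metis add.right_neutral coeff_add coeff_monom coeff_0)
    with Suc have "p i ^ q = 0" by (simp add: pS)
    then have "p i = 0" by simp
    with Suc \<open>a (Suc i) = 0\<close> show ?case by (auto simp: le_Suc_eq)
  qed
  from k zero have "p m \<noteq> 0" by blast
  from dvd[of m] obtain g where g: "p m = monom 1 q * g" by (elim dvdE)
  with \<open>p m \<noteq> 0\<close> have "g \<noteq> 0" by auto
  \<comment> \<open>This is \<open>p m\<close> divided by the variable, so a root of
    \<open>h - 1\<close> solves \<open>p m y = y\<close>. A root exists because \<open>h\<close> has
    degree at least \<open>q - 1\<close>, and it is nonzero because \<open>h\<close> vanishes at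
    0.\<close>
  define h where "h = monom 1 (q - 1) * g"
  have pm: "p m = monom 1 1 * h"
    unfolding g h_def mult.assoc[symmetric] mult_monom using q_gt_1 by simp
  have h: "h \<noteq> 0" "degree h \<ge> q - 1"
    using \<open>g \<noteq> 0\<close> by (simp_all add: h_def degree_mult_eq degree_monom_eq)
  have "degree (h - 1) = degree h"
    using h q_gt_1 degree_add_eq_left[of "- 1" h] by simp
  moreover have "0 < degree h" using h(2) q_gt_1 by linarith
  ultimately obtain y where "poly (h - 1) y = 0"
    using alg_closed_imp_poly_has_root[of "h - 1"] by auto
  then have y: "poly h y = 1" by simp
  have "poly h 0 = 0" using q_gt_1 by (simp add: h_def poly_monom)
  with y have "y \<noteq> 0" by auto
  define x where "x = (\<lambda>i. poly (p i) y)"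
  have "x m = y" using y by (simp add: x_def pm poly_monom)
  then show ?thesis using \<open>y \<noteq> 0\<close>
    by (intro that[of x]) (auto simp: x_def p0 pS poly_monom F_eq mult.commute)
qed

text \<open>The solutions are the fixed vectors of the semilinear map \<open>f v = B F(v)\<close>,
  where \<open>B\<close> inverts \<open>A\<close>. The first iterate of a unit vector that depends
  on its predecessors supplies the coefficients for \<open>fixed_vector_coefficients_exist\<close>,
  and its minimality keeps the fixed combination nonzero.\<close>

lemma semilinear_fixed_vector:
  assumes A: "A \<in> carrier_mat d d" "det A \<noteq> 0" and "0 < d"
  obtains v where "v \<in> carrier_vec d" "v \<noteq> 0\<^sub>v d" "map_vec F v = A *\<^sub>v v"
proof -
  from nonzero_det_inverse[OF A] obtain B where
    B: "B \<in> carrier_mat d d" "A * B = 1\<^sub>m d" "B * A = 1\<^sub>m d" by blast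
  define f where "f v = B *\<^sub>v map_vec F v" for v
  define w where "w i = (f ^^ i) (unit_vec d 0)" for i :: nat
  have f: "f v \<in> carrier_vec d" if "v \<in> carrier_vec d" for v
    using that B by (auto simp: f_def)
  have wc: "w i \<in> carrier_vec d" for i
    by (induction i) (auto simp: w_def f)
  have w0: "w 0 $ 0 = 1" using \<open>0 < d\<close> by (simp add: w_def)
  have f_nth: "f v $ j = (\<Sum>k<d. B $$ (j,k) * F (v $ k))" if "v \<in> carrier_vec d" "j < d" for v j
    using that B by (simp add: f_def scalar_prod_def atLeast0LessThan)
  have wS: "w (Suc i) = f (w i)" for i by (simp add: w_def)
  define rel where "rel r = (\<exists>a. \<forall>j<d. w r $ j = (\<Sum>i<r. a i * w i $ j))" for r
  have "\<exists>r. rel r"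
  proof -
    \<comment> \<open>The \<open>d + 1\<close> iterates are the columns; a zero row at the bottom
      makes the matrix square and its determinant zero.\<close>
    define M where "M = mat (Suc d) (Suc d) (\<lambda>(j,i). if j < d then w i $ j else 0)"
    have M: "M \<in> carrier_mat (Suc d) (Suc d)" by (simp add: M_def)
    have "M\<^sup>T *\<^sub>v unit_vec (Suc d) d = 0\<^sub>v (Suc d)"
      by (rule eq_vecI) (auto simp: M_def)
    moreover have "unit_vec (Suc d) d \<noteq> (0\<^sub>v (Suc d) :: 'a vec)" by simp
    ultimately have "det M\<^sup>T = 0"
      unfolding det_0_iff_vec_prod_zero_field[OF transpose_carrier_mat[THEN iffD2, OF M]]
      by (intro exI[of _ "unit_vec (Suc d) d"]) simp
    then have "det M = 0" using M by (simp add: det_transpose)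
    then obtain c where c: "c \<in> carrier_vec (Suc d)" "c \<noteq> 0\<^sub>v (Suc d)" "M *\<^sub>v c = 0\<^sub>v (Suc d)"
      using det_0_iff_vec_prod_zero_field[OF M] by auto
    \<comment> \<open>Dividing by the last nonzero coefficient expresses \<open>w r\<close> by
      earlier iterates only.\<close>
    define r where "r = Max {i. i < Suc d \<and> c $ i \<noteq> 0}"
    have ne: "{i. i < Suc d \<and> c $ i \<noteq> 0} \<noteq> {}"
    proof
      assume "{i. i < Suc d \<and> c $ i \<noteq> 0} = {}"
      then have "c = 0\<^sub>v (Suc d)" using c(1) by (intro eq_vecI) auto
      with c(2) show False by simp
    qed
    have r: "r < Suc d" "c $ r \<noteq> 0"
      using Max_in[OF _ ne] by (auto simp: r_def)
    have gt: "c $ i = 0" if "r < i" "i < Suc d" for i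
    proof (rule ccontr)
      assume "c $ i \<noteq> 0"
      then have "i \<le> r" unfolding r_def using that by (intro Max_ge) auto
      with that show False by simp
    qed
    have "w r $ j = (\<Sum>i<r. (- c $ i / c $ r) * w i $ j)" if j: "j < d" for j
    proof -
      have "(\<Sum>i<Suc d. w i $ j * c $ i) = 0"
        using arg_cong[OF c(3), of "\<lambda>w. w $ j"] j c(1)
        by (simp add: M_def scalar_prod_def atLeast0LessThan)
      also have "(\<Sum>i<Suc d. w i $ j * c $ i) = (\<Sum>i<Suc r. w i $ j * c $ i)"
        by (rule sum.mono_neutral_right) (use r gt in auto)
      finally have "c $ r * w r $ j = - (\<Sum>i<r. c $ i * w i $ j)"
        by (simp add: eq_neg_iff_add_eq_0 ac_simps)
      then have "w r $ j = - (\<Sum>i<r. c $ i * w i $ j) / c $ r"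
        using r by (simp add: field_simps)
      then show ?thesis by (simp add: sum_divide_distrib sum_negf)
    qed
    then show ?thesis unfolding rel_def by (intro exI[of _ r] exI[of _ "\<lambda>i. - c $ i / c $ r"]) auto
  qed
  define r where "r = (LEAST r. rel r)"
  have "rel r" unfolding r_def using \<open>\<exists>r. rel r\<close> by (rule LeastI_ex)
  have least: "\<not> rel i" if "i < r" for i
    using that not_less_Least unfolding r_def by blast
  have "\<not> rel 0" using w0 \<open>0 < d\<close> unfolding rel_def by force
  with \<open>rel r\<close> have "r \<noteq> 0" by metis
  then obtain m where m: "r = Suc m" by (cases r) auto
  from \<open>rel r\<close> obtain a where a: "\<And>j. j < d \<Longrightarrow> w r $ j = (\<Sum>i<r. a i * w i $ j)"
    unfolding rel_def by blast
  \<comment> \<open>The map \<open>f\<close> has trivial kernel: if the relation read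
    \<open>w r = 0\<close>, then already \<open>w m = 0\<close>, against the minimality of
    \<open>r\<close>.\<close>
  have "\<exists>k\<le>m. a k \<noteq> 0"
  proof (rule ccontr)
    assume "\<not> ?thesis"
    then have "w r $ j = 0" if "j < d" for j using a[OF that] by (simp add: m)
    then have "w r = 0\<^sub>v d" using wc[of r] by (intro eq_vecI) auto
    then have "A *\<^sub>v (B *\<^sub>v map_vec F (w m)) = 0\<^sub>v d"
      using A by (intro eq_vecI) (auto simp: m wS f_def)
    also have "A *\<^sub>v (B *\<^sub>v map_vec F (w m)) = map_vec F (w m)"
      using A B wc by (metis assoc_mult_mat_vec map_carrier_vec one_mult_mat_vec)
    finally have "w m = 0\<^sub>v d" using wc[of m] by simp
    then have "rel m" unfolding rel_def by (intro exI[of _ "\<lambda>_. 0"]) auto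
    with least[of m] show False by (simp add: m)
  qed
  then obtain k where "k \<le> m" "a k \<noteq> 0" by blast
  then obtain x where x: "x m \<noteq> 0" "x 0 = F (x m) * a 0"
    "\<And>i. i < m \<Longrightarrow> x (Suc i) = F (x m) * a (Suc i) + F (x i)"
    using fixed_vector_coefficients_exist by blast
  define v where "v = vec d (\<lambda>j. \<Sum>i<r. x i * w i $ j)"
  have v: "v \<in> carrier_vec d" by (simp add: v_def)
  have "f v = v"
  proof (rule eq_vecI)
    fix j assume "j < dim_vec v"
    then have j: "j < d" by (simp add: v_def)
    have "f v $ j = (\<Sum>k<d. B $$ (j,k) * (\<Sum>i<r. F (x i) * F (w i $ k)))"
      using f_nth[OF v j] by (simp add: v_def hom_distribs)
    also have "\<dots> = (\<Sum>i<r. F (x i) * (\<Sum>k<d. B $$ (j,k) * F (w i $ k)))"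
      unfolding sum_distrib_left by (subst sum.swap) (simp add: ac_simps)
    also have "\<dots> = (\<Sum>i<r. F (x i) * w (Suc i) $ j)"
      by (simp add: wS f_nth[OF wc j])
    also have "\<dots> = (\<Sum>i<m. F (x i) * w (Suc i) $ j) + F (x m) * (\<Sum>i<r. a i * w i $ j)"
      using a[OF j] by (simp add: m)
    also have "(\<Sum>i<r. a i * w i $ j) = a 0 * w 0 $ j + (\<Sum>i<m. a (Suc i) * w (Suc i) $ j)"
      unfolding m by (subst sum.lessThan_Suc_shift) simp
    also have "(\<Sum>i<m. F (x i) * w (Suc i) $ j) + F (x m) * \<dots>
      = x 0 * w 0 $ j + (\<Sum>i<m. x (Suc i) * w (Suc i) $ j)"
      by (simp add: x(2,3) algebra_simps sum.distrib sum_distrib_left)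
    also have "\<dots> = v $ j"
      unfolding v_def using j by (simp add: m sum.lessThan_Suc_shift del: sum.lessThan_Suc)
    finally show "f v $ j = v $ j" .
  qed (use v f[OF v] in simp)
  have "v \<noteq> 0\<^sub>v d"
  proof
    assume "v = 0\<^sub>v d"
    have "w m $ j = (\<Sum>i<m. (- x i / x m) * w i $ j)" if j: "j < d" for j
    proof -
      have "v $ j = 0" using j \<open>v = 0\<^sub>v d\<close> by simp
      then have "x m * w m $ j = - (\<Sum>i<m. x i * w i $ j)"
        using j by (simp add: v_def m eq_neg_iff_add_eq_0 ac_simps)
      then have "w m $ j = - (\<Sum>i<m. x i * w i $ j) / x m"
        using x(1) by (simp add: field_simps)
      then show ?thesis by (simp add: sum_divide_distrib sum_negf)
    qed
    then have "rel m" unfolding rel_def by (intro exI[of _ "\<lambda>i. - x i / x m"]) auto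
    with least[of m] show False by (simp add: m)
  qed
  moreover have "map_vec F v = A *\<^sub>v v"
  proof -
    have "A *\<^sub>v v = A *\<^sub>v (B *\<^sub>v map_vec F v)" using \<open>f v = v\<close> by (simp add: f_def)
    also have "\<dots> = map_vec F v"
      using A B v by (metis assoc_mult_mat_vec map_carrier_vec one_mult_mat_vec)
    finally show ?thesis ..
  qed
  ultimately show ?thesis using v that by blast
qed

text \<open>A polynomial of degree \<open>q\<close> in \<open>y\<close> has a root. The case
  \<open>b = 1\<close> fills the off-diagonal block in Lang's theorem; \<open>b = - 1\<close>
  supplies an element with \<open>t + F t = 1\<close>.\<close>

lemma additive_solvable: obtains y where "F y = b * y + c"
proof -
  define p where "p = monom 1 q - [:c, b:]"
  have "degree p = degree (monom 1 q :: 'a poly)"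
    unfolding p_def diff_conv_add_uminus
    by (rule degree_add_eq_left) (use q_gt_1 in \<open>auto simp: degree_monom_eq intro: le_less_trans[OF degree_pCons_le]\<close>)
  then obtain y where "poly p y = 0"
    using q_gt_1 alg_closed_imp_poly_has_root[of p] by (auto simp: degree_monom_eq)
  then show ?thesis using that[of y] by (simp add: p_def poly_monom F_eq algebra_simps)
qed

text \<open>Induction on \<open>d\<close>. With a solution \<open>v\<close> of
  \<open>F v = A v\<close> as first column of \<open>P\<close>, the twisted conjugate
  \<open>C = F(P)^-1 A P\<close> has first column \<open>unit_vec 0\<close>. If \<open>Y\<close>
  solves the problem for \<open>C\<close>, then \<open>P * Y\<close> solves it for
  \<open>A\<close>.\<close>

theorem lang:
  assumes "A \<in> carrier_mat d d" "det A \<noteq> 0"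
  shows "\<exists>X\<in>carrier_mat d d. det X \<noteq> 0 \<and> map_mat F X = A * X"
  using assms
proof (induction d arbitrary: A)
  case 0
  then show ?case by (intro bexI[of _ A]) auto
next
  case (Suc d)
  let ?c = "carrier_mat (Suc d) (Suc d)"
  from semilinear_fixed_vector[OF Suc.prems] obtain v where
    v: "v \<in> carrier_vec (Suc d)" "v \<noteq> 0\<^sub>v (Suc d)" "map_vec F v = A *\<^sub>v v" by auto
  from nonzero_vec_basis_completion[OF v(1,2)] obtain P where
    P: "P \<in> ?c" "det P \<noteq> 0" "col P 0 = v" by metis
  from nonzero_det_inverse[OF P(1,2)] obtain R where
    R: "R \<in> ?c" "P * R = 1\<^sub>m (Suc d)" "R * P = 1\<^sub>m (Suc d)" by blast
  have A: "A \<in> ?c" by fact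
  define FP where "FP = map_mat F P"
  define FR where "FR = map_mat F R"
  have FP: "FP \<in> ?c" and FR: "FR \<in> ?c" using P R by (simp_all add: FP_def FR_def)
  have FPR: "FP * FR = 1\<^sub>m (Suc d)" "FR * FP = 1\<^sub>m (Suc d)"
    unfolding FP_def FR_def using P R by (simp_all add: mat_hom_mult[symmetric] mat_hom_one)
  define C where "C = FR * (A * P)"
  have C: "C \<in> ?c" using FR A P by (simp add: C_def)
  have Rv: "R *\<^sub>v v = unit_vec (Suc d) 0"
  proof -
    have "R *\<^sub>v v = col (R * P) 0" using R P col_mult2[OF R(1) P(1), of 0] by simp
    then show ?thesis by (simp add: R)
  qed
  have "col C 0 = FR *\<^sub>v (A *\<^sub>v v)"
    using FR A P col_mult2[OF FR mult_carrier_mat[OF A P(1)], of 0] col_mult2[OF A P(1), of 0]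
    by (simp add: C_def)
  also have "\<dots> = map_vec F (R *\<^sub>v v)"
    unfolding v(3)[symmetric] FR_def using R v by (simp add: mult_mat_vec_hom)
  also have "\<dots> = unit_vec (Suc d) 0"
    unfolding Rv by (rule eq_vecI) (auto simp: unit_vec_def)
  finally have colC: "col C 0 = unit_vec (Suc d) 0" .
  have C0: "C $$ (i, 0) = (if i = 0 then 1 else 0)" if "i < Suc d" for i
    using arg_cong[OF colC, of "\<lambda>w. w $ i"] that C by auto
  define b where "b = mat 1 d (\<lambda>(i,j). C $$ (0, Suc j))"
  define A' where "A' = mat d d (\<lambda>(i,j). C $$ (Suc i, Suc j))"
  have b: "b \<in> carrier_mat 1 d" and A': "A' \<in> carrier_mat d d" by (auto simp: b_def A'_def)
  have C_eq: "C = four_block_mat (1\<^sub>m 1) b (0\<^sub>m d 1) A'"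
    by (subst four_block_first[OF C], unfold b_def A'_def, rule cong_four_block_mat)
       (auto simp: C0)
  have "det C = det A'"
    unfolding C_eq using A' b by (subst det_four_block_mat_lower_left_zero[of _ 1 _ d]) auto
  moreover have "det C \<noteq> 0"
    using det_mult[OF FR, of "A * P"] det_mult[OF A P(1)] A P Suc.prems
      inverse_imp_nonzero_det[OF FR FP FPR(2)] by (simp add: C_def)
  ultimately obtain X' where X': "X' \<in> carrier_mat d d" "det X' \<noteq> 0" "map_mat F X' = A' * X'"
    using Suc.IH[OF A'] by auto
  \<comment> \<open>The diagonal blocks of \<open>map_mat F Y = C * Y\<close> are settled; the upper
    right one amounts to one additive equation per column.\<close>
  have "\<forall>j. \<exists>y. F y = y + (b * X') $$ (0, j)" using additive_solvable[of 1] by (metis mult_1)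
  then obtain y where y: "\<And>j. F (y j) = y j + (b * X') $$ (0, j)" by metis
  define z where "z = mat 1 d (\<lambda>(i,j). y j)"
  have z: "z \<in> carrier_mat 1 d" "map_mat F z = z + b * X'"
    using b X' y by (auto simp: z_def intro!: eq_matI)
  define Y where "Y = four_block_mat (1\<^sub>m 1) z (0\<^sub>m d 1) X'"
  have Y: "Y \<in> ?c" using z X' unfolding Y_def
    by (metis four_block_carrier_mat one_carrier_mat plus_1_eq_Suc)
  have "map_mat F Y = four_block_mat (1\<^sub>m 1) (z + b * X') (0\<^sub>m d 1) (A' * X')"
    unfolding Y_def using z X' by (subst map_four_block_mat[of _ 1 1 _ d _ d]) (auto simp: mat_hom_one intro!: cong_four_block_mat)
  also have "\<dots> = C * Y"
    unfolding C_eq Y_def using b A' z X'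
    by (subst mult_four_block_mat[of _ 1 1 _ d _ d _ _ 1 _ d]) auto
  finally have FY: "map_mat F Y = C * Y" .
  have "det Y \<noteq> 0" unfolding Y_def using X' z
    by (subst det_four_block_mat_lower_left_zero[of _ 1 _ d]) auto
  have "map_mat F (P * Y) = FP * (C * Y)"
    unfolding FY[symmetric] FP_def by (rule mat_hom_mult[OF P(1) Y])
  also have "\<dots> = (FP * FR) * (A * P * Y)"
    using FP FR A P Y by (simp add: C_def assoc_mult_mat[of _ "Suc d" "Suc d" _ "Suc d" _ "Suc d"])
  also have "\<dots> = A * (P * Y)"
    using A P Y by (simp add: FPR assoc_mult_mat[of _ "Suc d" "Suc d" _ "Suc d" _ "Suc d"])
  finally have "map_mat F (P * Y) = A * (P * Y)" .
  moreover have "det (P * Y) \<noteq> 0" using det_mult[OF P(1) Y] P \<open>det Y \<noteq> 0\<close> by simp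
  ultimately show ?case using P Y by (intro bexI[of _ "P * Y"]) auto
qed

end

section \<open>Lang's theorem for the unitary group\<close>

context alg_closed_frobenius_power
begin

text \<open>The form with Gram matrix \<open>N\<close>, linear in the first and
  \<open>F\<close>-semilinear in the second argument, has this Gram matrix with respect to the
  columns of \<open>S\<close>. So \<open>sesqui N S = N\<close> says that \<open>S\<close> preserves
  the form.\<close>

definition sesqui :: "'a mat \<Rightarrow> 'a mat \<Rightarrow> 'a mat" where
  "sesqui N S = S\<^sup>T * N * map_mat F S"

lemma sesqui_carrier [simp]:
  "N \<in> carrier_mat d d \<Longrightarrow> S \<in> carrier_mat d d \<Longrightarrow> sesqui N S \<in> carrier_mat d d"
  by (simp add: sesqui_def)

lemma sesqui_sesqui:
  assumes "N \<in> carrier_mat d d" "S \<in> carrier_mat d d" "T \<in> carrier_mat d d"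
  shows "sesqui (sesqui N S) T = sesqui N (S * T)"
  using assms
  by (simp add: sesqui_def transpose_mult[of _ d d _ d] mat_hom_mult[of _ d d _ d]
      assoc_mult_mat[of _ d d _ d _ d])

lemma det_sesqui:
  assumes "N \<in> carrier_mat d d" "S \<in> carrier_mat d d"
  shows "det (sesqui N S) = det S * det N * F (det S)"
  using assms by (simp add: sesqui_def det_mult[of _ d] det_transpose)

text \<open>Applying \<open>F\<close> puts \<open>F (F S)\<close> on the right, whereas transposing
  puts \<open>S\<close> there. This is why the basis changes used to diagonalize a Hermitian matrix
  are kept fixed by the square of \<open>F\<close>.\<close>

lemma sesqui_hermitian:
  assumes "N \<in> carrier_mat d d" "N\<^sup>T = map_mat F N"
    and "S \<in> carrier_mat d d" "map_mat F (map_mat F S) = S"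
  shows "(sesqui N S)\<^sup>T = map_mat F (sesqui N S)"
  using assms
  by (simp add: sesqui_def transpose_mult[of _ d d _ d] mat_hom_mult[of _ d d _ d]
      assoc_mult_mat[of _ d d _ d _ d] map_mat_transpose)

lemma hermitian_nth:
  assumes "N \<in> carrier_mat d d" "N\<^sup>T = map_mat F N" "i < d" "j < d"
  shows "F (N $$ (i,j)) = N $$ (j,i)"
  using arg_cong[OF assms(2), of "\<lambda>A. A $$ (i,j)"] assms(1,3,4) by simp

lemma sesqui_0_0:
  assumes "N \<in> carrier_mat d d" "S \<in> carrier_mat d d" "0 < d"
  shows "sesqui N S $$ (0,0) = col S 0 \<bullet> (N *\<^sub>v map_vec F (col S 0))"
proof -
  have "sesqui N S $$ (0,0) = row (S\<^sup>T) 0 \<bullet> col (N * map_mat F S) 0"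
    using assms by (simp add: sesqui_def assoc_mult_mat[of _ d d _ d _ d])
  then show ?thesis using assms col_mult2[of N d d "map_mat F S" d 0] by simp
qed

text \<open>A nonzero diagonal entry is the value at a unit vector. If the diagonal is zero, the
  value at \<open>unit_vec d i + c \<cdot>\<^sub>v unit_vec d j\<close> is the trace
  \<open>z + F z\<close> of \<open>z = F c * N $$ (i,j)\<close>, and \<open>c\<close> is chosen to
  make it 1.\<close>

lemma anisotropic_vector:
  assumes N: "N \<in> carrier_mat d d" "N\<^sup>T = map_mat F N" and "N \<noteq> 0\<^sub>m d d"
  obtains v where "v \<in> carrier_vec d" "map_vec F (map_vec F v) = v"
    "v \<bullet> (N *\<^sub>v map_vec F v) \<noteq> 0"
proof (cases "\<exists>i<d. N $$ (i,i) \<noteq> 0")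
  case True
  then obtain i where i: "i < d" "N $$ (i,i) \<noteq> 0" by blast
  have e: "map_vec F (unit_vec d i) = unit_vec d i" by (intro eq_vecI) (auto simp: unit_vec_def)
  have "unit_vec d i \<bullet> (N *\<^sub>v unit_vec d i) = N $$ (i,i)"
    using i N by (simp add: scalar_prod_left_unit)
  then show ?thesis using i e by (intro that[of "unit_vec d i"]) auto
next
  case False
  from N \<open>N \<noteq> 0\<^sub>m d d\<close> obtain i j where ij: "i < d" "j < d" "N $$ (i,j) \<noteq> 0"
    by (metis carrier_matD eq_matI index_zero_mat)
  with False have "i \<noteq> j" by auto
  \<comment> \<open>An element of trace 1 exists in every characteristic, including 2. The scalar
    \<open>c\<close> is then solved from \<open>F c * N $$ (i,j) = t\<close>.\<close>
  obtain t where "F t = - 1 * t + 1" by (rule additive_solvable)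
  then have t: "F t = 1 - t" by simp
  then have FFt: "F (F t) = t" by (simp add: hom_distribs)
  define c where "c = F (t / N $$ (i,j))"
  have Nij: "F (N $$ (i,j)) = N $$ (j,i)" "F (N $$ (j,i)) = N $$ (i,j)"
    using hermitian_nth[OF N] ij by auto
  have Fc: "F c = t / N $$ (i,j)" unfolding c_def hom_div Nij FFt ..
  define v where "v = unit_vec d i + c \<cdot>\<^sub>v unit_vec d j"
  have Fv: "map_vec F v = unit_vec d i + F c \<cdot>\<^sub>v unit_vec d j"
    by (intro eq_vecI) (auto simp: v_def unit_vec_def hom_distribs)
  have FFc: "F (F c) = c" unfolding Fc unfolding c_def ..
  have "map_vec F (map_vec F v) = v"
    unfolding Fv by (intro eq_vecI) (auto simp: v_def unit_vec_def hom_distribs FFc)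
  moreover have "v \<bullet> (N *\<^sub>v map_vec F v) = F c * N $$ (i,j) + c * N $$ (j,i)"
    unfolding Fv unfolding v_def using N ij False
    by (simp add: mult_add_distrib_mat_vec[of _ d d] mult_mat_vec[of _ d d]
      add_scalar_prod_distrib[of _ d] scalar_prod_left_unit)
  moreover have "F c * N $$ (i,j) + c * N $$ (j,i) = t + F t"
    using ij Nij(1) unfolding Fc by (simp add: c_def hom_distribs)
       (metis nonzero_eq_divide_eq hom_0_iff Nij(1))
  ultimately show ?thesis using t by (intro that[of v]) (auto simp: v_def)
qed

text \<open>One Gram-Schmidt step: \<open>E\<close> subtracts projections to the first basis vector.
  The row \<open>e\<close> is chosen to clear the first column of \<open>N\<close>; by Hermitian
  symmetry \<open>map_mat F e\<close> clears the first row.\<close>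

lemma hermitian_diagonal_block:
  assumes N: "N \<in> carrier_mat (Suc d) (Suc d)" "N\<^sup>T = map_mat F N" and a: "N $$ (0,0) \<noteq> 0"
  obtains E N' where "E \<in> carrier_mat (Suc d) (Suc d)" "det E \<noteq> 0"
    "map_mat F (map_mat F E) = E" "N' \<in> carrier_mat d d"
    "sesqui N E = four_block_mat (N $$ (0,0) \<cdot>\<^sub>m 1\<^sub>m 1) (0\<^sub>m 1 d) (0\<^sub>m d 1) N'"
proof -
  let ?a = "N $$ (0,0)"
  define b where "b = mat 1 d (\<lambda>(i,j). N $$ (0, Suc j))"
  define b' where "b' = mat d 1 (\<lambda>(i,j). N $$ (Suc i, 0))"
  define D where "D = mat d d (\<lambda>(i,j). N $$ (Suc i, Suc j))"
  have c: "b \<in> carrier_mat 1 d" "b' \<in> carrier_mat d 1" "D \<in> carrier_mat d d"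
    by (auto simp: b_def b'_def D_def)
  have N_eq: "N = four_block_mat (?a \<cdot>\<^sub>m 1\<^sub>m 1) b b' D"
    by (subst four_block_first[OF N(1)], unfold b_def b'_def D_def, rule cong_four_block_mat) auto
  note nth = hermitian_nth[OF N]
  define e where "e = mat 1 d (\<lambda>(i,j). - (N $$ (Suc j, 0)) / ?a)"
  have e: "e \<in> carrier_mat 1 d" by (simp add: e_def)
  define E where "E = four_block_mat (1\<^sub>m 1) e (0\<^sub>m d 1) (1\<^sub>m d)"
  have E: "E \<in> carrier_mat (Suc d) (Suc d)" unfolding E_def
    using four_block_carrier_mat[of "1\<^sub>m 1" 1 1 "1\<^sub>m d" d d e "0\<^sub>m d 1"] by simp
  have detE: "det E = 1" unfolding E_def using e
    by (subst det_four_block_mat_lower_left_zero[of _ 1 _ d]) auto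
  have FE: "map_mat F E = four_block_mat (1\<^sub>m 1) (map_mat F e) (0\<^sub>m d 1) (1\<^sub>m d)"
    unfolding E_def using e
    by (subst map_four_block_mat[of _ 1 1 _ d _ d]) (auto simp: mat_hom_one intro!: cong_four_block_mat)
  have FFe: "map_mat F (map_mat F e) = e"
    by (intro eq_matI) (auto simp: e_def hom_distribs nth)
  have FFE: "map_mat F (map_mat F E) = E"
    unfolding FE using e
    by (subst map_four_block_mat[of _ 1 1 _ d _ d])
      (auto simp: mat_hom_one FFe E_def intro!: cong_four_block_mat)
  define X where "X = E\<^sup>T * N"
  have ET: "E\<^sup>T = four_block_mat (1\<^sub>m 1) (0\<^sub>m 1 d) (e\<^sup>T) (1\<^sub>m d)"
    unfolding E_def using e by (subst transpose_four_block_mat[of _ 1 1 _ d _ d]) auto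
  have z1: "e\<^sup>T * (?a \<cdot>\<^sub>m 1\<^sub>m 1) + 1\<^sub>m d * b' = 0\<^sub>m d 1"
    using e c a by (intro eq_matI) (auto simp: e_def b'_def scalar_prod_def)
  have z2: "(?a \<cdot>\<^sub>m 1\<^sub>m 1) * map_mat F e + b = 0\<^sub>m 1 d"
    using e c a by (intro eq_matI) (auto simp: e_def b_def scalar_prod_def hom_distribs nth)
  define N' where "N' = e\<^sup>T * b + D"
  have N': "N' \<in> carrier_mat d d" using e c by (simp add: N'_def)
  have "E\<^sup>T * N = four_block_mat (?a \<cdot>\<^sub>m 1\<^sub>m 1) b (0\<^sub>m d 1) N'"
    unfolding ET by (subst N_eq, subst mult_four_block_mat[of _ 1 1 _ d _ d _ _ 1 _ d])
      (use e c z1 in \<open>auto simp: N'_def intro!: cong_four_block_mat\<close>)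
  then have "sesqui N E = four_block_mat (?a \<cdot>\<^sub>m 1\<^sub>m 1) (0\<^sub>m 1 d) (0\<^sub>m d 1) N'"
    unfolding sesqui_def FE
    by (simp, subst mult_four_block_mat[of _ 1 1 _ d _ d _ _ 1 _ d])
      (use e c z2 N' in \<open>auto intro!: cong_four_block_mat\<close>)
  then show ?thesis using that[OF E _ FFE N'] detE by simp
qed

lemma hermitian_orthonormal_basis:
  assumes "N \<in> carrier_mat d d" "det N \<noteq> 0" "N\<^sup>T = map_mat F N"
  shows "\<exists>S\<in>carrier_mat d d. sesqui N S = 1\<^sub>m d"
  using assms
proof (induction d arbitrary: N)
  case 0
  then have "sesqui N N = 1\<^sub>m 0" by (intro eq_matI) (auto simp: sesqui_def)
  with 0 show ?case by blast
next
  case (Suc d)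
  have "N \<noteq> 0\<^sub>m (Suc d) (Suc d)" using Suc.prems(2) by auto
  then obtain v where v: "v \<in> carrier_vec (Suc d)" "map_vec F (map_vec F v) = v"
    "v \<bullet> (N *\<^sub>v map_vec F v) \<noteq> 0"
    using anisotropic_vector[OF Suc.prems(1,3)] by blast
  then have "v \<noteq> 0\<^sub>v (Suc d)" using Suc.prems(1) by auto
  then obtain P where P: "P \<in> carrier_mat (Suc d) (Suc d)" "det P \<noteq> 0" "col P 0 = v"
    "\<And>i j. i < Suc d \<Longrightarrow> 0 < j \<Longrightarrow> j < Suc d \<Longrightarrow> P $$ (i, j) \<in> {0, 1}"
    using nonzero_vec_basis_completion[OF v(1)] by metis
  \<comment> \<open>The first column is \<open>v\<close> and the others consist of 0 and 1. Thus
    \<open>N1\<close> is still Hermitian.\<close>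
  have FFP: "map_mat F (map_mat F P) = P"
  proof (rule eq_matI)
    fix i j assume "i < dim_row P" "j < dim_col P"
    then have ij: "i < Suc d" "j < Suc d" using P by auto
    show "map_mat F (map_mat F P) $$ (i,j) = P $$ (i,j)"
    proof (cases "j = 0")
      case True
      have "P $$ (i,0) = v $ i" using P ij by auto
      then show ?thesis using True arg_cong[OF v(2), of "\<lambda>w. w $ i"] ij P(1) v(1) by simp
    next
      case False
      then show ?thesis using P(4)[of i j] ij P(1) by auto
    qed
  qed auto
  define N1 where "N1 = sesqui N P"
  have N1: "N1 \<in> carrier_mat (Suc d) (Suc d)" "N1\<^sup>T = map_mat F N1"
    unfolding N1_def using sesqui_hermitian Suc.prems P FFP by auto
  have a: "N1 $$ (0,0) \<noteq> 0"
    unfolding N1_def using sesqui_0_0[OF Suc.prems(1) P(1)] P v by simp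
  obtain E N' where E: "E \<in> carrier_mat (Suc d) (Suc d)" "det E \<noteq> 0"
    "map_mat F (map_mat F E) = E" and N': "N' \<in> carrier_mat d d"
    and N1E: "sesqui N1 E = four_block_mat (N1 $$ (0,0) \<cdot>\<^sub>m 1\<^sub>m 1) (0\<^sub>m 1 d) (0\<^sub>m d 1) N'"
    using hermitian_diagonal_block[OF N1 a] by blast
  let ?N2 = "sesqui N1 E"
  have N2: "?N2 \<in> carrier_mat (Suc d) (Suc d)" "?N2\<^sup>T = map_mat F ?N2"
    using sesqui_hermitian N1 E by auto
  have "N' $$ (i, j) = ?N2 $$ (Suc i, Suc j)" if "i < d" "j < d" for i j
    unfolding N1E using that N' by simp
  then have "N'\<^sup>T = map_mat F N'"
    using N' hermitian_nth[OF N2] by (intro eq_matI) auto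
  moreover have "det N' \<noteq> 0"
  proof -
    have "det ?N2 \<noteq> 0"
      using det_sesqui[OF N1(1) E(1)] det_sesqui[OF Suc.prems(1) P(1)] Suc.prems P E
      by (simp add: N1_def)
    then show ?thesis unfolding N1E using N'
      by (subst (asm) det_four_block_mat_lower_left_zero[of _ 1 _ d]) auto
  qed
  ultimately obtain S' where S': "S' \<in> carrier_mat d d" "sesqui N' S' = 1\<^sub>m d"
    using Suc.IH[OF N'] by auto
  \<comment> \<open>Normalizing the first basis vector requires
    \<open>c * N1 $$ (0,0) * F c = 1\<close>, and \<open>c * F c\<close> is a
    \<open>(q + 1)\<close>-st power.\<close>
  obtain c where c: "c ^ (q + 1) = inverse (N1 $$ (0,0))"
    using nth_root_exists[of "q + 1"] by auto
  define S where "S = four_block_mat (c \<cdot>\<^sub>m 1\<^sub>m 1) (0\<^sub>m 1 d) (0\<^sub>m d 1) S'"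
  have S: "S \<in> carrier_mat (Suc d) (Suc d)"
    unfolding S_def using four_block_carrier_mat[of "c \<cdot>\<^sub>m 1\<^sub>m 1" 1 1 S' d d] S'(1) by simp
  have "sesqui ?N2 S = four_block_mat (1\<^sub>m 1) (0\<^sub>m 1 d) (0\<^sub>m d 1) (sesqui N' S')"
  proof -
    have ST: "S\<^sup>T = four_block_mat (c \<cdot>\<^sub>m 1\<^sub>m 1) (0\<^sub>m 1 d) (0\<^sub>m d 1) S'\<^sup>T"
      unfolding S_def using S' by (subst transpose_four_block_mat[of _ 1 1 _ d _ d]) (auto intro!: cong_four_block_mat eq_matI)
    have FS: "map_mat F S = four_block_mat (F c \<cdot>\<^sub>m 1\<^sub>m 1) (0\<^sub>m 1 d) (0\<^sub>m d 1) (map_mat F S')"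
      unfolding S_def using S' by (subst map_four_block_mat[of _ 1 1 _ d _ d])
         (auto simp: hom_distribs intro!: cong_four_block_mat)
    have "c * N1 $$ (0,0) * F c = 1" using c a by (simp add: F_eq field_simps)
    then have 1: "((c \<cdot>\<^sub>m 1\<^sub>m 1) * (N1 $$ (0,0) \<cdot>\<^sub>m 1\<^sub>m 1) + 0\<^sub>m 1 1) * (F c \<cdot>\<^sub>m 1\<^sub>m 1) + 0\<^sub>m 1 1
        = (1\<^sub>m 1 :: 'a mat)"
      by (intro eq_matI) (auto simp: scalar_prod_def)
    show ?thesis
      unfolding N1E unfolding sesqui_def ST FS
      by (subst mult_four_block_mat[of _ 1 1 _ d _ d _ _ 1 _ d];
          (subst mult_four_block_mat[of _ 1 1 _ d _ d _ _ 1 _ d])?)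
        (use S' N' 1 in \<open>auto simp: sesqui_def intro!: cong_four_block_mat\<close>)
  qed
  then have "sesqui N (P * E * S) = 1\<^sub>m (Suc d)"
    using S' Suc.prems P E S N1
    by (simp add: sesqui_sesqui[symmetric, of _ "Suc d"] N1_def)
  then show ?case using P E S by (intro bexI[of _ "P * E * S"]) auto
qed

text \<open>This is Lang's theorem for the Steinberg endomorphism with fixed points \<open>GU\<close>: applied to
  the square of \<open>F\<close>, Lang's theorem makes \<open>M\<close> Hermitian.\<close>

theorem unitary_lang:
  assumes M: "M \<in> carrier_mat d d" "det M \<noteq> 0"
  obtains S R where "S \<in> carrier_mat d d" "R \<in> carrier_mat d d" "S * R = 1\<^sub>m d" "R * S = 1\<^sub>m d"
    "M = S\<^sup>T * map_mat F S"
proof -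
  interpret F2: alg_closed_frobenius_power "\<lambda>x. F (F x)" "q\<^sup>2"
    unfolding alg_closed_frobenius_power_def by (rule frobenius_power_square)
  have FM: "map_mat F M \<in> carrier_mat d d" "det (map_mat F M) \<noteq> 0"
    using M by auto
  then obtain L where L: "L \<in> carrier_mat d d" "map_mat F M * L = 1\<^sub>m d" "L * map_mat F M = 1\<^sub>m d"
    using nonzero_det_inverse by metis
  have "det L \<noteq> 0" using inverse_imp_nonzero_det L FM by blast
  then have "det (L * M\<^sup>T) \<noteq> 0" using M L by (simp add: det_mult[of _ d] det_transpose)
  \<comment> \<open>The equation for \<open>X\<close> is exactly what makes
    \<open>N = sesqui M X\<close> Hermitian: as \<open>L\<close> inverts \<open>F(M)\<close>, it
    turns \<open>F(N) = F(X)^T F(M) F(F(X))\<close> into \<open>F(X)^T M^T X\<close>, the transpose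
    of \<open>N\<close>.\<close>
  with F2.lang[of "L * M\<^sup>T" d] L M obtain X where
    X: "X \<in> carrier_mat d d" "det X \<noteq> 0" "map_mat (\<lambda>x. F (F x)) X = L * M\<^sup>T * X"
    by auto
  have FFX: "map_mat F (map_mat F X) = L * (M\<^sup>T * X)"
  proof -
    have "map_mat F (map_mat F X) = map_mat (\<lambda>x. F (F x)) X" by (intro eq_matI) auto
    then show ?thesis using X L M by (simp add: assoc_mult_mat[of _ d d _ d _ d])
  qed
  define N where "N = sesqui M X"
  have "map_mat F N = (map_mat F X)\<^sup>T * map_mat F M * map_mat F (map_mat F X)"
    using X M by (simp add: N_def sesqui_def mat_hom_mult[of _ d d _ d] map_mat_transpose)
  also have "\<dots> = (map_mat F X)\<^sup>T * (map_mat F M * L) * (M\<^sup>T * X)"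
    unfolding FFX using X M L
    by (subst (1 2) assoc_mult_mat[of _ d d _ d _ d])
       (auto simp: assoc_mult_mat[of _ d d L d "M\<^sup>T * X" d, symmetric])
  also have "\<dots> = N\<^sup>T"
    using X M L by (simp add: N_def sesqui_def assoc_mult_mat[of _ d d _ d _ d] transpose_mult[of _ d d _ d])
  finally have herm: "N\<^sup>T = map_mat F N" ..
  have N: "N \<in> carrier_mat d d" "det N \<noteq> 0"
    using M X by (simp_all add: N_def det_sesqui[of _ d])
  from hermitian_orthonormal_basis[OF N herm] obtain S where
    S: "S \<in> carrier_mat d d" "sesqui N S = 1\<^sub>m d" by blast
  \<comment> \<open>The columns of \<open>R\<close> are orthonormal for \<open>M\<close>. Its
    inverse, which takes over the name \<open>S\<close> below, is therefore the desired factor of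
    \<open>M\<close>.\<close>
  define R where "R = X * S"
  have R: "R \<in> carrier_mat d d" "sesqui M R = 1\<^sub>m d"
    using X S M by (simp_all add: R_def N_def sesqui_sesqui[of _ d])
  have "det R \<noteq> 0" using det_sesqui[OF M(1) R(1)] R(2) by auto
  with R obtain S where S: "S \<in> carrier_mat d d" "R * S = 1\<^sub>m d" "S * R = 1\<^sub>m d"
    using nonzero_det_inverse by metis
  have RTS: "S\<^sup>T * R\<^sup>T = 1\<^sub>m d" using S R by (simp add: transpose_mult[of _ d d _ d, symmetric])
  have FRS: "map_mat F R * map_mat F S = 1\<^sub>m d" 
    using S R by (simp add: mat_hom_mult[of _ d d _ d, symmetric] mat_hom_one)
  have "S\<^sup>T * map_mat F S = S\<^sup>T * sesqui M R * map_mat F S"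
    unfolding R(2) using S by simp
  also have "\<dots> = (S\<^sup>T * R\<^sup>T) * M * (map_mat F R * map_mat F S)"
    unfolding sesqui_def using R(1) S(1) M by (simp add: assoc_mult_mat[of _ d d _ d _ d])
  also have "\<dots> = M" using M RTS FRS by simp
  finally show ?thesis using that[OF S(1) R(1) S(3,2)] by simp
qed

end

section \<open>Triangularisation\<close>

lemma similar_upper_triangular:
  fixes A :: "'a::alg_closed_field mat"
  assumes "A \<in> carrier_mat d d"
  shows "\<exists>B. B \<in> carrier_mat d d \<and> similar_mat A B \<and> upper_triangular B"
  using assms
proof (induction d arbitrary: A)
  case 0
  then show ?case using similar_mat_refl by (intro exI[of _ A]) auto
next
  case (Suc d)
  let ?c = "carrier_mat (Suc d) (Suc d)"
  have A: "A \<in> ?c" by fact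
  obtain e where "poly (char_poly A) e = 0"
    using alg_closed_imp_poly_has_root[of "char_poly A"] degree_monic_char_poly[OF A] by auto
  then obtain v where v: "v \<in> carrier_vec (Suc d)" "v \<noteq> 0\<^sub>v (Suc d)" "A *\<^sub>v v = e \<cdot>\<^sub>v v"
    using eigenvalue_root_char_poly[OF A, of e] A unfolding eigenvalue_def eigenvector_def by auto
  from nonzero_vec_basis_completion[OF v(1,2)] obtain P where
    P: "P \<in> ?c" "det P \<noteq> 0" "col P 0 = v" by metis
  from nonzero_det_inverse[OF P(1,2)] obtain R where
    R: "R \<in> ?c" "P * R = 1\<^sub>m (Suc d)" "R * P = 1\<^sub>m (Suc d)" by blast
  define C where "C = R * A * P"
  have C: "C \<in> ?c" using R A P by (simp add: C_def)
  have "P * C * R = (P * R) * A * (P * R)"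
    using P(1) R(1) A by (simp add: C_def assoc_mult_mat[of _ "Suc d" "Suc d" _ "Suc d" _ "Suc d"])
  then have "A = P * C * R" using A by (simp add: R)
  then have sim: "similar_mat A C"
    using A P R C by (intro similar_matI[of _ _ P R "Suc d"]) auto
  have Rv: "R *\<^sub>v v = unit_vec (Suc d) 0"
    using R P col_mult2[OF R(1) P(1), of 0] by simp
  have "col C 0 = R *\<^sub>v (A *\<^sub>v v)"
    using R A P col_mult2[OF mult_carrier_mat[OF R(1) A] P(1), of 0] v by (simp add: C_def)
  also have "\<dots> = e \<cdot>\<^sub>v unit_vec (Suc d) 0"
    unfolding v(3) using R v by (simp add: mult_mat_vec[of _ "Suc d" "Suc d"] Rv)
  finally have colC: "col C 0 = e \<cdot>\<^sub>v unit_vec (Suc d) 0" .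
  have C0: "C $$ (i, 0) = (if i = 0 then e else 0)" if "i < Suc d" for i
    using arg_cong[OF colC, of "\<lambda>w. w $ i"] that C by auto
  define b where "b = mat 1 d (\<lambda>(i,j). C $$ (0, Suc j))"
  define A' where "A' = mat d d (\<lambda>(i,j). C $$ (Suc i, Suc j))"
  have b: "b \<in> carrier_mat 1 d" and A': "A' \<in> carrier_mat d d" by (auto simp: b_def A'_def)
  define E where "E = e \<cdot>\<^sub>m 1\<^sub>m 1"
  have E: "E \<in> carrier_mat 1 1" "upper_triangular E" by (auto simp: E_def)
  have C_eq: "C = four_block_mat E b (0\<^sub>m d 1) A'"
    by (subst four_block_first[OF C], unfold b_def A'_def, rule cong_four_block_mat)
       (auto simp: C0 E_def)
  obtain B' where B': "B' \<in> carrier_mat d d" "similar_mat A' B'" "upper_triangular B'"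
    using Suc.IH[OF A'] by blast
  obtain b' where "b' \<in> carrier_mat 1 d" "similar_mat C (four_block_mat E b' (0\<^sub>m d 1) B')"
    unfolding C_eq using similar_mat_four_block_0_ex[OF similar_mat_refl[OF E(1)] B'(2) b E(1) A'] by blast
  then show ?case
    using similar_mat_trans[OF sim] upper_triangular_four_block[OF E(1) B'(1) E(2) B'(3), of b']
      four_block_carrier_mat[OF E(1) B'(1), of b' "0\<^sub>m d 1"] by auto
qed

section \<open>Traces and the eigenvalues of powers\<close>

lemma mat_trace_mult_commute:
  fixes A B :: "'a::comm_semiring_0 mat"
  assumes "A \<in> carrier_mat m n" "B \<in> carrier_mat n m"
  shows "mat_trace (A * B) = mat_trace (B * A)"
proof -
  have "mat_trace (A * B) = (\<Sum>i<m. \<Sum>j<n. A $$ (i,j) * B $$ (j,i))"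
    using assms by (simp add: mat_trace_def scalar_prod_def atLeast0LessThan)
  also have "\<dots> = (\<Sum>j<n. \<Sum>i<m. B $$ (j,i) * A $$ (i,j))"
    by (subst sum.swap) (simp add: mult.commute)
  also have "\<dots> = mat_trace (B * A)"
    using assms by (simp add: mat_trace_def scalar_prod_def atLeast0LessThan)
  finally show ?thesis .
qed

lemma mat_trace_conjugate:
  fixes A :: "'a::comm_semiring_1 mat"
  assumes "P \<in> carrier_mat d d" "A \<in> carrier_mat d d" "R \<in> carrier_mat d d" "R * P = 1\<^sub>m d"
  shows "mat_trace (P * A * R) = mat_trace A"
  using mat_trace_mult_commute[of "P * A" d d R] assms
  by (simp add: assoc_mult_mat[of R d d P d A d, symmetric])

lemma mat_trace_similar:
  fixes A B :: "'a::comm_ring_1 mat"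
  assumes "similar_mat A B"
  shows "mat_trace A = mat_trace B"
  using assms mat_trace_conjugate by (elim similar_matD[elim_format]) auto

lemma upper_triangular_mult:
  fixes A B :: "'a::semiring_1 mat"
  assumes "A \<in> carrier_mat d d" "B \<in> carrier_mat d d" "upper_triangular A" "upper_triangular B"
  shows "upper_triangular (A * B)" "i < d \<Longrightarrow> (A * B) $$ (i,i) = A $$ (i,i) * B $$ (i,i)"
proof -
  have eq: "(A * B) $$ (i,j) = (\<Sum>k<d. A $$ (i,k) * B $$ (k,j))" if "i < d" "j < d" for i j
    using assms that by (simp add: scalar_prod_def atLeast0LessThan)
  have z: "A $$ (i,k) * B $$ (k,j) = 0" if "i < d" "k < d" "k < i \<or> j < k" for i j k
    using that assms by (auto dest: upper_triangularD)
  show "upper_triangular (A * B)"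
  proof (rule upper_triangularI)
    fix i j assume "j < i" "i < dim_row (A * B)"
    then have ij: "j < i" "i < d" "j < d" using assms by auto
    then have "A $$ (i,k) * B $$ (k,j) = 0" if "k < d" for k
      using z[of i k j] that by linarith
    then show "(A * B) $$ (i, j) = 0" using eq[of i j] ij by simp
  qed
  assume i: "i < d"
  have "(\<Sum>k<d. A $$ (i,k) * B $$ (k,i)) = (\<Sum>k\<in>{i}. A $$ (i,k) * B $$ (k,i))"
    by (rule sum.mono_neutral_right) (use i z[of i _ i] in \<open>auto simp: neq_iff\<close>)
  then show "(A * B) $$ (i,i) = A $$ (i,i) * B $$ (i,i)" using eq[OF i i] by simp
qed

lemma upper_triangular_pow:
  fixes A :: "'a::comm_semiring_1 mat"
  assumes "A \<in> carrier_mat d d" "upper_triangular A"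
  shows "upper_triangular (A ^\<^sub>m k) \<and> (\<forall>i<d. (A ^\<^sub>m k) $$ (i,i) = A $$ (i,i) ^ k)"
proof (induction k)
  case 0
  then show ?case using assms by auto
next
  case (Suc k)
  then show ?case
    using upper_triangular_mult[of "A ^\<^sub>m k" d A] assms by (auto simp: mult.commute)
qed

text \<open>One triangularization conjugates all powers at once, so a single list serves every
  \<open>k\<close>. This relates the spectrum of \<open>g^q\<close> to that of
  \<open>g\<close>.\<close>

lemma eigenvalue_list:
  fixes A :: "'a::alg_closed_field mat"
  assumes A: "A \<in> carrier_mat d d"
  obtains es where "length es = d"
    "\<And>k. char_poly (A ^\<^sub>m k) = (\<Prod>e\<leftarrow>es. [:- (e ^ k), 1:])"
    "\<And>k. mat_trace (A ^\<^sub>m k) = (\<Sum>e\<leftarrow>es. e ^ k)"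
proof -
  obtain B where B: "B \<in> carrier_mat d d" "similar_mat A B" "upper_triangular B"
    using similar_upper_triangular[OF A] by blast
  then obtain P R where w: "similar_mat_wit A B P R" unfolding similar_mat_def by blast
  have sim: "similar_mat (A ^\<^sub>m k) (B ^\<^sub>m k)" for k
    using similar_mat_wit_pow[OF w] unfolding similar_mat_def by blast
  note pow = upper_triangular_pow[OF B(1,3)]
  have Bk: "B ^\<^sub>m k \<in> carrier_mat d d" for k using B by simp
  have diag: "diag_mat (B ^\<^sub>m k) = map (\<lambda>e. e ^ k) (diag_mat B)" for k
    unfolding diag_mat_def using pow[of k] B(1) by simp
  show ?thesis
  proof (rule that[of "diag_mat B"])
    show "length (diag_mat B) = d" using B(1) by (simp add: diag_mat_def)
    fix k
    show "char_poly (A ^\<^sub>m k) = (\<Prod>e\<leftarrow>diag_mat B. [:- (e ^ k), 1:])"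
      unfolding char_poly_similar[OF sim]
        char_poly_upper_triangular[OF Bk conjunct1[OF pow]] diag by (simp add: comp_def)
    have "mat_trace (A ^\<^sub>m k) = (\<Sum>i<d. B $$ (i,i) ^ k)"
      unfolding mat_trace_similar[OF sim] unfolding mat_trace_def using pow[of k] B(1) by simp
    also have "\<dots> = (\<Sum>e\<leftarrow>diag_mat B. e ^ k)"
      using B(1) by (simp add: diag_mat_def comp_def interv_sum_list_conv_sum_set_nat atLeast0LessThan)
    finally show "mat_trace (A ^\<^sub>m k) = (\<Sum>e\<leftarrow>diag_mat B. e ^ k)" .
  qed
qed

section \<open>Roots of characteristic polynomials and unipotent matrices\<close>

lemma linear_factors_nonzero: "(\<Prod>e\<leftarrow>es. [:- f e, 1:]) \<noteq> (0 :: 'a::idom poly)"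
  by (induction es) (simp_all del: mult_pCons_left)

lemma proots_linear_factors: "proots (\<Prod>e\<leftarrow>es. [:- f e, 1:]) = mset (map f es)"
  for f :: "'b \<Rightarrow> 'a::idom"
proof (induction es)
  case (Cons e es)
  then show ?case
    using proots_mult[of "[:- f e, 1:]" "\<Prod>e\<leftarrow>es. [:- f e, 1:]"] linear_factors_nonzero[of f es]
    by (simp del: mult_pCons_left)
qed simp

text \<open>Induction on the distance \<open>k\<close> from the diagonal. When the entries nearer to
  the diagonal vanish, those at distance \<open>k\<close> add up under multiplication, so
  \<open>B ^\<^sub>m n\<close> has \<open>n\<close> times the entry of \<open>B\<close>. This entry
  of the identity is 0, and \<open>n\<close> is nonzero in the field.\<close>

lemma unipotent_pow_eq_one_upper_triangular:
  fixes B :: "'a::field mat"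
  assumes B: "B \<in> carrier_mat d d" "upper_triangular B" "B ^\<^sub>m n = 1\<^sub>m d"
    and diag: "\<And>i. i < d \<Longrightarrow> B $$ (i,i) = 1" and n: "of_nat n \<noteq> (0::'a)"
  shows "B = 1\<^sub>m d"
proof -
  have "B $$ (i, i + k) = 0" if "0 < k" "i + k < d" for i k
    using that
  proof (induction k arbitrary: i rule: less_induct)
    case (less k)
    define j where "j = i + k"
    have ij: "i < j" "j < d" using less.prems by (auto simp: j_def)
    have small: "B $$ (i, l) = 0" if "i < l" "l < j" for l
      using less.IH[of "l - i" i] that ij by (simp add: j_def)
    have small': "B $$ (l, j) = 0" if "i < l" "l < j" for l
      using less.IH[of "j - l" l] that ij by (simp add: j_def)
    have low: "(B ^\<^sub>m m) $$ (i, l) = 0" if "l < i" for m l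
      using upper_triangular_pow[OF B(1,2), of m] that B(1) ij by (auto dest!: upper_triangularD)
    have "(B ^\<^sub>m m) $$ (i, j) = of_nat m * B $$ (i, j)" for m
    proof (induction m)
      case 0
      then show ?case using B(1) ij by simp
    next
      case (Suc m)
      have "(B ^\<^sub>m Suc m) $$ (i, j) = (\<Sum>l<d. (B ^\<^sub>m m) $$ (i, l) * B $$ (l, j))"
        using B(1) ij by (simp add: scalar_prod_def atLeast0LessThan)
      also have "\<dots> = (\<Sum>l\<in>{i,j}. (B ^\<^sub>m m) $$ (i, l) * B $$ (l, j))"
      proof (rule sum.mono_neutral_right)
        show "\<forall>l\<in>{..<d} - {i, j}. (B ^\<^sub>m m) $$ (i, l) * B $$ (l, j) = 0"
        proof
          fix l assume "l \<in> {..<d} - {i, j}"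
          then consider "l < i" | "i < l" "l < j" | "j < l" "l < d" by fastforce
          then show "(B ^\<^sub>m m) $$ (i, l) * B $$ (l, j) = 0"
            using low small' B(1,2) by cases (auto dest: upper_triangularD)
        qed
      qed (use ij in auto)
      also have "\<dots> = of_nat (Suc m) * B $$ (i, j)"
        using ij upper_triangular_pow[OF B(1,2), of m] diag by (simp add: Suc algebra_simps)
      finally show ?case .
    qed
    from this[of n] n B(3) ij show ?case by (simp add: j_def)
  qed
  note up = this
  show ?thesis
  proof (rule eq_matI)
    fix i j assume "i < dim_row (1\<^sub>m d :: 'a mat)" "j < dim_col (1\<^sub>m d :: 'a mat)"
    then have "i < d" "j < d" by auto
    then show "B $$ (i,j) = 1\<^sub>m d $$ (i,j)"
      using up[of "j - i" i] diag B(1,2) upper_triangularD[OF B(2), of j i]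
      by (cases i j rule: linorder_cases) auto
  qed (use B in auto)
qed

lemma unipotent_pow_eq_one:
  fixes A :: "'a::alg_closed_field mat"
  assumes A: "A \<in> carrier_mat d d" "A ^\<^sub>m n = 1\<^sub>m d" and n: "of_nat n \<noteq> (0::'a)"
    and ev: "\<And>e. poly (char_poly A) e = 0 \<Longrightarrow> e = 1"
  shows "A = 1\<^sub>m d"
proof -
  obtain B where B: "B \<in> carrier_mat d d" "similar_mat A B" "upper_triangular B"
    using similar_upper_triangular[OF A(1)] by blast
  then obtain P R where w: "similar_mat_wit A B P R" unfolding similar_mat_def by blast
  have "B $$ (i,i) = 1" if "i < d" for i
  proof (rule ev)
    have "B $$ (i,i) \<in> set (diag_mat B)" using B(1) that by (simp add: diag_mat_def)
    then show "poly (char_poly A) (B $$ (i,i)) = 0"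
      unfolding char_poly_similar[OF B(2)] char_poly_upper_triangular[OF B(1,3)]
      by (auto simp: poly_prod_list prod_list_zero_iff)
  qed
  moreover have "B ^\<^sub>m n = 1\<^sub>m d"
    using similar_mat_wit_pow_id[OF similar_mat_wit_sym[OF w], of n] A similar_mat_witD2[OF A(1) w]
    by simp
  ultimately have "B = 1\<^sub>m d"
    using unipotent_pow_eq_one_upper_triangular[OF B(1,3) _ _ n] by blast
  then show ?thesis using similar_mat_witD2[OF A(1) w] by simp
qed

text \<open>Apply \<open>F\<close> to \<open>char_poly A\<close>: the coefficients stay fixed, while
  the linear factors become those of the power of \<open>A\<close>.\<close>

lemma (in alg_closed_frobenius_power) char_poly_pow_fixed:
  assumes A: "A \<in> carrier_mat d d" "map_mat F A = A"
  shows "char_poly (A ^\<^sub>m q) = char_poly A"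
proof -
  obtain es where es: "\<And>k. char_poly (A ^\<^sub>m k) = (\<Prod>e\<leftarrow>es. [:- (e ^ k), 1:])"
    using eigenvalue_list[OF A(1)] by metis
  interpret mp: map_poly_inj_idom_hom F ..
  have "char_poly A = (\<Prod>e\<leftarrow>es. [:- e, 1:])" using es[of 1] A by simp
  moreover have "map_poly F (\<Prod>e\<leftarrow>es. [:- e, 1:]) = (\<Prod>e\<leftarrow>es. [:- (e ^ q), 1:])"
    by (induction es) (simp_all add: hom_uminus F_eq[symmetric] mp.hom_mult del: mult_pCons_left)
  moreover have "map_poly F (char_poly A) = char_poly A"
    using char_poly_hom[OF A(1)] A(2) by simp
  ultimately show ?thesis by (simp add: es)
qed

section \<open>Galois conjugates of roots of unity\<close>

lemma prime_dvd_add_power: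
  fixes x y :: "'a::comm_ring_1"
  assumes p: "prime p"
  shows "of_nat p dvd (x + y) ^ p - (x ^ p + y ^ p)"
proof -
  have p0: "p \<noteq> 0" using p by auto
  have "{..p} = insert 0 (insert p {1..<p})" using p0 by auto
  then have "(x + y) ^ p = y ^ p + x ^ p + (\<Sum>k\<in>{1..<p}. of_nat (p choose k) * x ^ k * y ^ (p - k))"
    using p0 by (simp add: binomial_ring)
  moreover have "of_nat p dvd (\<Sum>k\<in>{1..<p}. of_nat (p choose k) * x ^ k * y ^ (p - k))"
  proof (rule dvd_sum)
    fix k assume "k \<in> {1..<p}"
    then have "p dvd (p choose k)" using p by (intro dvd_choose_prime) auto
    then obtain c where "p choose k = p * c" by (elim dvdE)
    then have "of_nat p dvd (of_nat (p choose k) :: 'a)" by simp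
    then show "of_nat p dvd of_nat (p choose k) * x ^ k * y ^ (p - k)" by (simp add: dvd_mult2)
  qed
  ultimately show ?thesis by (simp add: algebra_simps)
qed

lemma int_fermat:
  fixes a :: int
  assumes "prime p"
  shows "int p dvd a ^ p - a"
proof (induction a rule: int_induct[where k = 0])
  case base
  then show ?case using assms by (auto simp: power_0_left)
next
  case (step1 i)
  have "(i + 1) ^ p - (i + 1) = ((i + 1) ^ p - (i ^ p + 1 ^ p)) + (i ^ p - i)" by simp
  then show ?case using prime_dvd_add_power[OF assms, of i 1] step1 by (metis dvd_add of_nat_id)
next
  case (step2 i)
  have "(i - 1) ^ p - (i - 1) = (i ^ p - i) - ((i - 1 + 1) ^ p - ((i - 1) ^ p + 1 ^ p))" by simp
  then show ?case using prime_dvd_add_power[OF assms, of "i - 1" 1] step2 by (metis dvd_diff of_nat_id)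
qed

text \<open>Modulo \<open>p\<close>, raising to the \<open>p\<close>-th power is additive and fixes
  the coefficients by Fermat's little theorem. The congruence compares the values of
  \<open>f\<close> at \<open>w\<close> and at \<open>w ^ p\<close> in Dedekind's argument.\<close>

lemma prime_dvd_pcompose_monom_diff_power:
  fixes f :: "int poly"
  assumes p: "prime p"
  shows "of_nat p dvd pcompose f (monom 1 p) - f ^ p"
proof (induction f)
  case 0
  then show ?case using p by (auto simp: power_0_left)
next
  case (pCons a f)
  let ?X = "monom 1 1 :: int poly"
  have X: "monom 1 p = ?X ^ p" by (simp add: monom_power)
  have eq: "pCons a f = [:a:] + ?X * f" by (simp add: monom_altdef)
  have "[:a:] - [:a:] ^ p = - of_int (a ^ p - a)"
    by (simp add: of_int_poly poly_const_pow)
  moreover have "(of_nat p :: int poly) dvd of_int (a ^ p - a)"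
    using int_fermat[OF p, of a] by (metis of_int_of_nat_eq dvdE dvd_triv_left of_int_mult)
  ultimately have 1: "of_nat p dvd [:a:] - [:a:] ^ p" by (simp only: dvd_minus_iff)
  have 2: "of_nat p dvd ?X ^ p * (pcompose f (monom 1 p) - f ^ p)" using pCons.IH by simp
  have 3: "of_nat p dvd ([:a:] + ?X * f) ^ p - ([:a:] ^ p + (?X * f) ^ p)"
    by (rule prime_dvd_add_power[OF p])
  have "pcompose (pCons a f) (monom 1 p) - pCons a f ^ p =
      ([:a:] - [:a:] ^ p) + ?X ^ p * (pcompose f (monom 1 p) - f ^ p)
      - (([:a:] + ?X * f) ^ p - ([:a:] ^ p + (?X * f) ^ p))"
    unfolding pcompose_pCons unfolding eq X by (simp add: power_mult_distrib algebra_simps)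
  then show ?case using 1 2 3 by (metis dvd_add dvd_diff)
qed

section \<open>Integer polynomials at roots of unity\<close>

abbreviation ipoly :: "int poly \<Rightarrow> 'a::field_char_0 \<Rightarrow> 'a" where
  "ipoly f x \<equiv> poly (of_int_poly f) x"

text \<open>Multiplication by \<open>f w\<close> on the powers of \<open>w\<close> is given by a circulant integer matrix, of which
  \<open>f w\<close> is therefore an eigenvalue.\<close>

lemma algebraic_int_ipoly_root_of_unity:
  fixes w :: "'a::field_char_0"
  assumes w: "w ^ n = 1" and n: "0 < n"
  shows "algebraic_int (ipoly f w)"
proof -
  define M where "M = mat n n (\<lambda>(i,j). \<Sum>t\<le>degree f. if (i + t) mod n = j then coeff f t else 0)"
  have M: "M \<in> carrier_mat n n" by (simp add: M_def)
  define v where "v = vec n (\<lambda>j. w ^ j)"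
  have v: "v \<in> carrier_vec n" by (simp add: v_def)
  have wmod: "w ^ (k mod n) = w ^ k" for k
  proof -
    have "w ^ k = w ^ (n * (k div n) + k mod n)" by simp
    then show ?thesis by (simp only: power_add power_mult w) simp
  qed
  have "map_mat of_int M *\<^sub>v v = ipoly f w \<cdot>\<^sub>v v"
  proof (rule eq_vecI)
    fix i assume "i < dim_vec (ipoly f w \<cdot>\<^sub>v v)"
    then have i: "i < n" by (simp add: v_def)
    have "(map_mat of_int M *\<^sub>v v) $ i =
      (\<Sum>j<n. (\<Sum>t\<le>degree f. if (i + t) mod n = j then of_int (coeff f t) else 0) * w ^ j)"
      using i by (simp add: M_def v_def scalar_prod_def atLeast0LessThan if_distrib[of of_int] cong: if_cong)
    also have "\<dots> = (\<Sum>t\<le>degree f. \<Sum>j<n. if j = (i + t) mod n then of_int (coeff f t) * w ^ j else 0)"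
      unfolding sum_distrib_right by (subst sum.swap) (intro sum.cong, auto)
    also have "\<dots> = (\<Sum>t\<le>degree f. of_int (coeff f t) * w ^ (i + t))"
      using n by (intro sum.cong) (simp_all add: wmod)
    also have "\<dots> = ipoly f w * w ^ i"
      by (simp add: poly_altdef sum_distrib_left sum_distrib_right power_add ac_simps)
    finally show "(map_mat of_int M *\<^sub>v v) $ i = (ipoly f w \<cdot>\<^sub>v v) $ i"
      using i by (simp add: v_def)
  qed (use M in \<open>auto simp: v_def\<close>)
  moreover have "v \<noteq> 0\<^sub>v n"
  proof
    assume "v = 0\<^sub>v n"
    then have "v $ 0 = 0\<^sub>v n $ 0" by simp
    then show False using n by (simp add: v_def)
  qed
  ultimately have "eigenvalue (map_mat of_int M) (ipoly f w)"
    using v M unfolding eigenvalue_def eigenvector_def by auto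
  then have "poly (char_poly (map_mat of_int M)) (ipoly f w) = 0"
    using eigenvalue_root_char_poly[of "map_mat of_int M :: 'a mat" n] M by simp
  then have "ipoly (char_poly M) (ipoly f w) = 0"
    by (simp add: of_int_hom.char_poly_hom[OF M])
  moreover have "lead_coeff (char_poly M) = 1" using degree_monic_char_poly[OF M] by simp
  ultimately show ?thesis by (auto simp: algebraic_int_altdef_ipoly)
qed

text \<open>The value \<open>ipoly f w\<close> is the rational number \<open>a / p\<close> and an
  algebraic integer, hence an integer. So divisibility by \<open>p\<close> descends from the ring
  generated by \<open>w\<close> to the integers.\<close>

lemma prime_dvd_of_ipoly:
  fixes w :: "'a::field_char_0"
  assumes "w ^ n = 1" "0 < n" "prime p" "of_nat a = of_nat p * ipoly f w"
  shows "p dvd a"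
proof -
  have "ipoly f w = of_nat a / of_nat p" using assms by (auto simp: field_simps)
  then have "ipoly f w \<in> \<rat>" by simp
  then have "ipoly f w \<in> \<int>"
    using rational_algebraic_int_is_int algebraic_int_ipoly_root_of_unity assms by blast
  then obtain z where "ipoly f w = of_int z" by (elim Ints_cases)
  with assms(4) have "of_int (int a) = (of_int (int p * z) :: 'a)" by simp
  then have "int a = int p * z" by (simp only: of_int_eq_iff)
  then have "int p dvd int a" by simp
  then show ?thesis by simp
qed

text \<open>Gauss's lemma gives divisibility with integer coefficients: \<open>f\<close> is the
  primitive part of an annihilating polynomial of least degree, so the scalar in a pseudo-division
  by \<open>f\<close> divides the content of the quotient and cancels.\<close>

lemma int_minimal_polynomial:
  fixes w :: "'a::field_char_0"
  assumes "ipoly g w = 0" "g \<noteq> 0"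
  obtains f where "ipoly f w = 0" "\<And>h. ipoly h w = 0 \<Longrightarrow> f dvd h"
proof -
  define P where "P g = (ipoly g w = 0 \<and> g \<noteq> 0)" for g
  obtain f0 where f0: "P f0" "\<And>g. P g \<Longrightarrow> degree f0 \<le> degree g"
    using assms arg_min_nat_lemma[of P g degree] unfolding P_def by blast
  define f where "f = primitive_part f0"
  have nz: "f0 \<noteq> 0" "content f0 \<noteq> 0" using f0 by (auto simp: P_def)
  then have f: "content f = 1" "f \<noteq> 0" "degree f = degree f0" by (simp_all add: f_def)
  have "ipoly (Polynomial.smult (content f0) f) w = 0" using f0 by (simp add: f_def P_def)
  then have root: "ipoly f w = 0" using nz by (simp add: of_int_hom.map_poly_hom_smult)
  moreover have "f dvd h" if h: "ipoly h w = 0" for h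
  proof -
    define r where "r = pseudo_mod h f"
    obtain a q where aq: "a \<noteq> 0" "Polynomial.smult a h = f * q + r"
      using pseudo_mod(1)[OF f(2), of h] unfolding r_def by blast
    have "r = Polynomial.smult a h - f * q" using aq by simp
    then have "ipoly r w = 0"
      using h root by (simp add: of_int_poly_hom.hom_minus of_int_poly_hom.hom_mult of_int_hom.map_poly_hom_smult)
    then have "r \<noteq> 0 \<Longrightarrow> degree f0 \<le> degree r" by (intro f0(2)) (simp add: P_def)
    moreover have "r = 0 \<or> degree r < degree f" unfolding r_def by (rule pseudo_mod(2)[OF f(2)])
    ultimately have "r = 0" using f(3) by (metis leD)
    then have eq: "Polynomial.smult a h = f * q" using aq by simp
    have "normalize a * content h = content q"
      using arg_cong[OF eq, of content] f(1) by (simp add: content_mult)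
    then have "normalize a dvd content q" by (metis dvd_triv_left)
    then have "a dvd content q" by simp
    then have "[:a:] dvd q" by (simp add: const_poly_dvd_iff_dvd_content)
    then obtain q' where "q = [:a:] * q'" by (elim dvdE)
    then have "Polynomial.smult a h = Polynomial.smult a (f * q')" using eq by simp
    then have "h = f * q'" using aq(1) by (metis smult_cancel)
    then show ?thesis by simp
  qed
  ultimately show ?thesis using that by blast
qed

text \<open>Dedekind's argument. If the minimal polynomial \<open>f\<close> is nonzero at
  \<open>u = w ^ p\<close>, then its cofactor \<open>k\<close> in \<open>X^n - 1\<close> vanishes
  there, and differentiating gives \<open>n u^(n-1) = f(u) k'(u)\<close>. Modulo \<open>p\<close>,
  however, \<open>f(u)\<close> is \<open>f(w)^p = 0\<close>, so \<open>p\<close> would divide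
  \<open>n\<close>.\<close>

lemma ipoly_root_of_unity_prime_power:
  fixes w :: "'a::field_char_0"
  assumes w: "w ^ n = 1" and n: "0 < n" and p: "prime p" "\<not> p dvd n" and h: "ipoly h w = 0"
  shows "ipoly h (w ^ p) = 0"
proof -
  define g where "g = monom 1 n - (1 :: int poly)"
  have ipoly_g: "ipoly g x = x ^ n - 1" for x :: 'a
    by (simp add: g_def of_int_poly_hom.hom_minus poly_monom)
  have "g \<noteq> 0" using n by (auto simp: g_def monom_eq_1_iff)
  moreover have "ipoly g w = 0" using w by (simp add: ipoly_g)
  ultimately obtain f where f: "ipoly f w = 0" "\<And>h. ipoly h w = 0 \<Longrightarrow> f dvd h"
    using int_minimal_polynomial by blast
  define u where "u = w ^ p"
  have u: "u ^ n = 1" using w by (metis u_def power_mult mult.commute power_one)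
  from f(2) \<open>ipoly g w = 0\<close> obtain k where k: "g = f * k" by blast
  obtain K where K: "pcompose f (monom 1 p) - f ^ p = of_nat p * K"
    using prime_dvd_pcompose_monom_diff_power[OF p(1), of f] by (elim dvdE)
  have pc: "ipoly (pcompose F (monom 1 p)) w = ipoly F u" for F
    by (simp add: of_int_hom.map_poly_pcompose poly_pcompose poly_monom u_def)
  have "pcompose f (monom 1 p) = of_nat p * K + f ^ p" using K by (simp add: algebra_simps)
  then have "ipoly f u = of_nat p * ipoly K w + ipoly f w ^ p"
    using pc[of f] by (simp add: of_int_poly_hom.hom_add of_int_poly_hom.hom_mult of_int_poly_hom.hom_power
        of_nat_poly of_int_hom.map_poly_hom_smult)
  then have fu: "ipoly f u = of_nat p * ipoly K w" using f(1) p(1) by (auto simp: power_0_left)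
  have "ipoly f u = 0"
  proof (rule ccontr)
    assume "ipoly f u \<noteq> 0"
    moreover have "ipoly f u * ipoly k u = 0"
      using ipoly_g[of u] u by (simp add: k of_int_poly_hom.hom_mult)
    ultimately have ku: "ipoly k u = 0" by simp
    have "ipoly (pderiv g) u = of_nat n * u ^ (n - 1)"
      by (simp add: g_def pderiv_diff pderiv_monom of_int_hom.map_poly_hom_monom poly_monom)
    also have "pderiv g = f * pderiv k + k * pderiv f" by (simp add: k pderiv_mult)
    finally have "of_nat n * u ^ (n - 1) = ipoly f u * ipoly (pderiv k) u"
      by (simp add: of_int_poly_hom.hom_add of_int_poly_hom.hom_mult ku)
    then have "of_nat n * (u ^ (n - 1) * u) = of_nat p * (ipoly K w * ipoly (pderiv k) u * u)"
      by (simp add: fu)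
    also have "u ^ (n - 1) * u = 1" using u n by (metis power_minus_mult)
    also have "ipoly K w * ipoly (pderiv k) u * u
        = ipoly (K * pcompose (pderiv k) (monom 1 p) * monom 1 p) w"
      by (simp add: of_int_poly_hom.hom_mult pc poly_monom u_def[symmetric])
    finally have "of_nat n = of_nat p * ipoly (K * pcompose (pderiv k) (monom 1 p) * monom 1 p) w" by simp
    then have "p dvd n" by (rule prime_dvd_of_ipoly[OF w n p(1)])
    with p(2) show False by simp
  qed
  moreover obtain r where "h = f * r" using f(2)[OF h] by blast
  ultimately show ?thesis by (simp add: of_int_poly_hom.hom_mult u_def)
qed

text \<open>The prime factors of \<open>b\<close> are taken one at a time, each applied to the root
  of unity reached so far; hence the induction generalizes \<open>w\<close>.\<close>

lemma ipoly_root_of_unity_coprime_power: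
  fixes w :: "'a::field_char_0"
  assumes w: "w ^ n = 1" and n: "0 < n" and b: "coprime b n" "b \<noteq> 0" and h: "ipoly h w = 0"
  shows "ipoly h (w ^ b) = 0"
  using b w h
proof (induction b arbitrary: w rule: prime_divisors_induct)
  case zero
  then show ?case by simp
next
  case (unit b)
  then show ?case by simp
next
  case (factor p b)
  have cop: "coprime p n" "coprime b n" using factor.prems(1) by auto
  then have "\<not> p dvd n" using factor.hyps by (metis coprime_absorb_left not_prime_unit)
  then have "ipoly h (w ^ p) = 0"
    using ipoly_root_of_unity_prime_power n factor by blast
  moreover have "(w ^ p) ^ n = 1" using factor.prems(3) by (metis power_mult mult.commute power_one)
  ultimately show ?case
    using factor.IH[of "w ^ p"] cop factor.prems(2) by (simp add: power_mult)
qed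

section \<open>Ring homomorphisms into an algebraically closed field\<close>

text \<open>Subrings are sets rather than types because Zorn's lemma is to range over them. The
  values of \<open>f\<close> outside \<open>R\<close> are arbitrary.\<close>

locale ring_hom_on =
  fixes R :: "'a::comm_ring_1 set" and f :: "'a \<Rightarrow> 'b::comm_ring_1"
  assumes one [simp]: "1 \<in> R" "f 1 = 1"
    and add: "x \<in> R \<Longrightarrow> y \<in> R \<Longrightarrow> x + y \<in> R" "x \<in> R \<Longrightarrow> y \<in> R \<Longrightarrow> f (x + y) = f x + f y"
    and mult: "x \<in> R \<Longrightarrow> y \<in> R \<Longrightarrow> x * y \<in> R" "x \<in> R \<Longrightarrow> y \<in> R \<Longrightarrow> f (x * y) = f x * f y"
    and uminus: "x \<in> R \<Longrightarrow> - x \<in> R" "x \<in> R \<Longrightarrow> f (- x) = - f x"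
begin

lemma zero [simp]: "0 \<in> R" "f 0 = 0"
  using add[of 1 "- 1"] uminus[of 1] by auto

lemma diff: "x \<in> R \<Longrightarrow> y \<in> R \<Longrightarrow> x - y \<in> R" "x \<in> R \<Longrightarrow> y \<in> R \<Longrightarrow> f (x - y) = f x - f y"
  using add[of x "- y"] uminus[of y] by auto

lemma power: "x \<in> R \<Longrightarrow> x ^ k \<in> R \<and> f (x ^ k) = f x ^ k"
  by (induction k) (auto simp: mult)

lemma sum: "(\<And>i. i \<in> A \<Longrightarrow> g i \<in> R) \<Longrightarrow> sum g A \<in> R \<and> f (sum g A) = (\<Sum>i\<in>A. f (g i))"
  by (induction A rule: infinite_finite_induct) (auto simp: add)

lemma prod: "(\<And>i. i \<in> A \<Longrightarrow> g i \<in> R) \<Longrightarrow> prod g A \<in> R \<and> f (prod g A) = (\<Prod>i\<in>A. f (g i))"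
  by (induction A rule: infinite_finite_induct) (auto simp: mult)

lemma prod_list: "set xs \<subseteq> R \<Longrightarrow> prod_list xs \<in> R \<and> f (prod_list xs) = prod_list (map f xs)"
  by (induction xs) (auto simp: mult)

lemma of_nat: "of_nat n \<in> R \<and> f (of_nat n) = of_nat n"
  by (induction n) (auto simp: add)

lemma of_int: "of_int n \<in> R \<and> f (of_int n) = of_int n"
  using of_nat uminus by (cases n rule: int_cases2) auto

lemma coeff_map [simp]: "coeff (map_poly f p) i = f (coeff p i)"
  by (simp add: coeff_map_poly)

lemma ring_hom_on_poly: "ring_hom_on {p. \<forall>i. coeff p i \<in> R} (map_poly f)"
proof
  show "1 \<in> {p. \<forall>i. coeff p i \<in> R}" by (auto simp: coeff_1)
  show "map_poly f 1 = 1" by (rule poly_eqI) (auto simp: coeff_1)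
  fix p q assume "p \<in> {p. \<forall>i. coeff p i \<in> R}" "q \<in> {p. \<forall>i. coeff p i \<in> R}"
  then have p: "coeff p i \<in> R" and q: "coeff q i \<in> R" for i by auto
  have s: "(\<Sum>i\<le>n. coeff p i * coeff q (n - i)) \<in> R \<and> 
     f (\<Sum>i\<le>n. coeff p i * coeff q (n - i)) = (\<Sum>i\<le>n. f (coeff p i * coeff q (n - i)))" for n
    using sum[of "{..n}" "\<lambda>i. coeff p i * coeff q (n - i)"] p q mult(1) by blast
  show "p + q \<in> {p. \<forall>i. coeff p i \<in> R}" "- p \<in> {p. \<forall>i. coeff p i \<in> R}"
    "map_poly f (p + q) = map_poly f p + map_poly f q" "map_poly f (- p) = - map_poly f p"
    using p q by (auto simp: add uminus poly_eq_iff)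
  show "p * q \<in> {p. \<forall>i. coeff p i \<in> R}" "map_poly f (p * q) = map_poly f p * map_poly f q"
    using p q s by (auto simp: coeff_mult poly_eq_iff mult)
qed

lemma degree_map_le: "degree (map_poly f p) \<le> degree p"
  by (rule degree_le) (simp add: coeff_eq_0)

lemma poly_map: "poly (map_poly f p) y = (\<Sum>i\<le>degree p. f (coeff p i) * y ^ i)"
  unfolding poly_altdef coeff_map
proof (rule Groups_Big.comm_monoid_add_class.sum.mono_neutral_left)
  show "\<forall>i\<in>{..degree p} - {..degree (map_poly f p)}. f (coeff p i) * y ^ i = 0"
    using coeff_eq_0[of "map_poly f p"] by auto
qed (use degree_map_le in auto)

lemma poly_in:
  assumes "\<And>i. coeff p i \<in> R" "x \<in> R"
  shows "poly p x \<in> R \<and> f (poly p x) = poly (map_poly f p) (f x)"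
proof -
  have "poly (map_poly f p) (f x) = (\<Sum>i\<le>degree p. f (coeff p i) * f x ^ i)"
    by (rule poly_map)
  then show ?thesis using assms power[OF assms(2)] sum[of "{..degree p}" "\<lambda>i. coeff p i * x ^ i"]
    unfolding poly_altdef by (auto simp: mult)
qed

end

text \<open>In valuation theory these are the places of \<open>'a\<close>:
  \<open>in_or_inverse_in\<close> shows that \<open>R\<close> is a valuation ring. Maximality
  concludes only \<open>S = R\<close>, since \<open>g\<close> and \<open>f\<close> may differ
  outside \<open>R\<close>.\<close>

locale maximal_ring_hom_on = ring_hom_on R f
  for R :: "'a::field set" and f :: "'a \<Rightarrow> 'b::alg_closed_field" +
  assumes maximal: "ring_hom_on S g \<Longrightarrow> R \<subseteq> S \<Longrightarrow> (\<And>x. x \<in> R \<Longrightarrow> g x = f x) \<Longrightarrow> S = R"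
begin

definition polys :: "'a poly set" where "polys = {p. \<forall>i. coeff p i \<in> R}"

sublocale P: ring_hom_on polys "map_poly f"
  unfolding polys_def by (rule ring_hom_on_poly)

lemma polysD: "p \<in> polys \<Longrightarrow> coeff p i \<in> R" by (simp add: polys_def)

lemma const_polys: "c \<in> R \<Longrightarrow> [:c:] \<in> polys \<and> map_poly f [:c:] = [:f c:]"
  by (auto simp: polys_def coeff_pCons poly_eq_iff split: nat.split)

lemma monom_polys: "c \<in> R \<Longrightarrow> monom c n \<in> polys \<and> map_poly f (monom c n) = monom (f c) n"
  by (auto simp: polys_def map_poly_monom)

text \<open>The hypothesis says that \<open>x\<close> may be sent to \<open>y\<close>: evaluation at
  \<open>x\<close> followed by reduced evaluation at \<open>y\<close> is a well-defined extension of
  \<open>f\<close> to the ring generated by \<open>x\<close> over \<open>R\<close>, which by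
  maximality is \<open>R\<close>.\<close>

lemma extension:
  assumes ext: "\<And>p. p \<in> polys \<Longrightarrow> poly p x = 0 \<Longrightarrow> poly (map_poly f p) y = 0"
  shows "x \<in> R"
proof -
  define S where "S = (\<lambda>p. poly p x) ` polys"
  define g where "g s = poly (map_poly f (SOME p. p \<in> polys \<and> poly p x = s)) y" for s
  have g: "g (poly p x) = poly (map_poly f p) y" if p: "p \<in> polys" for p
  proof -
    define r where "r = (SOME p'. p' \<in> polys \<and> poly p' x = poly p x)"
    have "\<exists>r. r \<in> polys \<and> poly r x = poly p x" using p by blast
    then have r: "r \<in> polys \<and> poly r x = poly p x" unfolding r_def by (rule someI_ex)
    then have "r - p \<in> polys" "poly (r - p) x = 0" "map_poly f (r - p) = map_poly f r - map_poly f p"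
      using p P.diff[of r p] by auto
    with ext[of "r - p"] show ?thesis by (simp add: g_def r_def[symmetric])
  qed
  have "ring_hom_on S g"
  proof
    show "1 \<in> S" unfolding S_def using P.one(1) by (intro image_eqI[of _ _ 1]) auto
    show "g 1 = 1" using g[OF P.one(1)] by simp
    fix s t assume "s \<in> S" "t \<in> S"
    then obtain p r where pr: "p \<in> polys" "s = poly p x" "r \<in> polys" "t = poly r x"
      unfolding S_def by blast
    have eq: "s + t = poly (p + r) x" "s * t = poly (p * r) x" "- s = poly (- p) x" using pr by auto
    have in_polys: "p + r \<in> polys" "p * r \<in> polys" "- p \<in> polys"
      using pr P.add(1) P.mult(1) P.uminus(1) by blast+
    show "s + t \<in> S" "s * t \<in> S" "- s \<in> S"
      unfolding eq S_def using in_polys by blast+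
    show "g (s + t) = g s + g t" "g (s * t) = g s * g t" "g (- s) = - g s"
      unfolding eq unfolding g[OF in_polys(1)] g[OF in_polys(2)] g[OF in_polys(3)]
        pr(2,4) g[OF pr(1)] g[OF pr(3)] P.add(2)[OF pr(1,3)] P.mult(2)[OF pr(1,3)] P.uminus(2)[OF pr(1)]
      by simp_all
  qed
  moreover have "R \<subseteq> S" and gf: "g c = f c" if "c \<in> R" for c
  proof -
    show "R \<subseteq> S"
    proof
      fix c assume "c \<in> R"
      then show "c \<in> S" unfolding S_def using const_polys[of c]
        by (intro image_eqI[of _ _ "[:c:]"]) auto
    qed
    show "g c = f c" using const_polys[OF that] g[of "[:c:]"] by simp
  qed
  ultimately have "S = R" using maximal one(1) by blast
  moreover have "poly (monom 1 1) x \<in> S"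
    unfolding S_def using monom_polys[of 1 1] by (intro imageI) auto
  ultimately show ?thesis by (simp add: poly_monom)
qed

text \<open>This makes \<open>R\<close> a local ring with the kernel of \<open>f\<close> as maximal
  ideal. Sending \<open>inverse r\<close> to \<open>inverse (f r)\<close> respects every relation,
  as multiplication by \<open>r ^ degree p\<close> shows, so \<open>extension\<close>
  applies.\<close>

lemma inverse_in:
  assumes r: "r \<in> R" "f r \<noteq> 0"
  shows "inverse r \<in> R" "f (inverse r) = inverse (f r)"
proof -
  have r0: "r \<noteq> 0" using r by auto
  show "inverse r \<in> R"
  proof (rule extension)
    fix p assume p: "p \<in> polys" "poly p (inverse r) = 0"
    let ?n = "degree p"
    let ?q = "\<lambda>i. coeff p i * r ^ (?n - i)"
    have "(\<Sum>i\<le>?n. ?q i) = r ^ ?n * poly p (inverse r)"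
      unfolding poly_altdef sum_distrib_left
      by (intro sum.cong) (auto simp: r0 power_diff divide_inverse power_inverse)
    then have "f (\<Sum>i\<le>?n. ?q i) = 0" using p by simp
    moreover have "f (\<Sum>i\<le>?n. ?q i) = (\<Sum>i\<le>?n. f (coeff p i) * f r ^ (?n - i))"
      using sum[of "{..?n}" ?q] polysD[OF p(1)] power[OF r(1)] by (auto simp: mult)
    moreover have "(\<Sum>i\<le>?n. f (coeff p i) * f r ^ (?n - i)) = f r ^ ?n * (\<Sum>i\<le>?n. f (coeff p i) * inverse (f r) ^ i)"
      unfolding sum_distrib_left
      by (intro sum.cong) (auto simp: r power_diff divide_inverse power_inverse)
    moreover have "poly (map_poly f p) (inverse (f r)) = (\<Sum>i\<le>?n. f (coeff p i) * inverse (f r) ^ i)"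
      by (rule poly_map)
    ultimately show "poly (map_poly f p) (inverse (f r)) = 0" using r by simp
  qed
  then have "f (r * inverse r) = f r * f (inverse r)" using r by (simp add: mult)
  then show "f (inverse r) = inverse (f r)" using r r0 by (simp add: field_simps)
qed

text \<open>By \<open>extension\<close>, the reductions of the relations of \<open>x\<close> have no
  common zero. One of least degree divides all of them, as its leading coefficient lifts to a unit
  of \<open>R\<close> and long division stays among reductions. A root of it would be a common zero,
  so it is constant and can be normalized to 1.\<close>

lemma not_in_imp_relation:
  assumes "x \<notin> R"
  shows "\<exists>p\<in>polys. poly p x = 0 \<and> map_poly f p = 1"
proof -
  define I where "I = map_poly f ` {p \<in> polys. poly p x = 0}"
  have ex: "\<exists>g\<in>I. poly g y \<noteq> 0" for y
    using extension[of x y] assms unfolding I_def by blast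
  then have "\<exists>g. g \<in> I \<and> g \<noteq> 0" by (metis poly_0)
  then obtain g where g: "g \<in> I" "g \<noteq> 0" "\<And>h. h \<in> I \<Longrightarrow> h \<noteq> 0 \<Longrightarrow> degree g \<le> degree h"
    using arg_min_nat_lemma[of "\<lambda>g. g \<in> I \<and> g \<noteq> 0" _ degree] by blast
  obtain p where p: "p \<in> polys" "poly p x = 0" "g = map_poly f p" using g(1) by (auto simp: I_def)
  define c where "c = coeff p (degree g)"
  have c: "c \<in> R" "f c = lead_coeff g" using polysD[OF p(1)] by (simp_all add: c_def p(3))
  then have fc: "f c \<noteq> 0" using g(2) by simp
  have "degree g = 0"
  proof (rule ccontr)
    assume "degree g \<noteq> 0"
    then obtain y where y: "poly g y = 0" using alg_closed_imp_poly_has_root[of g] by auto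
    have "poly h y = 0" if "h \<in> I" for h
      using that
    proof (induction "degree h" arbitrary: h rule: less_induct)
      case less
      show ?case
      proof (cases "h = 0")
        case False
        with less.prems g(3) have deg: "degree g \<le> degree h" by blast
        obtain r where r: "r \<in> polys" "poly r x = 0" "h = map_poly f r" using less.prems by (auto simp: I_def)
        define e where "e = coeff r (degree h) * inverse c"
        have e: "e \<in> R" "f e = lead_coeff h / lead_coeff g"
          using polysD[OF r(1)] inverse_in[OF c(1) fc] c(2)
          by (simp_all add: e_def r(3) mult divide_inverse)
        define m where "m = monom e (degree h - degree g)"
        have m: "m \<in> polys" "map_poly f m = monom (f e) (degree h - degree g)"
          unfolding m_def using monom_polys[OF e(1)] by auto
        define h' where "h' = h - monom (f e) (degree h - degree g) * g"
        have "r - m * p \<in> polys" "poly (r - m * p) x = 0" "map_poly f (r - m * p) = h'"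
          using r p m by (auto simp: P.diff P.mult h'_def)
        then have "h' \<in> I" unfolding I_def by blast
        have "h' = 0 \<or> degree h' < degree h"
        proof -
          have *: "degree (monom (f e) (degree h - degree g) * g) = degree h"
            using False g(2) e(2) deg by (simp add: degree_mult_eq degree_monom_eq monom_eq_0_iff)
          have "coeff h' (degree h) = 0"
            using deg e g(2) by (simp add: h'_def coeff_monom_mult)
          moreover have "degree h' \<le> degree h" unfolding h'_def using * degree_diff_le[of h "degree h"] by simp
          ultimately show ?thesis by (metis le_neq_implies_less leading_coeff_0_iff)
        qed
        then have "poly h' y = 0" using less.hyps[of h'] \<open>h' \<in> I\<close> by auto
        then show ?thesis using y by (simp add: h'_def)
      qed simp
    qed
    with ex[of y] show False by blast
  qed
  then have "g = [:f c:]" using c(2) by (metis degree_0_id)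
  then have "map_poly f ([:inverse c:] * p) = 1"
    using P.mult[of "[:inverse c:]" p] const_polys[of "inverse c"] inverse_in[OF c(1) fc] p fc
    by (auto simp: one_pCons)
  moreover have "[:inverse c:] * p \<in> polys"
    using P.mult[of "[:inverse c:]" p] const_polys[of "inverse c"] inverse_in[OF c(1) fc] p by auto
  ultimately show ?thesis using p(2) by (intro bexI[of _ "[:inverse c:] * p"]) auto
qed

text \<open>Otherwise the reversal \<open>s\<close> of \<open>r\<close> is a relation for
  \<open>x\<close> whose degree is at most that of \<open>p\<close> and whose leading coefficient
  \<open>coeff r 0\<close> is a unit. Cancelling the leading term of \<open>p\<close> by a multiple
  of \<open>s\<close> preserves the reduction 1, because \<open>f\<close> kills the leading
  coefficient of \<open>p\<close>. This contradicts minimality.\<close>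

lemma relation_degree_lt:
  assumes x: "x \<noteq> 0"
    and p: "p \<in> polys" "poly p x = 0" "map_poly f p = 1"
    and min: "\<And>p'. p' \<in> polys \<Longrightarrow> poly p' x = 0 \<Longrightarrow> map_poly f p' = 1 \<Longrightarrow> degree p \<le> degree p'"
    and r: "r \<in> polys" "poly r (inverse x) = 0" "map_poly f r = 1"
  shows "degree p < degree r"
proof (rule ccontr)
  assume "\<not> degree p < degree r"
  then have le: "degree r \<le> degree p" by simp
  have fr: "f (coeff r i) = (if i = 0 then 1 else 0)" for i
    using arg_cong[OF r(3), of "\<lambda>h. coeff h i"] by (simp add: coeff_1)
  have fp: "f (coeff p i) = (if i = 0 then 1 else 0)" for i
    using arg_cong[OF p(3), of "\<lambda>h. coeff h i"] by (simp add: coeff_1)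
  let ?n = "degree p" and ?m = "degree r"
  have n: "?n > 0"
  proof (rule ccontr)
    assume "\<not> 0 < ?n"
    then have "p = [:coeff p 0:]" by (metis degree_0_id gr0I)
    then have "coeff p 0 = 0" using p(2) by (metis mult_zero_right add.right_neutral poly_pCons poly_0)
    with fp[of 0] show False by simp
  qed
  define s where "s = reflect_poly r"
  have r0: "coeff r 0 \<noteq> 0" using fr[of 0] by auto
  have degs: "degree s = ?m" unfolding s_def using r0 by (rule degree_reflect_poly_eq)
  have cs: "coeff s i = (if i \<le> ?m then coeff r (?m - i) else 0)" for i
    unfolding s_def by (simp add: coeff_reflect_poly)
  have s: "s \<in> polys" using polysD[OF r(1)] by (auto simp: polys_def cs)
  have fs: "map_poly f s = monom 1 ?m" by (rule poly_eqI) (auto simp: cs fr)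
  have sx: "poly s x = 0" unfolding s_def using r(2) x poly_reflect_poly_nz[of "inverse x" r]
    by (metis inverse_inverse_eq mult_eq_0_iff poly_reflect_poly_nz reflect_poly_reflect_poly r0)
  have b: "inverse (coeff r 0) \<in> R" using inverse_in[OF polysD[OF r(1)], of 0] fr[of 0] by simp
  define e where "e = coeff p ?n * inverse (coeff r 0)"
  have e: "e \<in> R" "f e = 0" using b polysD[OF p(1)] fp[of ?n] n by (simp_all add: e_def mult)
  define m where "m = monom e (?n - ?m)"
  have m: "m \<in> polys" "map_poly f m = 0" unfolding m_def using monom_polys[OF e(1)] e(2) by auto
  define p' where "p' = p - m * s"
  have p': "p' \<in> polys" "poly p' x = 0" "map_poly f p' = 1"
    using p m s sx by (auto simp: p'_def P.diff P.mult)
  have "coeff p' ?n = 0"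
    using le r0 degs by (simp add: p'_def m_def coeff_monom_mult e_def cs)
  moreover have "degree p' \<le> ?n"
  proof -
    have "degree (m * s) \<le> degree m + degree s" by (rule degree_mult_le)
    also have "\<dots> \<le> ?n" using le degs degree_monom_le[of e "?n - ?m"] by (simp add: m_def)
    finally show ?thesis unfolding p'_def by (intro degree_diff_le) auto
  qed
  moreover have "p' \<noteq> 0" using p'(3) by auto
  ultimately have "degree p' < ?n" by (metis le_neq_implies_less leading_coeff_0_iff)
  with min[OF p'] show False by simp
qed

text \<open>If both were missing, relations of least degree for \<open>x\<close> and for
  \<open>inverse x\<close> would each have smaller degree than the other.\<close>

theorem in_or_inverse_in: "x \<in> R \<or> inverse x \<in> R"
proof (rule ccontr)
  assume *: "\<not> ?thesis"
  then have x: "x \<noteq> 0" by auto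
  have "\<exists>p. (p \<in> polys \<and> poly p z = 0 \<and> map_poly f p = 1) \<and>
      (\<forall>p'. p' \<in> polys \<and> poly p' z = 0 \<and> map_poly f p' = 1 \<longrightarrow> degree p \<le> degree p')" if "z \<notin> R" for z
    using not_in_imp_relation[OF that]
      arg_min_nat_lemma[of "\<lambda>p. p \<in> polys \<and> poly p z = 0 \<and> map_poly f p = 1" _ degree] by blast
  from this[of x] this[of "inverse x"] * obtain p r where
    "p \<in> polys" "poly p x = 0" "map_poly f p = 1"
    "\<And>p'. p' \<in> polys \<Longrightarrow> poly p' x = 0 \<Longrightarrow> map_poly f p' = 1 \<Longrightarrow> degree p \<le> degree p'"
    "r \<in> polys" "poly r (inverse x) = 0" "map_poly f r = 1"
    "\<And>p'. p' \<in> polys \<Longrightarrow> poly p' (inverse x) = 0 \<Longrightarrow> map_poly f p' = 1 \<Longrightarrow> degree r \<le> degree p'"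
    by metis
  then have "degree p < degree r" "degree r < degree p"
    using relation_degree_lt[of x p r] relation_degree_lt[of "inverse x" r p] x by auto
  then show False by simp
qed

end

text \<open>Extensions are ordered by inclusion of their graphs, which forget the arbitrary values
  outside the domain. Apart from two fixed inclusions, the conditions in \<open>A_iff\<close>
  involve at most two pairs at a time, so the union of a chain inherits them.\<close>

lemma maximal_ring_hom_on_exists:
  fixes R0 :: "'a::field set" and f0 :: "'a \<Rightarrow> 'b::alg_closed_field"
  assumes "ring_hom_on R0 f0"
  obtains R f where "maximal_ring_hom_on R f" "R0 \<subseteq> R" "\<And>x. x \<in> R0 \<Longrightarrow> f x = f0 x"
proof -
  interpret R0: ring_hom_on R0 f0 by fact
  define gr :: "'a set \<Rightarrow> ('a \<Rightarrow> 'b) \<Rightarrow> ('a \<times> 'b) set" where "gr R f = (\<lambda>x. (x, f x)) ` R" for R f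
  define A where "A = {gr R f | R f. ring_hom_on R f \<and> gr R0 f0 \<subseteq> gr R f}"
  have A_iff: "G \<in> A \<longleftrightarrow> gr R0 f0 \<subseteq> G \<and> (1,1) \<in> G \<and> (\<forall>x a b. (x,a) \<in> G \<longrightarrow> (x,b) \<in> G \<longrightarrow> a = b) \<and>
     (\<forall>x a y b. (x,a) \<in> G \<longrightarrow> (y,b) \<in> G \<longrightarrow> (x+y,a+b) \<in> G \<and> (x*y,a*b) \<in> G \<and> (-x,-a) \<in> G)" (is "_ \<longleftrightarrow> ?P G") for G
  proof
    assume "G \<in> A"
    then obtain R f where G: "G = gr R f" "ring_hom_on R f" "gr R0 f0 \<subseteq> G" unfolding A_def by auto
    interpret ring_hom_on R f by fact
    have "?P (gr R f)" using G(1,3) by (auto simp: gr_def image_iff add mult uminus)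
    with G(1) show "?P G" by simp
  next
    assume G: "?P G"
    define f where "f x = (THE a. (x,a) \<in> G)" for x
    have f: "f x = a" if "(x,a) \<in> G" for x a
      unfolding f_def by (rule the_equality) (use G that in auto)
    have G_eq: "G = gr (fst ` G) f" using f by (force simp: gr_def)
    have fstI: "x \<in> fst ` G" if "(x,a) \<in> G" for x a using that by (rule image_eqI[rotated]) simp
    have "ring_hom_on (fst ` G) f"
    proof
      have "(1,1) \<in> G" using G by blast
      then show "1 \<in> fst ` G" "f 1 = 1" using fstI f by blast+
      fix x y assume "x \<in> fst ` G" "y \<in> fst ` G"
      then obtain a b where ab: "(x,a) \<in> G" "(y,b) \<in> G" by auto
      then have c: "(x+y,a+b) \<in> G" "(x*y,a*b) \<in> G" "(-x,-a) \<in> G" using G by blast+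
      then show "x + y \<in> fst ` G" "x * y \<in> fst ` G" "- x \<in> fst ` G"
        by (blast intro: fstI)+
      show "f (x + y) = f x + f y" "f (x * y) = f x * f y" "f (- x) = - f x"
        unfolding f[OF ab(1)] f[OF ab(2)] f[OF c(1)] f[OF c(2)] f[OF c(3)] by (rule refl)+
    qed
    then show "G \<in> A" unfolding A_def using G G_eq by (intro CollectI exI[of _ "fst ` G"] exI[of _ f]) blast
  qed
  have "\<exists>M\<in>A. \<forall>X\<in>A. M \<subseteq> X \<longrightarrow> X = M"
  proof (rule subset_Zorn_nonempty)
    show "A \<noteq> {}" using assms unfolding A_def by blast
    fix C assume C: "C \<noteq> {}" "subset.chain A C"
    then have CA: "?P G" if "G \<in> C" for G using that A_iff[of G] unfolding subset_chain_def by blast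
    have two: "\<exists>G\<in>C. u \<in> G \<and> v \<in> G" if uv: "u \<in> \<Union>C" "v \<in> \<Union>C" for u v
    proof -
      obtain G G' where "G \<in> C" "u \<in> G" "G' \<in> C" "v \<in> G'" using uv by blast
      moreover from this have "G \<subseteq> G' \<or> G' \<subseteq> G" using C(2) unfolding subset_chain_def by blast
      ultimately show ?thesis by (metis subsetD)
    qed
    have "?P (\<Union>C)"
    proof (intro conjI allI impI)
      obtain G where G: "G \<in> C" using C(1) by blast
      show "gr R0 f0 \<subseteq> \<Union>C" "(1,1) \<in> \<Union>C" using G CA[OF G] by blast+
    next
      fix x a b assume "(x,a) \<in> \<Union>C" "(x,b) \<in> \<Union>C"
      then obtain G where G: "G \<in> C" "(x,a) \<in> G" "(x,b) \<in> G" using two by metis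
      show "a = b" using CA[OF G(1)] G by blast
    next
      fix x a y b assume "(x,a) \<in> \<Union>C" "(y,b) \<in> \<Union>C"
      then obtain G where G: "G \<in> C" "(x,a) \<in> G" "(y,b) \<in> G" using two by metis
      then have "(x+y,a+b) \<in> G" "(x*y,a*b) \<in> G" "(-x,-a) \<in> G" using CA[OF G(1)] by blast+
      then show "(x+y,a+b) \<in> \<Union>C" "(x*y,a*b) \<in> \<Union>C" "(-x,-a) \<in> \<Union>C" using G(1) by blast+
    qed
    then show "\<Union>C \<in> A" unfolding A_iff .
  qed
  then obtain M where M: "M \<in> A" "\<And>X. X \<in> A \<Longrightarrow> M \<subseteq> X \<Longrightarrow> X = M" by blast
  then obtain R f where Rf: "M = gr R f" "ring_hom_on R f" "gr R0 f0 \<subseteq> M" unfolding A_def by auto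
  have "maximal_ring_hom_on R f"
    unfolding maximal_ring_hom_on_def maximal_ring_hom_on_axioms_def
  proof (intro conjI allI impI Rf(2))
    fix S g assume S: "ring_hom_on S g" "R \<subseteq> S" "\<forall>x. x \<in> R \<longrightarrow> g x = f x"
    then have sub: "M \<subseteq> gr S g" unfolding Rf(1) by (auto simp: gr_def image_iff)
    then have "gr S g \<in> A" using S(1) Rf(3) unfolding A_def by blast
    then have "gr S g = M" using M(2) sub by blast
    then have "fst ` gr S g = fst ` gr R f" using Rf(1) by simp
    then show "S = R" by (simp add: gr_def image_image)
  qed
  moreover have "R0 \<subseteq> R" "\<And>x. x \<in> R0 \<Longrightarrow> f x = f0 x"
    using Rf(1,3) by (auto simp: gr_def)
  ultimately show ?thesis using that by blast
qed

section \<open>Schur relations\<close>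

text \<open>Homomorphisms into \<open>GL d\<close> in the form of matrix equations, which are easy
  to check after conjugation or after a ring homomorphism on the entries.\<close>

locale matrix_rep = group H for H :: "('h, 'b) monoid_scheme" (structure) +
  fixes d :: nat and \<rho> :: "'h \<Rightarrow> 'a::field mat"
  assumes fin: "finite (carrier H)"
    and carr: "g \<in> carrier H \<Longrightarrow> \<rho> g \<in> carrier_mat d d"
    and one: "\<rho> \<one> = 1\<^sub>m d"
    and mult: "g \<in> carrier H \<Longrightarrow> h \<in> carrier H \<Longrightarrow> \<rho> (g \<otimes> h) = \<rho> g * \<rho> h"

lemma matrix_rep_iff_hom_GL:
  assumes "group H" "finite (carrier H)"
  shows "matrix_rep H d \<rho> \<longleftrightarrow> \<rho> \<in> hom H (GL d :: 'a::field mat monoid)"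
proof
  interpret group H by fact
  have GL: "carrier (GL d) = {A \<in> carrier_mat d d. \<exists>B\<in>carrier_mat d d. B * A = 1\<^sub>m d \<and> A * B = (1\<^sub>m d :: 'a mat)}"
    by (auto simp: GL_def units_of_def Units_def ring_mat_def)
  {
    assume "matrix_rep H d \<rho>"
    then interpret matrix_rep H d \<rho> .
    have "\<rho> g \<in> carrier (GL d)" if "g \<in> carrier H" for g
      unfolding GL using that carr mult[of g "inv\<^bsub>H\<^esub> g"] mult[of "inv\<^bsub>H\<^esub> g" g] one
      by (auto intro!: bexI[of _ "\<rho> (inv\<^bsub>H\<^esub> g)"])
    then show "\<rho> \<in> hom H (GL d)"
      by (auto simp: hom_def mult carr GL_def units_of_def ring_mat_def)
  }
  {
    assume hom: "\<rho> \<in> hom H (GL d)"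
    have c: "\<rho> g \<in> carrier (GL d)" if "g \<in> carrier H" for g
      using hom that by (auto simp: hom_def)
    have m: "\<rho> (g \<otimes>\<^bsub>H\<^esub> h) = \<rho> g * \<rho> h" if "g \<in> carrier H" "h \<in> carrier H" for g h
      using hom that by (auto simp: hom_def GL_def units_of_def ring_mat_def)
    obtain B where B: "\<rho> \<one>\<^bsub>H\<^esub> \<in> carrier_mat d d" "B \<in> carrier_mat d d" "B * \<rho> \<one>\<^bsub>H\<^esub> = 1\<^sub>m d"
      using c[OF one_closed] unfolding GL by auto
    have rr: "\<rho> \<one>\<^bsub>H\<^esub> * \<rho> \<one>\<^bsub>H\<^esub> = \<rho> \<one>\<^bsub>H\<^esub>" using m[of "\<one>\<^bsub>H\<^esub>" "\<one>\<^bsub>H\<^esub>"] by simp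
    have "\<rho> \<one>\<^bsub>H\<^esub> = (B * \<rho> \<one>\<^bsub>H\<^esub>) * \<rho> \<one>\<^bsub>H\<^esub>" unfolding B(3) using B(1) by simp
    also have "\<dots> = B * \<rho> \<one>\<^bsub>H\<^esub>"
      using assoc_mult_mat[OF B(2,1,1)] rr by simp
    finally have "\<rho> \<one>\<^bsub>H\<^esub> = 1\<^sub>m d" using B by simp
    then show "matrix_rep H d \<rho>"
      using assms c m unfolding GL by unfold_locales auto
  }
qed

context matrix_rep
begin

lemma dims [simp]: "g \<in> carrier H \<Longrightarrow> dim_row (\<rho> g) = d" "g \<in> carrier H \<Longrightarrow> dim_col (\<rho> g) = d"
  using carr by blast+

lemma inverse: "g \<in> carrier H \<Longrightarrow> \<rho> g * \<rho> (inv g) = 1\<^sub>m d" "g \<in> carrier H \<Longrightarrow> \<rho> (inv g) * \<rho> g = 1\<^sub>m d"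
  using mult[of g "inv g"] mult[of "inv g" g] one by auto

lemma pow: "g \<in> carrier H \<Longrightarrow> \<rho> (g [^] k) = \<rho> g ^\<^sub>m k" for k :: nat
proof (induction k)
  case 0
  have "dim_row (\<rho> g) = d" using carr[OF 0] by auto
  with 0 show ?case by (simp add: one)
qed (simp add: mult)

lemma pow_order: "g \<in> carrier H \<Longrightarrow> \<rho> g ^\<^sub>m order H = 1\<^sub>m d"
  using pow[of g "order H"] pow_order_eq_1[of g] one by simp

lemma mult_nth:
  assumes "g \<in> carrier H" "h \<in> carrier H" "i < d" "j < d"
  shows "\<rho> (g \<otimes> h) $$ (i,j) = (\<Sum>k<d. \<rho> g $$ (i,k) * \<rho> h $$ (k,j))"
  using assms carr[OF assms(1)] carr[OF assms(2)]
  by (simp add: mult scalar_prod_def atLeast0LessThan)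

lemma inverse_nth:
  assumes "g \<in> carrier H" "i < d" "j < d"
  shows "(\<Sum>k<d. \<rho> g $$ (i,k) * \<rho> (inv g) $$ (k,j)) = (if i = j then 1 else 0)"
    "(\<Sum>k<d. \<rho> (inv g) $$ (i,k) * \<rho> g $$ (k,j)) = (if i = j then 1 else 0)"
  using mult_nth[of g "inv g" i j] mult_nth[of "inv g" g i j] assms one by auto

lemma conjugate:
  assumes "P \<in> carrier_mat d d" "R \<in> carrier_mat d d" "P * R = 1\<^sub>m d" "R * P = 1\<^sub>m d"
  shows "matrix_rep H d (\<lambda>g. R * \<rho> g * P)"
proof
  fix g h assume gh: "g \<in> carrier H" "h \<in> carrier H"
  have "R * \<rho> (g \<otimes> h) * P = R * \<rho> g * (P * R) * (\<rho> h * P)"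
    unfolding assms(3) using assms(1,2) carr[OF gh(1)] carr[OF gh(2)]
    by (simp add: mult gh assoc_mult_mat[of _ d d _ d _ d])
  also have "\<dots> = R * \<rho> g * P * (R * \<rho> h * P)"
    using assms(1,2) carr[OF gh(1)] carr[OF gh(2)] by (simp add: assoc_mult_mat[of _ d d _ d _ d])
  finally show "R * \<rho> (g \<otimes> h) * P = R * \<rho> g * P * (R * \<rho> h * P)" .
qed (use fin assms one carr in auto)

lemma sum_left_mult:
  assumes "h \<in> carrier H"
  shows "(\<Sum>g\<in>carrier H. F (h \<otimes> g)) = (\<Sum>g\<in>carrier H. F g)"
proof (rule sum.reindex_bij_betw)
  show "bij_betw (\<lambda>g. h \<otimes> g) (carrier H) (carrier H)"
    unfolding bij_betw_def using inj_on_cmult surj_const_mult assms by blast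
qed

end

text \<open>The conclusion of Schur's lemma, isolated because a short matrix computation carries it
  to conjugate representations.\<close>

definition commutant_scalar :: "('h, 'b) monoid_scheme \<Rightarrow> nat \<Rightarrow> ('h \<Rightarrow> 'a::field mat) \<Rightarrow> bool" where
  "commutant_scalar H d \<rho> \<longleftrightarrow> (\<forall>X\<in>carrier_mat d d.
     (\<forall>g\<in>carrier H. \<rho> g * X = X * \<rho> g) \<longrightarrow> (\<exists>e. X = e \<cdot>\<^sub>m 1\<^sub>m d))"

lemma irreducible_rep_commutant_scalar:
  fixes \<rho> :: "'h \<Rightarrow> 'a::alg_closed_field mat"
  assumes irr: "irreducible_rep H d \<rho>" and "group H" "finite (carrier H)"
  shows "commutant_scalar H d \<rho>"
  unfolding commutant_scalar_def
proof (intro ballI impI)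
  fix X :: "'a mat" assume X: "X \<in> carrier_mat d d" and comm: "\<forall>g\<in>carrier H. \<rho> g * X = X * \<rho> g"
  interpret matrix_rep H d \<rho>
    using irr matrix_rep_iff_hom_GL[OF assms(2,3), of d \<rho>] by (simp add: irreducible_rep_def)
  have "0 < d" using irr by (simp add: irreducible_rep_def)
  then obtain e where "poly (char_poly X) e = 0"
    using alg_closed_imp_poly_has_root[of "char_poly X"] degree_monic_char_poly[OF X] by auto
  then obtain v where v: "v \<in> carrier_vec d" "v \<noteq> 0\<^sub>v d" "X *\<^sub>v v = e \<cdot>\<^sub>v v"
    using eigenvalue_root_char_poly[OF X, of e] X unfolding eigenvalue_def eigenvector_def by auto
  define W where "W = {w \<in> carrier_vec d. X *\<^sub>v w = e \<cdot>\<^sub>v w}"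
  have "VectorSpace.subspace class_ring W (module_vec TYPE('a) d)"
    unfolding VectorSpace.subspace_def submodule_def
  proof (intro conjI allI impI)
    show "vectorspace class_ring (module_vec TYPE('a) d)" by (rule vec_vs)
    show "module class_ring (module_vec TYPE('a) d)" by (rule vec_module)
    fix x y assume "x \<in> W" "y \<in> W"
    then show "x \<oplus>\<^bsub>module_vec TYPE('a) d\<^esub> y \<in> W"
      using X by (simp add: W_def module_vec_simps mult_add_distrib_mat_vec[of _ d d] smult_add_distrib_vec[of _ d])
  next
    fix c :: 'a and x assume "c \<in> carrier class_ring" "x \<in> W"
    then show "c \<odot>\<^bsub>module_vec TYPE('a) d\<^esub> x \<in> W"
      using X by (simp add: W_def module_vec_simps mult_mat_vec[of _ d d] smult_smult_assoc mult.commute)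
  next
    have "X *\<^sub>v 0\<^sub>v d = e \<cdot>\<^sub>v 0\<^sub>v d" using X by (intro eq_vecI) auto
    then show "\<zero>\<^bsub>module_vec TYPE('a) d\<^esub> \<in> W" by (simp add: W_def module_vec_simps)
    show "W \<subseteq> carrier (module_vec TYPE('a) d)" by (auto simp: W_def module_vec_simps)
  qed
  moreover have "\<rho> g *\<^sub>v w \<in> W" if g: "g \<in> carrier H" and w: "w \<in> W" for g w
  proof -
    have wc: "w \<in> carrier_vec d" "X *\<^sub>v w = e \<cdot>\<^sub>v w" using w by (auto simp: W_def)
    have "X *\<^sub>v (\<rho> g *\<^sub>v w) = (X * \<rho> g) *\<^sub>v w"
      using X carr[OF g] wc by simp
    also have "\<dots> = (\<rho> g * X) *\<^sub>v w" using comm g by simp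
    also have "\<dots> = e \<cdot>\<^sub>v (\<rho> g *\<^sub>v w)"
      using X carr[OF g] wc by (simp add: mult_mat_vec[of _ d d])
    finally show ?thesis using mult_mat_vec_carrier[OF carr[OF g] wc(1)] by (simp add: W_def)
  qed
  moreover have "v \<in> W" using v by (simp add: W_def)
  ultimately have "W = carrier_vec d"
    using irr v(2) unfolding irreducible_rep_def by blast
  then have W: "X *\<^sub>v w = e \<cdot>\<^sub>v w" if "w \<in> carrier_vec d" for w using that by (auto simp: W_def)
  have "X = e \<cdot>\<^sub>m 1\<^sub>m d"
  proof (rule eq_matI)
    fix i j assume "i < dim_row (e \<cdot>\<^sub>m 1\<^sub>m d)" "j < dim_col (e \<cdot>\<^sub>m 1\<^sub>m d)"
    then have ij: "i < d" "j < d" by auto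
    have "X *\<^sub>v unit_vec d j = col X j" using X ij by (intro eq_vecI) auto
    then have "col X j = e \<cdot>\<^sub>v unit_vec d j" using W[of "unit_vec d j"] by simp
    from arg_cong[OF this, of "\<lambda>w. w $ i"] show "X $$ (i,j) = (e \<cdot>\<^sub>m 1\<^sub>m d) $$ (i,j)"
      using ij X by (auto simp: unit_vec_def)
  qed (use X in auto)
  then show "\<exists>e. X = e \<cdot>\<^sub>m 1\<^sub>m d" ..
qed

lemma (in matrix_rep) commutant_scalar_conjugate:
  assumes PR: "P \<in> carrier_mat d d" "R \<in> carrier_mat d d" "P * R = 1\<^sub>m d" "R * P = 1\<^sub>m d"
    and sc: "commutant_scalar H d \<rho>"
  shows "commutant_scalar H d (\<lambda>g. R * \<rho> g * P)"
  unfolding commutant_scalar_def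
proof (intro ballI impI)
  fix X :: "'a mat" assume X: "X \<in> carrier_mat d d"
    and comm: "\<forall>g\<in>carrier H. R * \<rho> g * P * X = X * (R * \<rho> g * P)"
  note assoc = assoc_mult_mat[of _ d d _ d _ d]
  have "\<rho> g * (P * X * R) = P * X * R * \<rho> g" if g: "g \<in> carrier H" for g
  proof -
    have "\<rho> g * (P * X * R) = (P * R) * (\<rho> g * (P * X * R))"
      unfolding PR(3) using PR(1,2) X carr[OF g] by simp
    also have "\<dots> = P * (R * \<rho> g * P * X) * R"
      using PR(1,2) X carr[OF g] by (simp add: assoc)
    also have "\<dots> = P * (X * (R * \<rho> g * P)) * R" using comm g by simp
    also have "\<dots> = P * X * R * \<rho> g * (P * R)"
      using PR(1,2) X carr[OF g] by (simp add: assoc)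
    also have "\<dots> = P * X * R * \<rho> g" unfolding PR(3) using PR(1,2) X carr[OF g] by simp
    finally show ?thesis .
  qed
  then obtain e where e: "P * X * R = e \<cdot>\<^sub>m 1\<^sub>m d"
    using sc PR X unfolding commutant_scalar_def by (metis mult_carrier_mat)
  have "X = (R * P) * X * (R * P)" unfolding PR(4) using X by simp
  also have "\<dots> = R * (P * X * R) * P" using PR(1,2) X by (simp add: assoc)
  also have "\<dots> = e \<cdot>\<^sub>m 1\<^sub>m d" unfolding e 
    using PR mult_smult_distrib[of R d d "1\<^sub>m d" d e] mult_smult_assoc_mat[of R d d P d e] by simp
  finally show "\<exists>e. X = e \<cdot>\<^sub>m 1\<^sub>m d" ..
qed

text \<open>Orthogonality of matrix coefficients, multiplied by \<open>of_nat d\<close>: without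
  division it has integer coefficients and keeps its meaning in positive characteristic.\<close>

definition schur_relations :: "('h, 'b) monoid_scheme \<Rightarrow> nat \<Rightarrow> ('h \<Rightarrow> 'a::field mat) \<Rightarrow> bool" where
  "schur_relations H d \<rho> \<longleftrightarrow> (\<forall>a<d. \<forall>i<d. \<forall>j<d. \<forall>b<d.
     of_nat d * (\<Sum>g\<in>carrier H. \<rho> g $$ (a,i) * \<rho> (inv\<^bsub>H\<^esub> g) $$ (j,b))
       = (if i = j \<and> a = b then of_nat (order H) else 0))"

text \<open>The matrix \<open>X\<close> is the sum of all conjugates of the matrix unit at
  \<open>(i,j)\<close>, so it is a scalar \<open>e\<close>. Each conjugate has the trace of the
  matrix unit, which determines \<open>d * e\<close>.\<close>

lemma (in matrix_rep) commutant_scalar_schur_relations: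
  assumes sc: "commutant_scalar H d \<rho>"
  shows "schur_relations H d \<rho>"
  unfolding schur_relations_def
proof (intro allI impI)
  fix a i j b assume less: "a < d" "i < d" "j < d" "b < d"
  define X where "X = mat d d (\<lambda>(a,b). \<Sum>g\<in>carrier H. \<rho> g $$ (a,i) * \<rho> (inv g) $$ (j,b))"
  have X: "X \<in> carrier_mat d d" by (simp add: X_def)
  have "\<rho> h * X = X * \<rho> h" if h: "h \<in> carrier H" for h
  proof (rule eq_matI)
    fix a b assume "a < dim_row (X * \<rho> h)" "b < dim_col (X * \<rho> h)"
    then have ab: "a < d" "b < d" using X carr[OF h] by auto
    have "(\<rho> h * X) $$ (a,b) = (\<Sum>k<d. \<rho> h $$ (a,k) * (\<Sum>g\<in>carrier H. \<rho> g $$ (k,i) * \<rho> (inv g) $$ (j,b)))"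
      using ab carr[OF h] by (simp add: X_def scalar_prod_def atLeast0LessThan)
    also have "\<dots> = (\<Sum>g\<in>carrier H. (\<Sum>k<d. \<rho> h $$ (a,k) * \<rho> g $$ (k,i)) * \<rho> (inv g) $$ (j,b))"
      unfolding sum_distrib_left sum_distrib_right by (subst sum.swap) (simp add: ac_simps)
    \<comment> \<open>Writing \<open>inv g\<close> as \<open>inv (h \<otimes> g) \<otimes> h\<close>
      makes the summand a function of \<open>h \<otimes> g\<close>, ready for reindexing.\<close>
    also have "\<dots> = (\<Sum>g\<in>carrier H. \<rho> (h \<otimes> g) $$ (a,i) * \<rho> (inv (h \<otimes> g) \<otimes> h) $$ (j,b))"
      using h ab less by (intro sum.cong) (auto simp: mult_nth[of h _ a i] inv_mult_group m_assoc)
    also have "\<dots> = (\<Sum>g\<in>carrier H. \<rho> g $$ (a,i) * \<rho> (inv g \<otimes> h) $$ (j,b))"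
      by (rule sum_left_mult[OF h])
    also have "\<dots> = (\<Sum>g\<in>carrier H. \<rho> g $$ (a,i) * (\<Sum>k<d. \<rho> (inv g) $$ (j,k) * \<rho> h $$ (k,b)))"
      using h ab less by (intro sum.cong) (auto simp: mult_nth)
    also have "\<dots> = (\<Sum>k<d. (\<Sum>g\<in>carrier H. \<rho> g $$ (a,i) * \<rho> (inv g) $$ (j,k)) * \<rho> h $$ (k,b))"
      unfolding sum_distrib_left sum_distrib_right by (subst sum.swap) (simp add: ac_simps)
    also have "\<dots> = (X * \<rho> h) $$ (a,b)"
      using ab carr[OF h] by (simp add: X_def scalar_prod_def atLeast0LessThan)
    finally show "(\<rho> h * X) $$ (a,b) = (X * \<rho> h) $$ (a,b)" .
  qed (use X carr[OF h] in auto)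
  then obtain e where e: "X = e \<cdot>\<^sub>m 1\<^sub>m d" using sc X unfolding commutant_scalar_def by blast
  have "of_nat d * e = (\<Sum>k<d. X $$ (k,k))" unfolding e by simp
  also have "\<dots> = (\<Sum>g\<in>carrier H. \<Sum>k<d. \<rho> (inv g) $$ (j,k) * \<rho> g $$ (k,i))"
    by (subst sum.swap) (simp add: X_def mult.commute)
  also have "\<dots> = (\<Sum>g\<in>carrier H. if j = i then 1 else 0)"
    using less by (intro sum.cong) (auto simp: inverse_nth)
  also have "\<dots> = (if i = j then of_nat (order H) else 0)" by (simp add: order_def)
  finally have de: "of_nat d * e = (if i = j then of_nat (order H) else 0)" .
  have "(\<Sum>g\<in>carrier H. \<rho> g $$ (a,i) * \<rho> (inv g) $$ (j,b)) = X $$ (a,b)"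
    using less by (simp add: X_def)
  also have "\<dots> = (if a = b then e else 0)" unfolding e using less by auto
  finally show "of_nat d * (\<Sum>g\<in>carrier H. \<rho> g $$ (a,i) * \<rho> (inv g) $$ (j,b))
       = (if i = j \<and> a = b then of_nat (order H) else 0)"
    using de by auto
qed

context matrix_rep
begin

context
  assumes schur: "schur_relations H d \<rho>" and ord: "of_nat (order H) \<noteq> (0 :: 'a)"
begin

lemma schurD:
  assumes "a < d" "i < d" "j < d" "b < d"
  shows "of_nat d * (\<Sum>g\<in>carrier H. \<rho> g $$ (a,i) * \<rho> (inv g) $$ (j,b))
       = (if i = j \<and> a = b then of_nat (order H) else 0)"
  using schur assms unfolding schur_relations_def by blast

lemma character_norm:
  assumes "0 < d"
  shows "(\<Sum>g\<in>carrier H. mat_trace (\<rho> g) * mat_trace (\<rho> (inv g))) = of_nat (order H)"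
proof -
  \<comment> \<open>The relation with all indices 0 has a nonzero right-hand side; so
    \<open>d\<close> is nonzero in the field and can be cancelled at the end.\<close>
  have d: "of_nat d \<noteq> (0 :: 'a)" using schurD[of 0 0 0 0] assms ord by auto
  have tr: "mat_trace (\<rho> g) = (\<Sum>i<d. \<rho> g $$ (i,i))" if "g \<in> carrier H" for g
    using carr[OF that] by (simp add: mat_trace_def)
  have "(\<Sum>g\<in>carrier H. mat_trace (\<rho> g) * mat_trace (\<rho> (inv g)))
      = (\<Sum>g\<in>carrier H. \<Sum>a<d. \<Sum>b<d. \<rho> g $$ (a,a) * \<rho> (inv g) $$ (b,b))"
    by (intro sum.cong) (simp_all add: tr sum_product)
  also have "\<dots> = (\<Sum>a<d. \<Sum>b<d. \<Sum>g\<in>carrier H. \<rho> g $$ (a,a) * \<rho> (inv g) $$ (b,b))"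
    by (subst sum.swap, rule sum.cong[OF refl], subst sum.swap, rule refl)
  finally have "of_nat d * (\<Sum>g\<in>carrier H. mat_trace (\<rho> g) * mat_trace (\<rho> (inv g)))
     = (\<Sum>a<d. \<Sum>b<d. of_nat d * (\<Sum>g\<in>carrier H. \<rho> g $$ (a,a) * \<rho> (inv g) $$ (b,b)))"
    by (simp add: sum_distrib_left)
  also have "\<dots> = (\<Sum>a<d. \<Sum>b<d. if a = b then of_nat (order H) else 0)"
    by (intro sum.cong) (auto simp: schurD)
  also have "\<dots> = of_nat d * of_nat (order H)" by simp
  finally show ?thesis using d by simp
qed

text \<open>By Schur's relations, weighting the vectors \<open>\<rho> g *\<^sub>v v\<close> with
  \<open>of_nat d * \<rho> (inv g) $$ (i,b)\<close> and summing gives a nonzero multiple of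
  \<open>unit_vec d b\<close> whenever \<open>v $ i\<close> is nonzero. So \<open>M\<close> kills
  all unit vectors. For a matrix with invariant kernel this does the work of irreducibility.\<close>

lemma intertwiner_kernel:
  assumes M: "M \<in> carrier_mat d d" and v: "v \<in> carrier_vec d" "v \<noteq> 0\<^sub>v d"
    and Mv: "\<And>g. g \<in> carrier H \<Longrightarrow> M *\<^sub>v (\<rho> g *\<^sub>v v) = 0\<^sub>v d"
  shows "M = 0\<^sub>m d d"
proof (rule eq_matI)
  obtain i where i: "i < d" "v $ i \<noteq> 0" using v by (metis carrier_vecD eq_vecI index_zero_vec)
  fix c b assume "c < dim_row (0\<^sub>m d d)" "b < dim_col (0\<^sub>m d d)"
  then have cb: "c < d" "b < d" by auto
  have z: "(\<Sum>a<d. M $$ (c,a) * (\<Sum>k<d. \<rho> g $$ (a,k) * v $ k)) = 0" if g: "g \<in> carrier H" for g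
    using arg_cong[OF Mv[OF g], of "\<lambda>w. w $ c"] M v carr[OF g] cb
    by (simp add: scalar_prod_def atLeast0LessThan)
  have "0 = of_nat d * (\<Sum>g\<in>carrier H. (\<Sum>a<d. M $$ (c,a) * (\<Sum>k<d. \<rho> g $$ (a,k) * v $ k)) * \<rho> (inv g) $$ (i,b))"
    using z by simp
  also have "\<dots> = (\<Sum>g\<in>carrier H. \<Sum>a<d. \<Sum>k<d. M $$ (c,a) * v $ k * (of_nat d * (\<rho> g $$ (a,k) * \<rho> (inv g) $$ (i,b))))"
    by (simp add: sum_distrib_left sum_distrib_right ac_simps)
  also have "\<dots> = (\<Sum>a<d. \<Sum>k<d. \<Sum>g\<in>carrier H. M $$ (c,a) * v $ k * (of_nat d * (\<rho> g $$ (a,k) * \<rho> (inv g) $$ (i,b))))"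
    by (subst sum.swap, rule sum.cong[OF refl], subst sum.swap, rule refl)
  also have "\<dots> = (\<Sum>a<d. \<Sum>k<d. M $$ (c,a) * v $ k * (of_nat d * (\<Sum>g\<in>carrier H. \<rho> g $$ (a,k) * \<rho> (inv g) $$ (i,b))))"
    by (simp add: sum_distrib_left)
  also have "\<dots> = (\<Sum>a<d. \<Sum>k<d. if a = b then if k = i then M $$ (c,a) * v $ k * of_nat (order H) else 0 else 0)"
    using i cb by (intro sum.cong) (auto simp: schurD)
  also have "\<dots> = (\<Sum>a<d. if a = b then \<Sum>k<d. if k = i then M $$ (c,a) * v $ k * of_nat (order H) else 0 else 0)"
    by (intro sum.cong) auto
  also have "\<dots> = M $$ (c,b) * v $ i * of_nat (order H)" using i cb by simp
  finally have "M $$ (c,b) = 0" using i ord by simp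
  then show "M $$ (c,b) = 0\<^sub>m d d $$ (c,b)" using cb by simp
qed (use M in auto)

end

end

section \<open>Reduction of complex representations\<close>

lemma primitive_root_powers:
  fixes \<zeta> :: "'a::field"
  assumes "primitive_root_of_unity n \<zeta>"
  shows "inj_on (\<lambda>i. \<zeta> ^ i) {..<n}" "{x. x ^ n = 1} = (\<lambda>i. \<zeta> ^ i) ` {..<n}"
proof -
  have n: "0 < n" "\<zeta> ^ n = 1" and pr: "\<And>m. 0 < m \<Longrightarrow> m < n \<Longrightarrow> \<zeta> ^ m \<noteq> 1"
    using assms by (auto simp: primitive_root_of_unity_def)
  have z0: "\<zeta> \<noteq> 0" using n by (auto simp: power_0_left)
  have lt: "\<zeta> ^ i \<noteq> \<zeta> ^ j" if "i < j" "j < n" for i j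
  proof
    assume "\<zeta> ^ i = \<zeta> ^ j"
    also have "\<zeta> ^ j = \<zeta> ^ i * \<zeta> ^ (j - i)" using that by (simp add: power_add[symmetric])
    finally have "\<zeta> ^ (j - i) = 1" using z0 by simp
    then show False using pr[of "j - i"] that by simp
  qed
  show inj: "inj_on (\<lambda>i. \<zeta> ^ i) {..<n}"
  proof (rule inj_onI)
    fix i j assume "i \<in> {..<n}" "j \<in> {..<n}" "\<zeta> ^ i = \<zeta> ^ j"
    then show "i = j" using lt[of i j] lt[of j i] by (cases i j rule: linorder_cases) auto
  qed
  define p where "p = monom 1 n - (1 :: 'a poly)"
  have p: "poly p x = x ^ n - 1" for x by (simp add: p_def poly_monom)
  have "p \<noteq> 0"
  proof
    assume "p = 0"
    then have "poly p 0 = 0" by simp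
    then show False using n by (simp add: p power_0_left)
  qed
  have "degree p \<le> n" unfolding p_def by (intro degree_diff_le) (auto simp: degree_monom_le)
  have set_eq: "{x. x ^ n = 1} = {x. poly p x = 0}" by (simp add: p)
  then have "finite {x::'a. x ^ n = 1}" using poly_roots_finite[OF \<open>p \<noteq> 0\<close>] by simp
  moreover have "card {x::'a. x ^ n = 1} \<le> n"
    unfolding set_eq using card_poly_roots_bound[OF \<open>p \<noteq> 0\<close>] \<open>degree p \<le> n\<close> by simp
  moreover have "(\<lambda>i. \<zeta> ^ i) ` {..<n} \<subseteq> {x. x ^ n = 1}"
    using n by (auto simp: power_mult[symmetric] mult.commute) (metis power_mult power_one mult.commute)
  moreover have "card ((\<lambda>i. \<zeta> ^ i) ` {..<n}) = n" using card_image[OF inj] by simp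
  ultimately show "{x. x ^ n = 1} = (\<lambda>i. \<zeta> ^ i) ` {..<n}"
    by (metis card_seteq)
qed

lemma power_mod_order:
  fixes \<zeta> :: "'a::monoid_mult"
  assumes "\<zeta> ^ n = 1"
  shows "\<zeta> ^ (k mod n) = \<zeta> ^ k"
proof -
  have "\<zeta> ^ k = \<zeta> ^ (n * (k div n) + k mod n)" by simp
  then show ?thesis by (simp only: power_add power_mult assms) simp
qed

lemma primitive_root_cis: "0 < n \<Longrightarrow> primitive_root_of_unity n (cis (2 * pi / real n))"
proof -
  assume n: "0 < n"
  have pow: "cis (2 * pi / real n) ^ m = cis (2 * pi * real m / real n)" for m
    by (simp add: Complex.DeMoivre mult.commute)
  have inj: "inj_on (\<lambda>k. cis (2 * pi * real k / real n)) {..<n}"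
    using bij_betw_roots_unity[OF n] by (simp add: bij_betw_def)
  show ?thesis unfolding primitive_root_of_unity_def
  proof (intro conjI allI impI n)
    show "cis (2 * pi / real n) ^ n = 1" unfolding pow using n by simp
    fix m assume "0 < m \<and> m < n"
    then show "cis (2 * pi / real n) ^ m \<noteq> 1"
      unfolding pow using inj_onD[OF inj, of m 0] n by auto
  qed
qed

lemma root_lift_power:
  fixes \<zeta> :: "'k::field"
  assumes "primitive_root_of_unity n \<zeta>"
  shows "root_lift n \<zeta> (\<zeta> ^ k) = cis (2 * pi / real n) ^ k"
proof -
  have n: "0 < n" "\<zeta> ^ n = 1" using assms by (auto simp: primitive_root_of_unity_def)
  have "(THE i. i < n \<and> \<zeta> ^ i = \<zeta> ^ k) = k mod n"
  proof (rule the_equality)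
    show "k mod n < n \<and> \<zeta> ^ (k mod n) = \<zeta> ^ k" using n by (simp add: power_mod_order)
    fix i assume i: "i < n \<and> \<zeta> ^ i = \<zeta> ^ k"
    then have "\<zeta> ^ i = \<zeta> ^ (k mod n)" using power_mod_order[OF n(2)] by simp
    then show "i = k mod n"
      using inj_onD[OF primitive_root_powers(1)[OF assms], of i "k mod n"] i n by simp
  qed
  then show ?thesis
    using power_mod_order[of "cis (2 * pi / real n)" n k] primitive_root_cis[OF n(1)]
    by (simp add: root_lift_def primitive_root_of_unity_def)
qed

lemma pow_one_imp_eigenvalue_pow_one:
  fixes A :: "'a::field mat"
  assumes A: "A \<in> carrier_mat d d" "A ^\<^sub>m n = 1\<^sub>m d" and e: "poly (char_poly A) e = 0"
  shows "e ^ n = 1"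
proof -
  obtain v where v: "eigenvector A v e"
    using eigenvalue_root_char_poly[OF A(1)] e unfolding eigenvalue_def by auto
  then have vc: "v \<in> carrier_vec d" "v \<noteq> 0\<^sub>v d" using A by (auto simp: eigenvector_def)
  then obtain i where i: "i < d" "v $ i \<noteq> 0" by (metis carrier_vecD eq_vecI index_zero_vec)
  have "v = e ^ n \<cdot>\<^sub>v v" using eigenvector_pow[OF A(1) v, of n] A vc by simp
  then have "v $ i = e ^ n * v $ i" using i vc by (metis carrier_vecD index_smult_vec(1))
  then show ?thesis using i by simp
qed

lemma ring_hom_on_ipoly:
  fixes w :: "'a::field_char_0" and z :: "'b::comm_ring_1"
  assumes "\<And>F. ipoly F w = 0 \<Longrightarrow> poly (of_int_poly F) z = 0"
  obtains f where "ring_hom_on (range (\<lambda>F. ipoly F w)) f" "\<And>F. f (ipoly F w) = poly (of_int_poly F) z"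
proof -
  define f where "f x = poly (of_int_poly (SOME F. ipoly F w = x)) z" for x
  have f: "f (ipoly F w) = poly (of_int_poly F) z" for F
  proof -
    define G where "G = (SOME G. ipoly G w = ipoly F w)"
    have "ipoly G w = ipoly F w" unfolding G_def by (rule someI) (rule refl)
    then have "ipoly (G - F) w = 0" by (simp add: of_int_poly_hom.hom_minus)
    then have "poly (of_int_poly (G - F)) z = 0" by (rule assms)
    then show ?thesis by (simp add: of_int_poly_hom.hom_minus f_def G_def)
  qed
  have "ring_hom_on (range (\<lambda>F. ipoly F w)) f"
  proof
    show "1 \<in> range (\<lambda>F. ipoly F w)" by (rule range_eqI[of _ _ 1]) simp
    show "f 1 = 1" using f[of 1] by simp
    fix x y assume "x \<in> range (\<lambda>F. ipoly F w)" "y \<in> range (\<lambda>F. ipoly F w)"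
    then obtain F G where xy: "x = ipoly F w" "y = ipoly G w" by blast
    have eq: "x + y = ipoly (F + G) w" "x * y = ipoly (F * G) w" "- x = ipoly (- F) w"
      unfolding xy by (simp_all add: of_int_poly_hom.hom_add of_int_poly_hom.hom_mult of_int_poly_hom.hom_uminus)
    show "x + y \<in> range (\<lambda>F. ipoly F w)" "x * y \<in> range (\<lambda>F. ipoly F w)" "- x \<in> range (\<lambda>F. ipoly F w)"
      unfolding eq by blast+
    show "f (x + y) = f x + f y" "f (x * y) = f x * f y" "f (- x) = - f x"
      unfolding eq unfolding xy f
      by (simp_all add: of_int_poly_hom.hom_add of_int_poly_hom.hom_mult of_int_poly_hom.hom_uminus)
  qed
  then show ?thesis using that f by blast
qed

text \<open>Since \<open>x\<close> is a power of its inverse, it lies in the valuation ring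
  whichever of the two does.\<close>

lemma (in maximal_ring_hom_on) root_of_unity_in:
  assumes "x ^ n = 1" "0 < n"
  shows "x \<in> R"
proof -
  have x: "x \<noteq> 0" using assms by (auto simp: power_0_left)
  have "inverse x ^ (n - 1) = x"
    using assms x by (cases n) (auto simp: power_inverse field_simps)
  then show ?thesis using in_or_inverse_in[of x] power[of "inverse x" "n - 1"] by auto
qed

text \<open>A first place, which may send the chosen complex root of unity to any primitive root,
  serves to verify that the ring homomorphism sending it to \<open>\<zeta>\<close> is well defined.\<close>

lemma maximal_ring_hom_on_root_of_unity:
  fixes \<zeta> :: "'b::alg_closed_field" and \<omega> :: "'a::field_char_0"
  assumes \<zeta>: "primitive_root_of_unity n \<zeta>" and \<omega>: "primitive_root_of_unity n \<omega>"
    and n0: "of_nat n \<noteq> (0::'b)"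
  obtains R f where "maximal_ring_hom_on R f" "\<omega> \<in> R" "f \<omega> = \<zeta>"
proof -
  have n: "0 < n" "\<zeta> ^ n = 1" "\<omega> ^ n = 1" and prz: "\<And>m. 0 < m \<Longrightarrow> m < n \<Longrightarrow> \<zeta> ^ m \<noteq> 1"
    and prw: "\<And>m. 0 < m \<Longrightarrow> m < n \<Longrightarrow> \<omega> ^ m \<noteq> 1"
    using \<zeta> \<omega> by (auto simp: primitive_root_of_unity_def)
  have "poly (of_int_poly F) (0::'b) = 0" if "ipoly F (0::'a) = 0" for F
    using that by (simp add: poly_0_coeff_0)
  \<comment> \<open>Evaluation at 0 has the integers as its range, so the first place extends the
    map from the integers to \<open>'b\<close>.\<close>
  then obtain f0 :: "'a \<Rightarrow> 'b" where f0: "ring_hom_on (range (\<lambda>F. ipoly F 0)) f0"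
    by (rule ring_hom_on_ipoly)
  obtain R1 :: "'a set" and f1 :: "'a \<Rightarrow> 'b" where "maximal_ring_hom_on R1 f1"
    by (rule maximal_ring_hom_on_exists[OF f0])
  then interpret one: maximal_ring_hom_on R1 f1 .
  have wR: "\<omega> \<in> R1" by (rule one.root_of_unity_in[OF n(3,1)])
  have fpow: "f1 (\<omega> ^ k) = f1 \<omega> ^ k" "\<omega> ^ k \<in> R1" for k using one.power[OF wR] by auto
  \<comment> \<open>The geometric sum of the powers of \<open>\<omega> ^ m\<close> is 0. If
    \<open>f1 \<omega> ^ m\<close> were 1, its image would be \<open>n\<close>, which is nonzero in
    \<open>'b\<close>.\<close>
  have "f1 \<omega> ^ m \<noteq> 1" if m: "0 < m" "m < n" for m
  proof
    assume *: "f1 \<omega> ^ m = 1"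
    have "(\<omega> ^ m - 1) * (\<Sum>k<n. (\<omega> ^ m) ^ k) = (\<omega> ^ m) ^ n - 1"
      by (rule power_diff_1_eq[symmetric])
    also have "\<dots> = 0" using n by (metis power_mult power_one mult.commute diff_self)
    finally have "(\<Sum>k<n. (\<omega> ^ m) ^ k) = 0" using prw[OF m] by simp
    then have "f1 (\<Sum>k<n. (\<omega> ^ m) ^ k) = 0" by simp
    moreover have "f1 (\<Sum>k<n. (\<omega> ^ m) ^ k) = (\<Sum>k<n. f1 ((\<omega> ^ m) ^ k))"
      using one.sum[of "{..<n}" "\<lambda>k. (\<omega> ^ m) ^ k"] one.power[OF fpow(2)] by blast
    moreover have "f1 ((\<omega> ^ m) ^ k) = 1" for k using one.power[OF fpow(2), of m k] * by (simp add: fpow)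
    ultimately show False using n0 by simp
  qed
  moreover have "f1 \<omega> ^ n = 1" using fpow(1)[of n] n by simp
  ultimately have prim: "primitive_root_of_unity n (f1 \<omega>)" using n by (simp add: primitive_root_of_unity_def)
  obtain b0 where b0: "\<zeta> = f1 \<omega> ^ b0"
    using primitive_root_powers(2)[OF prim] n(2) by blast
  \<comment> \<open>Adding \<open>n\<close> leaves the power unchanged and makes the exponent
    nonzero, as \<open>ipoly_root_of_unity_coprime_power\<close> requires.\<close>
  define b where "b = b0 + n"
  have b: "\<zeta> = f1 \<omega> ^ b" "b \<noteq> 0"
    using b0 \<open>f1 \<omega> ^ n = 1\<close> n by (simp_all add: b_def power_add)
  have "coprime b n"
  proof (rule ccontr)
    assume "\<not> coprime b n"
    define g where "g = gcd b n"
    have "g \<noteq> 1" using \<open>\<not> coprime b n\<close> by (metis coprime_iff_gcd_eq_1 g_def)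
    moreover have "g \<noteq> 0" using n(1) unfolding g_def by (metis gcd_eq_0_iff less_irrefl)
    ultimately have g0: "1 < g" by linarith
    obtain b' where b': "b = g * b'" unfolding g_def by (metis dvdE gcd_dvd1)
    obtain n' where n': "n = g * n'" unfolding g_def by (metis dvdE gcd_dvd2)
    have "b * n' = n * b'" using b' n' by (metis mult.assoc mult.commute)
    then have "\<zeta> ^ n' = (f1 \<omega> ^ n) ^ b'" unfolding b power_mult[symmetric] by simp
    then have "\<zeta> ^ n' = 1" using \<open>f1 \<omega> ^ n = 1\<close> by simp
    moreover have "0 < n'" using n(1) n' by (metis gr0I mult_0_right)
    moreover have "n' < n" 
      using mult_strict_right_mono[OF g0 \<open>0 < n'\<close>] n' by simp
    ultimately show False using prz by blast
  qed
  \<comment> \<open>A relation of \<open>\<omega>\<close> also holds for its conjugate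
    \<open>\<omega> ^ b\<close>, and \<open>f1\<close> sends that conjugate to
    \<open>\<zeta>\<close>.\<close>
  have wd: "poly (of_int_poly F) \<zeta> = 0" if "ipoly F \<omega> = 0" for F
  proof -
    have "ipoly F (\<omega> ^ b) = 0"
      using ipoly_root_of_unity_coprime_power[OF n(3,1) \<open>coprime b n\<close> b(2) that] .
    moreover have "f1 (ipoly F (\<omega> ^ b)) = poly (map_poly f1 (of_int_poly F)) (f1 (\<omega> ^ b))"
      using one.poly_in[of "of_int_poly F" "\<omega> ^ b"] one.of_int fpow(2) by simp
    moreover have "map_poly f1 (of_int_poly F) = of_int_poly F"
      using one.of_int by (intro poly_eqI) simp
    ultimately show ?thesis using b fpow by simp
  qed
  obtain f2 where
    f2: "ring_hom_on (range (\<lambda>F. ipoly F \<omega>)) f2" "\<And>F. f2 (ipoly F \<omega>) = poly (of_int_poly F) \<zeta>"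
    using ring_hom_on_ipoly[OF wd] by metis
  obtain R f where Rf: "maximal_ring_hom_on R f" "range (\<lambda>F. ipoly F \<omega>) \<subseteq> R"
    "\<And>x. x \<in> range (\<lambda>F. ipoly F \<omega>) \<Longrightarrow> f x = f2 x"
    using maximal_ring_hom_on_exists[OF f2(1)] by metis
  have w: "\<omega> = ipoly [:0,1:] \<omega>" by simp
  then have "\<omega> \<in> range (\<lambda>F. ipoly F \<omega>)" by (rule range_eqI)
  moreover from this have "f \<omega> = \<zeta>" using Rf(3) f2(2)[of "[:0,1:]"] by simp
  ultimately show ?thesis using that Rf by blast
qed

text \<open>Divisibility is total in a valuation ring, so a finite set has a nonzero member of least
  valuation.\<close>

lemma (in maximal_ring_hom_on) finite_set_divisor:
  assumes "finite A" "a \<in> A" "a \<noteq> 0"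
  shows "\<exists>m\<in>A. m \<noteq> 0 \<and> (\<forall>x\<in>A. x / m \<in> R)"
  using assms
proof (induction A arbitrary: a rule: finite_induct)
  case empty
  then show ?case by simp
next
  case (insert x A)
  show ?case
  proof (cases "\<exists>a\<in>A. a \<noteq> 0")
    case False
    then have "a = x" using insert.prems by blast
    then show ?thesis using False insert.prems by (intro bexI[of _ x]) auto
  next
    case True
    then obtain m where m: "m \<in> A" "m \<noteq> 0" "\<And>y. y \<in> A \<Longrightarrow> y / m \<in> R" using insert.IH by blast
    show ?thesis
    proof (cases "x / m \<in> R")
      case True
      then show ?thesis using m by blast
    next
      case False
      then have x: "x \<noteq> 0" by auto
      have mx: "m / x \<in> R" using False in_or_inverse_in[of "x / m"] by auto
      have "y / x \<in> R" if "y \<in> A" for y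
        using mult(1)[OF m(3)[OF that] mx] m(2) by simp
      then show ?thesis using x by (intro bexI[of _ x]) auto
    qed
  qed
qed

text \<open>The columns of the conjugating matrix are chosen among the columns of all \<open>\<rho> g\<close> such that
  its determinant divides the determinants of all other choices; integrality is then Cramer's rule.\<close>

lemma (in matrix_rep) integral_conjugate:
  fixes R :: "'a set" and f :: "'a \<Rightarrow> 'c::alg_closed_field"
  assumes "maximal_ring_hom_on R f"
  obtains P Q where "P \<in> carrier_mat d d" "Q \<in> carrier_mat d d" "P * Q = 1\<^sub>m d" "Q * P = 1\<^sub>m d"
    "\<And>g i j. g \<in> carrier H \<Longrightarrow> i < d \<Longrightarrow> j < d \<Longrightarrow> (Q * \<rho> g * P) $$ (i,j) \<in> R"
proof -
  interpret R: maximal_ring_hom_on R f by fact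
  define T where "T = carrier H \<times> {..<d}"
  define w where "w t = col (\<rho> (fst t)) (snd t)" for t
  define S where "S = PiE {..<d} (\<lambda>_. T)"
  define B where "B s = mat d d (\<lambda>(i,j). w (s j) $ i)" for s :: "nat \<Rightarrow> 'h \<times> nat"
  have "finite S" unfolding S_def T_def by (rule finite_PiE) (use fin in auto)
  have wc: "w t \<in> carrier_vec d" if "t \<in> T" for t
  proof -
    have "fst t \<in> carrier H" using that by (auto simp: T_def)
    then show ?thesis by (intro carrier_vecI) (simp add: w_def)
  qed
  \<comment> \<open>The columns of \<open>\<rho> \<one>\<close> form the identity matrix, so some
    choice has a nonzero determinant.\<close>
  define s1 where "s1 = (\<lambda>j\<in>{..<d}. (\<one>, j))"
  have s1: "s1 \<in> S" unfolding s1_def S_def T_def by (intro restrict_PiE_iff[THEN iffD2] ballI) auto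
  have "B s1 = 1\<^sub>m d" by (intro eq_matI) (auto simp: B_def s1_def w_def one)
  then have "det (B s1) \<noteq> 0" by simp
  then obtain s where s: "s \<in> S" "det (B s) \<noteq> 0" "\<And>s'. s' \<in> S \<Longrightarrow> det (B s') / det (B s) \<in> R"
    using R.finite_set_divisor[of "(\<lambda>s. det (B s)) ` S" "det (B s1)"] \<open>finite S\<close> s1 by auto
  define P where "P = B s"
  have P: "P \<in> carrier_mat d d" "det P \<noteq> 0" using s by (simp_all add: P_def B_def)
  obtain Q where Q: "Q \<in> carrier_mat d d" "P * Q = 1\<^sub>m d" "Q * P = 1\<^sub>m d"
    using nonzero_det_inverse[OF P] by blast
  have "(Q * \<rho> h * P) $$ (i,j) \<in> R" if h: "h \<in> carrier H" and ij: "i < d" "j < d" for h i j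
  proof -
    obtain g k where t: "s j = (g, k)" "g \<in> carrier H" "k < d"
      using s(1) ij by (auto simp: S_def T_def PiE_def Pi_def)
    \<comment> \<open>Multiplication by \<open>\<rho> h\<close> carries the column indexed by
      \<open>(g, k)\<close> to the one indexed by \<open>(h \<otimes> g, k)\<close>, hence permits
      only the vectors \<open>w t\<close> as results.\<close>
    define t' where "t' = (h \<otimes> g, k)"
    have t': "t' \<in> T" using t h by (simp add: t'_def T_def)
    define x where "x = Q *\<^sub>v w t'"
    have x: "x \<in> carrier_vec d" using Q by (simp add: x_def mult_mat_vec_carrier[OF Q(1) wc[OF t']])
    have "col P j = col (\<rho> g) k"
      using ij t by (intro eq_vecI) (auto simp: P_def B_def w_def)
    then have "\<rho> h *\<^sub>v col P j = w t'"
      using col_mult2[OF carr[OF h] carr[OF t(2)] t(3)] h t by (simp add: w_def t'_def mult)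
    then have "col (Q * \<rho> h * P) j = x"
      using col_mult2[OF mult_carrier_mat[OF Q(1) carr[OF h]] P(1) ij(2)] Q(1) carr[OF h] P(1) ij
      by (simp add: x_def assoc_mult_mat_vec[of _ d d _ d])
    then have entry: "(Q * \<rho> h * P) $$ (i,j) = x $ i"
      using ij P Q h by (metis carr carrier_matD index_col index_mult_mat(2,3))
    have Px: "P *\<^sub>v x = w t'"
      unfolding x_def using P Q wc[OF t'] by (simp add: assoc_mult_mat_vec[of _ d d _ d, symmetric])
    \<comment> \<open>Replacing column \<open>i\<close> of \<open>P\<close> by \<open>w t'\<close>
      is again an admissible choice, so the numerator in Cramer's rule is divisible by
      \<open>det P\<close> in \<open>R\<close>.\<close>
    define s' where "s' = s(i := t')"
    have s': "s' \<in> S" using s(1) t' ij by (auto simp: s'_def S_def PiE_def Pi_def extensional_def)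
    have "replace_col P (w t') i = B s'"
      by (intro eq_matI) (auto simp: replace_col_def P_def B_def s'_def)
    then have "det (B s') = x $ i * det P"
      using cramer_lemma_mat[OF P(1) x ij(1)] Px by simp
    then have "x $ i = det (B s') / det (B s)" using P by (simp add: P_def)
    then show ?thesis using s(3)[OF s'] entry by simp
  qed
  then show ?thesis using that[OF P(1) Q] by blast
qed

section \<open>Determinants, characteristic polynomials and traces under reduction\<close>

context ring_hom_on
begin

lemma det_map:
  assumes A: "A \<in> carrier_mat d d" and "\<And>i j. i < d \<Longrightarrow> j < d \<Longrightarrow> A $$ (i,j) \<in> R"
  shows "det A \<in> R \<and> f (det A) = det (map_mat f A)"
proof -
  have sg: "signof p \<in> R \<and> f (signof p) = signof p" for p :: "nat \<Rightarrow> nat"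
    using uminus[of 1] by (cases p rule: sign_cases) auto
  have pr: "(\<Prod>i = 0..<d. A $$ (i, p i)) \<in> R \<and> 
      f (\<Prod>i = 0..<d. A $$ (i, p i)) = (\<Prod>i = 0..<d. f (A $$ (i, p i)))" if "p permutes {0..<d}" for p
    by (rule prod) (use assms permutes_in_image[OF that] in auto)
  have "map_mat f A \<in> carrier_mat d d" using A by simp
  then have "det (map_mat f A) = (\<Sum>p\<in>{p. p permutes {0..<d}}. signof p * (\<Prod>i = 0..<d. map_mat f A $$ (i, p i)))"
    by (rule det_def')
  also have "\<dots> = (\<Sum>p\<in>{p. p permutes {0..<d}}. f (signof p * (\<Prod>i = 0..<d. A $$ (i, p i))))"
  proof (rule sum.cong[OF refl])
    fix p assume "p \<in> {p. p permutes {0..<d}}"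
    then have p: "p permutes {0..<d}" by simp
    have "(\<Prod>i = 0..<d. map_mat f A $$ (i, p i)) = (\<Prod>i = 0..<d. f (A $$ (i, p i)))"
      by (rule prod.cong) (use A permutes_in_image[OF p] in auto)
    then show "signof p * (\<Prod>i = 0..<d. map_mat f A $$ (i, p i)) = f (signof p * (\<Prod>i = 0..<d. A $$ (i, p i)))"
      using sg pr[OF p] mult(2) by simp
  qed
  finally show ?thesis
    unfolding det_def'[OF A]
    using sum[of "{p. p permutes {0..<d}}" "\<lambda>p. signof p * (\<Prod>i = 0..<d. A $$ (i, p i))"] sg pr mult(1)
    by auto
qed

lemma char_poly_map:
  assumes A: "A \<in> carrier_mat d d" and R: "\<And>i j. i < d \<Longrightarrow> j < d \<Longrightarrow> A $$ (i,j) \<in> R"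
  shows "char_poly (map_mat f A) = map_poly f (char_poly A)"
proof -
  interpret P: ring_hom_on "{p. \<forall>i. coeff p i \<in> R}" "map_poly f" by (rule ring_hom_on_poly)
  have entry: "char_poly_matrix A $$ (i,j) = (if i = j then [:- (A $$ (i,i)), 1:] else [:- (A $$ (i,j)):])"
    if "i < d" "j < d" for i j using that A by (simp add: char_poly_matrix_def)
  have "map_mat (map_poly f) (char_poly_matrix A) = char_poly_matrix (map_mat f A)"
  proof (rule eq_matI)
    fix i j assume "i < dim_row (char_poly_matrix (map_mat f A))" "j < dim_col (char_poly_matrix (map_mat f A))"
    then have ij: "i < d" "j < d" using A by (auto simp: char_poly_matrix_def)
    then have "map_poly f (char_poly_matrix A $$ (i,j)) = char_poly_matrix (map_mat f A) $$ (i,j)"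
      using A R uminus by (auto simp: entry poly_eq_iff char_poly_matrix_def coeff_pCons split: nat.split)
    then show "map_mat (map_poly f) (char_poly_matrix A) $$ (i,j) = char_poly_matrix (map_mat f A) $$ (i,j)"
      using ij A by (simp add: char_poly_matrix_def)
  qed (use A in \<open>auto simp: char_poly_matrix_def\<close>)
  moreover have "coeff (char_poly_matrix A $$ (i,j)) k \<in> R" if "i < d" "j < d" for i j k
    using that A R uminus by (auto simp: entry coeff_pCons split: nat.split)
  ultimately show ?thesis
    unfolding char_poly_def using P.det_map[of "char_poly_matrix A" d] A by simp
qed

lemma mat_trace_map:
  assumes "A \<in> carrier_mat d d" "\<And>i j. i < d \<Longrightarrow> j < d \<Longrightarrow> A $$ (i,j) \<in> R"
  shows "mat_trace (map_mat f A) = f (mat_trace A)"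
  using assms sum[of "{..<d}" "\<lambda>i. A $$ (i,i)"] by (simp add: mat_trace_def)

lemma map_mat_mult:
  assumes A: "A \<in> carrier_mat d d" "\<And>i j. i < d \<Longrightarrow> j < d \<Longrightarrow> A $$ (i,j) \<in> R"
    and B: "B \<in> carrier_mat d d" "\<And>i j. i < d \<Longrightarrow> j < d \<Longrightarrow> B $$ (i,j) \<in> R"
  shows "map_mat f (A * B) = map_mat f A * map_mat f B"
proof (rule eq_matI)
  fix i j assume "i < dim_row (map_mat f A * map_mat f B)" "j < dim_col (map_mat f A * map_mat f B)"
  then have ij: "i < d" "j < d" using A B by auto
  then show "map_mat f (A * B) $$ (i,j) = (map_mat f A * map_mat f B) $$ (i,j)"
    using A B sum[of "{0..<d}" "\<lambda>k. A $$ (i,k) * B $$ (k,j)"] by (simp add: scalar_prod_def mult)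
qed (use A B in auto)

end

text \<open>All equations involved are built from entries by ring operations. The lemma serves
  twice: for the place on the complex numbers, and for the Frobenius twist with
  \<open>R = UNIV\<close>.\<close>

lemma (in matrix_rep) reduction:
  fixes R :: "'a set" and f :: "'a \<Rightarrow> 'c::field"
  assumes "ring_hom_on R f"
    and R: "\<And>g i j. g \<in> carrier H \<Longrightarrow> i < d \<Longrightarrow> j < d \<Longrightarrow> \<rho> g $$ (i,j) \<in> R"
  shows "matrix_rep H d (\<lambda>g. map_mat f (\<rho> g))"
    "schur_relations H d \<rho> \<Longrightarrow> schur_relations H d (\<lambda>g. map_mat f (\<rho> g))"
proof -
  interpret f: ring_hom_on R f by fact
  show "matrix_rep H d (\<lambda>g. map_mat f (\<rho> g))"
  proof
    show "map_mat f (\<rho> \<one>) = 1\<^sub>m d" unfolding one by (intro eq_matI) auto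
    show "map_mat f (\<rho> (g \<otimes> h)) = map_mat f (\<rho> g) * map_mat f (\<rho> h)"
      if "g \<in> carrier H" "h \<in> carrier H" for g h
      using f.map_mat_mult[OF carr[OF that(1)] R[OF that(1)] carr[OF that(2)] R[OF that(2)]] that
      by (simp add: mult)
  qed (use fin carr in auto)
  assume S: "schur_relations H d \<rho>"
  show "schur_relations H d (\<lambda>g. map_mat f (\<rho> g))"
    unfolding schur_relations_def
  proof (intro allI impI)
    fix a i j b assume less: "a < d" "i < d" "j < d" "b < d"
    let ?t = "\<lambda>g. \<rho> g $$ (a,i) * \<rho> (inv g) $$ (j,b)"
    have t: "?t g \<in> R \<and> f (?t g) = map_mat f (\<rho> g) $$ (a,i) * map_mat f (\<rho> (inv g)) $$ (j,b)"
      if "g \<in> carrier H" for g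
      using that less R by (simp add: f.mult)
    have s: "sum ?t (carrier H) \<in> R \<and> f (sum ?t (carrier H)) = (\<Sum>g\<in>carrier H. f (?t g))"
      by (rule f.sum) (use t in blast)
    have "of_nat d * (\<Sum>g\<in>carrier H. map_mat f (\<rho> g) $$ (a,i) * map_mat f (\<rho> (inv g)) $$ (j,b))
      = f (of_nat d * sum ?t (carrier H))"
      using s t f.of_nat[of d] by (simp add: f.mult)
    also have "of_nat d * sum ?t (carrier H) = (if i = j \<and> a = b then of_nat (order H) else 0)"
      using S less unfolding schur_relations_def by blast
    also have "f \<dots> = (if i = j \<and> a = b then of_nat (order H) else 0)" using f.of_nat by simp
    finally show "of_nat d * (\<Sum>g\<in>carrier H. map_mat f (\<rho> g) $$ (a,i) * map_mat f (\<rho> (inv g)) $$ (j,b))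
       = (if i = j \<and> a = b then of_nat (order H) else 0)" .
  qed
qed

lemma brauer_value_eq:
  assumes "char_poly A = (\<Prod>e\<leftarrow>es. [:- e, 1:])"
  shows "brauer_value n \<zeta> A = (\<Sum>e\<leftarrow>es. root_lift n \<zeta> e)"
  using assms proots_linear_factors[of id es] by (simp add: brauer_value_def flip: sum_mset_sum_list)

text \<open>The function \<open>F\<close> is the place itself. What matters about it is that the
  trace of \<open>\<psi> g\<close> depends only on the complex trace, so equal character values give
  equal traces in \<open>'l\<close>.\<close>

theorem irreducible_rep_reduction:
  fixes \<rho> :: "'h \<Rightarrow> complex mat" and \<zeta> :: "'l::alg_closed_field"
  assumes H: "group H" "finite (carrier H)" and irr: "irreducible_rep H d \<rho>"
    and ord: "of_nat (order H) \<noteq> (0::'l)" and \<zeta>: "primitive_root_of_unity (order H) \<zeta>"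
  obtains \<psi> :: "'h \<Rightarrow> 'l mat" and F :: "complex \<Rightarrow> 'l" where
    "matrix_rep H d \<psi>" "schur_relations H d \<psi>"
    "\<And>g. g \<in> carrier H \<Longrightarrow> brauer_value (order H) \<zeta> (\<psi> g) = mat_trace (\<rho> g)"
    "\<And>g. g \<in> carrier H \<Longrightarrow> mat_trace (\<psi> g) = F (mat_trace (\<rho> g))"
proof -
  let ?n = "order H"
  interpret matrix_rep H d \<rho>
    using irr matrix_rep_iff_hom_GL[OF H, of d \<rho>] by (simp add: irreducible_rep_def)
  have n: "0 < ?n" using H order_gt_0_iff_finite by blast
  define \<omega> where "\<omega> = cis (2 * pi / real ?n)"
  have \<omega>: "primitive_root_of_unity ?n \<omega>" unfolding \<omega>_def by (rule primitive_root_cis[OF n])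
  obtain R and f :: "complex \<Rightarrow> 'l" where Rf: "maximal_ring_hom_on R f" "\<omega> \<in> R" "f \<omega> = \<zeta>"
    using maximal_ring_hom_on_root_of_unity[OF \<zeta> \<omega> ord] by blast
  interpret R: maximal_ring_hom_on R f by fact
  obtain P Q where PQ: "P \<in> carrier_mat d d" "Q \<in> carrier_mat d d" "P * Q = 1\<^sub>m d" "Q * P = 1\<^sub>m d"
    and int: "\<And>g i j. g \<in> carrier H \<Longrightarrow> i < d \<Longrightarrow> j < d \<Longrightarrow> (Q * \<rho> g * P) $$ (i,j) \<in> R"
    using integral_conjugate[OF Rf(1)] by blast
  define \<rho>' where "\<rho>' g = Q * \<rho> g * P" for g
  interpret r': matrix_rep H d \<rho>' unfolding \<rho>'_def by (rule conjugate[OF PQ])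
  have int': "\<And>g i j. g \<in> carrier H \<Longrightarrow> i < d \<Longrightarrow> j < d \<Longrightarrow> \<rho>' g $$ (i,j) \<in> R"
    unfolding \<rho>'_def by (rule int)
  have "commutant_scalar H d \<rho>'"
    unfolding \<rho>'_def by (rule commutant_scalar_conjugate[OF PQ irreducible_rep_commutant_scalar[OF irr H]])
  then have "schur_relations H d \<rho>'" by (rule r'.commutant_scalar_schur_relations)
  note red = r'.reduction[OF R.ring_hom_on_axioms int']
  have tr: "mat_trace (\<rho>' g) = mat_trace (\<rho> g)" if g: "g \<in> carrier H" for g
    unfolding \<rho>'_def by (rule mat_trace_conjugate[OF PQ(2) carr[OF g] PQ(1,3)])
  have "brauer_value ?n \<zeta> (map_mat f (\<rho>' g)) = mat_trace (\<rho> g)" if g: "g \<in> carrier H" for g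
  proof -
    obtain es where es: "\<And>k. char_poly (\<rho>' g ^\<^sub>m k) = (\<Prod>e\<leftarrow>es. [:- (e ^ k), 1:])"
      "\<And>k. mat_trace (\<rho>' g ^\<^sub>m k) = (\<Sum>e\<leftarrow>es. e ^ k)"
      using eigenvalue_list[OF r'.carr[OF g]] by metis
    have cp: "char_poly (\<rho>' g) = (\<Prod>e\<leftarrow>es. [:- e, 1:])" and tre: "mat_trace (\<rho>' g) = sum_list es"
      using es[of 1] r'.carr[OF g] by simp_all
    \<comment> \<open>On powers of \<open>\<omega>\<close> the place sends
      \<open>\<omega> ^ k\<close> to \<open>\<zeta> ^ k\<close>, and \<open>root_lift\<close> undoes
      this; so the lifted eigenvalues of the reduction are the original ones.\<close>
    have pow: "\<exists>k. e = \<omega> ^ k" if "e \<in> set es" for e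
    proof -
      have "poly (char_poly (\<rho>' g)) e = 0"
        unfolding cp using that by (auto simp: poly_prod_list prod_list_zero_iff)
      then have "e ^ ?n = 1"
        using pow_one_imp_eigenvalue_pow_one[OF r'.carr[OF g] r'.pow_order[OF g]] by blast
      then show ?thesis using primitive_root_powers(2)[OF \<omega>] by blast
    qed
    have fpow: "f (\<omega> ^ k) = \<zeta> ^ k" "\<omega> ^ k \<in> R" for k using R.power[OF Rf(2)] Rf(3) by auto
    interpret P: ring_hom_on "{p. \<forall>i. coeff p i \<in> R}" "map_poly f" by (rule R.ring_hom_on_poly)
    have lin: "[:- e, 1:] \<in> {p. \<forall>i. coeff p i \<in> R} \<and> map_poly f [:- e, 1:] = [:- f e, 1:]" if "e \<in> set es" for e
      using pow[OF that] fpow R.uminus by (auto simp: coeff_pCons poly_eq_iff split: nat.split)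
    have "char_poly (map_mat f (\<rho>' g)) = map_poly f (\<Prod>e\<leftarrow>es. [:- e, 1:])"
      using R.char_poly_map[OF r'.carr[OF g] int'[OF g]] cp by simp
    also have "\<dots> = (\<Prod>p\<leftarrow>map (\<lambda>e. [:- e, 1:]) es. map_poly f p)"
    proof -
      have "set (map (\<lambda>e. [:- e, 1:]) es) \<subseteq> {p. \<forall>i. coeff p i \<in> R}"
        using lin unfolding set_map by blast
      then show ?thesis using P.prod_list by blast
    qed
    also have "map (map_poly f) (map (\<lambda>e. [:- e, 1:]) es) = map (\<lambda>e. [:- e, 1:]) (map f es)"
      using lin by auto
    finally have "brauer_value ?n \<zeta> (map_mat f (\<rho>' g)) = (\<Sum>e\<leftarrow>map f es. root_lift ?n \<zeta> e)"
      by (rule brauer_value_eq)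
    also have "map (root_lift ?n \<zeta>) (map f es) = es"
    proof -
      have "root_lift ?n \<zeta> (f e) = e" if "e \<in> set es" for e
        using pow[OF that] fpow root_lift_power[OF \<zeta>] by (auto simp: \<omega>_def)
      then show ?thesis by (simp add: map_idI)
    qed
    also have "sum_list es = mat_trace (\<rho> g)" using tre tr[OF g] by simp
    finally show ?thesis .
  qed
  moreover have "mat_trace (map_mat f (\<rho>' g)) = f (mat_trace (\<rho> g))" if g: "g \<in> carrier H" for g
    using R.mat_trace_map[OF r'.carr[OF g] int'[OF g]] tr[OF g] by simp
  ultimately show ?thesis
    using that[of "\<lambda>g. map_mat f (\<rho>' g)" f] red \<open>schur_relations H d \<rho>'\<close> by blast
qed

section \<open>Invariant Hermitian forms\<close>

context alg_closed_frobenius_power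
begin

lemma GF_iff: "x \<in> GF (q\<^sup>2) \<longleftrightarrow> F (F x) = x"
  by (simp add: GF_def F_eq power_mult[symmetric] power2_eq_square)

lemma GF_vec_iff: "v \<in> GF_vec d (q\<^sup>2) \<longleftrightarrow> v \<in> carrier_vec d \<and> map_vec F (map_vec F v) = v"
  by (auto simp: GF_vec_def GF_iff vec_eq_iff)

lemma unit_vec_GF: "(unit_vec d i :: 'a vec) \<in> GF_vec d (q\<^sup>2)"
  by (auto simp: GF_vec_def GF_iff unit_vec_def)

text \<open>Linearity is available only over the field of order \<open>q\<^sup>2\<close>. The
  coordinates are added one at a time so that each truncation \<open>p k\<close> stays in
  \<open>GF_vec\<close>.\<close>

lemma hermitian_form_expand:
  fixes h :: "'a vec \<Rightarrow> 'a vec \<Rightarrow> 'a"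
  assumes h: "hermitian_form d q h" and v: "v \<in> GF_vec d (q\<^sup>2)" and w: "w \<in> GF_vec d (q\<^sup>2)"
  shows "h v w = (\<Sum>i<d. v $ i * h (unit_vec d i) w)"
proof -
  define p where "p k = vec d (\<lambda>i. if i < k then v $ i else 0)" for k
  have vi: "v $ i \<in> GF (q\<^sup>2)" if "i < d" for i using v that by (simp add: GF_vec_def)
  have p: "p k \<in> GF_vec d (q\<^sup>2)" for k
    using vi by (auto simp: p_def GF_vec_def GF_iff)
  have add: "h (u + x) w = h u w + h x w" if "u \<in> GF_vec d (q\<^sup>2)" "x \<in> GF_vec d (q\<^sup>2)" for u x
    using h w that unfolding hermitian_form_def by blast
  have smult: "h (c \<cdot>\<^sub>v x) w = c * h x w" if "c \<in> GF (q\<^sup>2)" "x \<in> GF_vec d (q\<^sup>2)" for c x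
    using h w that unfolding hermitian_form_def by blast
  have scaled: "c \<cdot>\<^sub>v unit_vec d k \<in> GF_vec d (q\<^sup>2)" if "c \<in> GF (q\<^sup>2)" for c :: 'a and k
    using that by (auto simp: GF_vec_def GF_iff unit_vec_def hom_distribs)
  have "h (p k) w = (\<Sum>i<k. v $ i * h (unit_vec d i) w)" if "k \<le> d" for k
    using that
  proof (induction k)
    case 0
    have "p 0 = 0 \<cdot>\<^sub>v p 0" by (intro eq_vecI) (auto simp: p_def)
    then have "h (p 0) w = 0 * h (p 0) w" using smult[of 0 "p 0"] p by (simp add: GF_iff)
    then show ?case by simp
  next
    case (Suc k)
    have "p (Suc k) = p k + v $ k \<cdot>\<^sub>v unit_vec d k"
      using Suc.prems by (intro eq_vecI) (auto simp: p_def unit_vec_def less_Suc_eq)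
    then show ?case
      using Suc add[OF p scaled[OF vi]] smult[OF vi unit_vec_GF] by simp
  qed
  moreover have "p d = v" using v by (intro eq_vecI) (auto simp: p_def GF_vec_def)
  ultimately show ?thesis by auto
qed

text \<open>A vector of minimal support in the kernel of a matrix that is fixed by the square of \<open>F\<close>
  becomes fixed itself once one of its entries is scaled to \<open>1\<close>.\<close>

lemma rational_kernel_vector:
  assumes A: "A \<in> carrier_mat d d" "map_mat F (map_mat F A) = A" "det A = 0"
  obtains v where "v \<in> GF_vec d (q\<^sup>2)" "v \<noteq> 0\<^sub>v d" "A *\<^sub>v v = 0\<^sub>v d"
proof -
  define K where "K v = (v \<in> carrier_vec d \<and> v \<noteq> 0\<^sub>v d \<and> A *\<^sub>v v = 0\<^sub>v d)" for v
  define s where "s v = {i. i < d \<and> v $ i \<noteq> 0}" for v :: "'a vec"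
  have "\<exists>v. K v" using A det_0_iff_vec_prod_zero_field[OF A(1)] by (auto simp: K_def)
  then obtain v where v: "K v" "\<And>u. K u \<Longrightarrow> card (s v) \<le> card (s u)"
    using arg_min_nat_lemma[of K _ "\<lambda>v. card (s v)"] by blast
  have vc: "v \<in> carrier_vec d" "v \<noteq> 0\<^sub>v d" "A *\<^sub>v v = 0\<^sub>v d" using v(1) by (auto simp: K_def)
  obtain k where k: "k < d" "v $ k \<noteq> 0" using vc by (metis carrier_vecD eq_vecI index_zero_vec)
  define u where "u = inverse (v $ k) \<cdot>\<^sub>v v"
  have u: "u \<in> carrier_vec d" "u $ k = 1" "A *\<^sub>v u = 0\<^sub>v d"
    using vc k A(1) by (auto simp: u_def mult_mat_vec[of _ d d])
  have us: "u $ i = 0" if "i < d" "v $ i = 0" for i using that vc by (simp add: u_def)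
  \<comment> \<open>This vector is again in the kernel, and its support lies in that of
    \<open>v\<close> but misses \<open>k\<close>. Minimality forces it to be zero.\<close>
  define x where "x = u - map_vec F (map_vec F u)"
  have x: "x \<in> carrier_vec d" using u by (simp add: x_def)
  have FFu: "map_vec F (map_vec F u) \<in> carrier_vec d" using u by simp
  have "A *\<^sub>v map_vec F (map_vec F u) = map_vec F (map_vec F (A *\<^sub>v u))"
    using A u mult_mat_vec_hom[of A d d u] mult_mat_vec_hom[of "map_mat F A" d d "map_vec F u"] by simp
  then have "A *\<^sub>v map_vec F (map_vec F u) = 0\<^sub>v d" unfolding u(3) by (simp add: vec_hom_zero)
  then have Ax: "A *\<^sub>v x = 0\<^sub>v d"
    unfolding x_def using mult_minus_distrib_mat_vec[OF A(1) u(1) FFu] u(3) by simp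
  have "s x \<subset> s v"
  proof
    show "s x \<subseteq> s v" using us u(1) by (auto simp: s_def x_def)
    have "k \<in> s v" "k \<notin> s x" using k u by (auto simp: s_def x_def)
    then show "s x \<noteq> s v" by blast
  qed
  moreover have "finite (s v)" by (simp add: s_def)
  ultimately have "card (s x) < card (s v)" by (rule psubset_card_mono[rotated])
  then have "\<not> K x" using v(2)[of x] by linarith
  then have x0: "x = 0\<^sub>v d" using x Ax by (auto simp: K_def)
  have "map_vec F (map_vec F u) = u"
  proof (rule eq_vecI)
    fix i assume "i < dim_vec u"
    then have i: "i < d" using u by simp
    have "x $ i = 0" using x0 i by simp
    then show "map_vec F (map_vec F u) $ i = u $ i" using i u by (simp add: x_def)
  qed simp
  then have "u \<in> GF_vec d (q\<^sup>2)" using u by (simp add: GF_vec_iff)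
  moreover have "u \<noteq> 0\<^sub>v d" using u k by auto
  ultimately show ?thesis using that u by blast
qed

text \<open>Nondegeneracy speaks only of vectors over the field of order \<open>q\<^sup>2\<close>,
  whereas a singular Gram matrix gives a kernel vector over \<open>'a\<close>;
  \<open>rational_kernel_vector\<close> closes this gap. The transpose appears because the kernel
  vector is the first argument of the form.\<close>

lemma gram_matrix:
  fixes h :: "'a vec \<Rightarrow> 'a vec \<Rightarrow> 'a"
  assumes h: "hermitian_form d q h" and nd: "nondegenerate_form d q h"
  obtains J where "J \<in> carrier_mat d d" "det J \<noteq> 0" "J\<^sup>T = map_mat F J"
    "\<And>v w. v \<in> GF_vec d (q\<^sup>2) \<Longrightarrow> w \<in> GF_vec d (q\<^sup>2) \<Longrightarrow> h v w = v \<bullet> (J *\<^sub>v map_vec F w)"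
proof -
  define J where "J = mat d d (\<lambda>(i,j). h (unit_vec d i) (unit_vec d j))"
  have J: "J \<in> carrier_mat d d" by (simp add: J_def)
  have sym: "h w v = F (h v w)" if "v \<in> GF_vec d (q\<^sup>2)" "w \<in> GF_vec d (q\<^sup>2)" for v w
    using h that unfolding hermitian_form_def F_eq by blast
  have herm: "J\<^sup>T = map_mat F J"
    by (rule eq_matI) (auto simp: J_def intro!: sym unit_vec_GF)
  have eq: "h v w = v \<bullet> (J *\<^sub>v map_vec F w)"
    if v: "v \<in> GF_vec d (q\<^sup>2)" and w: "w \<in> GF_vec d (q\<^sup>2)" for v w
  proof -
    have wc: "w \<in> carrier_vec d" using w by (simp add: GF_vec_def)
    have "h (unit_vec d i) w = (\<Sum>j<d. J $$ (i,j) * F (w $ j))" if i: "i < d" for i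
    proof -
      have "h (unit_vec d i) w = F (h w (unit_vec d i))" by (rule sym[OF w unit_vec_GF])
      also have "h w (unit_vec d i) = (\<Sum>j<d. w $ j * h (unit_vec d j) (unit_vec d i))"
        by (rule hermitian_form_expand[OF h w unit_vec_GF])
      also have "F \<dots> = (\<Sum>j<d. F (w $ j) * F (h (unit_vec d j) (unit_vec d i)))"
        by (simp add: hom_distribs)
      also have "\<dots> = (\<Sum>j<d. J $$ (i,j) * F (w $ j))"
        using i by (intro sum.cong) (simp_all add: J_def sym[OF unit_vec_GF unit_vec_GF, symmetric] mult.commute)
      finally show ?thesis .
    qed
    then show ?thesis
      unfolding hermitian_form_expand[OF h v w] using wc J
      by (simp add: scalar_prod_def atLeast0LessThan)
  qed
  have "det J \<noteq> 0"
  proof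
    assume "det J = 0"
    then have "det J\<^sup>T = 0" using J by (simp add: det_transpose)
    moreover have JT: "J\<^sup>T \<in> carrier_mat d d" using J by simp
    moreover have "map_mat F (map_mat F J\<^sup>T) = J\<^sup>T"
    proof -
      have "map_mat F J\<^sup>T = (map_mat F J)\<^sup>T" by (rule map_mat_transpose[symmetric])
      also have "\<dots> = J" unfolding herm[symmetric] by simp
      finally show ?thesis using herm by simp
    qed
    ultimately obtain v where v: "v \<in> GF_vec d (q\<^sup>2)" "v \<noteq> 0\<^sub>v d" "J\<^sup>T *\<^sub>v v = 0\<^sub>v d"
      using rational_kernel_vector by metis
    have vc: "v \<in> carrier_vec d" using v by (simp add: GF_vec_def)
    have "h v w = 0" if w: "w \<in> GF_vec d (q\<^sup>2)" for w
    proof -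
      have wc: "map_vec F w \<in> carrier_vec d" using w by (simp add: GF_vec_def)
      have "h v w = (J\<^sup>T *\<^sub>v v) \<bullet> map_vec F w"
        using eq[OF v(1) w] transpose_vec_mult_scalar[OF J wc vc] by simp
      then show ?thesis using v(3) wc by simp
    qed
    then have "v = 0\<^sub>v d" using nd v(1) unfolding nondegenerate_form_def by blast
    with v(2) show False by simp
  qed
  then show ?thesis using that J herm eq by blast
qed

text \<open>Transposing \<open>A^T J F(A) = J\<close> and applying \<open>F\<close> to it give the
  same linear equation \<open>X B = F(J)\<close> for \<open>B = A\<close> and for
  \<open>B = F(F(A))\<close>, with the invertible coefficient matrix
  \<open>X = F(A)^T F(J)\<close>.\<close>

lemma unitary_rational:
  assumes J: "J \<in> carrier_mat d d" "det J \<noteq> 0" "J\<^sup>T = map_mat F J"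
    and A: "A \<in> carrier_mat d d" "sesqui J A = J"
  shows "map_mat F (map_mat F A) = A"
proof -
  note assoc = assoc_mult_mat[of _ d d _ d _ d]
  let ?X = "(map_mat F A)\<^sup>T * map_mat F J"
  have X: "?X \<in> carrier_mat d d" using J A by simp
  have eq: "A\<^sup>T * J * map_mat F A = J" using A(2) by (simp add: sesqui_def)
  have "?X * A = (A\<^sup>T * J * map_mat F A)\<^sup>T"
    using J(1) A(1) unfolding J(3)[symmetric] by (simp add: transpose_mult[of _ d d _ d] assoc)
  also have "\<dots> = map_mat F J" unfolding eq by (rule J(3))
  finally have 1: "?X * A = map_mat F J" .
  have "?X * map_mat F (map_mat F A) = map_mat F (A\<^sup>T * J * map_mat F A)"
    using J(1) A(1) by (simp add: mat_hom_mult[of _ d d _ d] map_mat_transpose)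
  then have 2: "?X * map_mat F (map_mat F A) = map_mat F J" unfolding eq .
  have "det ?X * det A = F (det J)" using arg_cong[OF 1, of det] det_mult[OF X A(1)] by simp
  then have "det ?X \<noteq> 0" using J(2) by auto
  then obtain Y where Y: "Y \<in> carrier_mat d d" "Y * ?X = 1\<^sub>m d" using nonzero_det_inverse[OF X] by metis
  have "B = Y * (?X * B)" if "B \<in> carrier_mat d d" for B
    using assoc_mult_mat[OF Y(1) X that] Y(2) that by simp
  from this[of A] this[of "map_mat F (map_mat F A)"] show ?thesis using 1 2 A(1) by simp
qed

lemma unitary_in_GU_GF:
  assumes J: "J \<in> carrier_mat d d" "det J \<noteq> 0" "J\<^sup>T = map_mat F J"
    and h: "\<And>v w. v \<in> GF_vec d (q\<^sup>2) \<Longrightarrow> w \<in> GF_vec d (q\<^sup>2) \<Longrightarrow> h v w = v \<bullet> (J *\<^sub>v map_vec F w)"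
    and A: "A \<in> carrier (GL d)" "A \<in> carrier_mat d d" "sesqui J A = J"
  shows "A \<in> GU_GF d q h"
proof -
  have FFA: "map_mat F (map_mat F A) = A" by (rule unitary_rational[OF J A(2,3)])
  have "A $$ (i,j) \<in> GF (q\<^sup>2)" if "i < d" "j < d" for i j
    using arg_cong[OF FFA, of "\<lambda>B. B $$ (i,j)"] that A(2) by (simp add: GF_iff)
  then have "A \<in> GL_GF d (q\<^sup>2)" using A(1) by (simp add: GL_GF_def)
  moreover have "h (A *\<^sub>v v) (A *\<^sub>v w) = h v w"
    if v: "v \<in> GF_vec d (q\<^sup>2)" and w: "w \<in> GF_vec d (q\<^sup>2)" for v w
  proof -
    have vc: "v \<in> carrier_vec d" and wc: "w \<in> carrier_vec d" using v w by (auto simp: GF_vec_def)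
    have GFA: "A *\<^sub>v u \<in> GF_vec d (q\<^sup>2)" if "u \<in> GF_vec d (q\<^sup>2)" for u
    proof -
      have uc: "u \<in> carrier_vec d" "map_vec F (map_vec F u) = u" using that by (auto simp: GF_vec_iff)
      have "map_vec F (map_vec F (A *\<^sub>v u)) = A *\<^sub>v u"
        using mult_mat_vec_hom[OF A(2) uc(1)] mult_mat_vec_hom[of "map_mat F A" d d "map_vec F u"] A(2) uc FFA
        by simp
      then show ?thesis using mult_mat_vec_carrier[OF A(2) uc(1)] by (simp add: GF_vec_iff)
    qed
    let ?w = "map_vec F w"
    have Fw: "?w \<in> carrier_vec d" "map_mat F A \<in> carrier_mat d d" using wc A(2) by auto
    have c: "J *\<^sub>v (map_mat F A *\<^sub>v ?w) \<in> carrier_vec d"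
      by (rule mult_mat_vec_carrier[OF J(1) mult_mat_vec_carrier[OF Fw(2,1)]])
    have "h (A *\<^sub>v v) (A *\<^sub>v w) = (A *\<^sub>v v) \<bullet> (J *\<^sub>v (map_mat F A *\<^sub>v ?w))"
      using h[OF GFA[OF v] GFA[OF w]] mult_mat_vec_hom[OF A(2) wc] by simp
    also have "\<dots> = v \<bullet> (A\<^sup>T *\<^sub>v (J *\<^sub>v (map_mat F A *\<^sub>v ?w)))"
      using transpose_vec_mult_scalar[of "A\<^sup>T" d d _ v, OF _ c vc] A(2) by simp
    also have "A\<^sup>T *\<^sub>v (J *\<^sub>v (map_mat F A *\<^sub>v ?w)) = sesqui J A *\<^sub>v ?w"
      using J(1) A(2) Fw unfolding sesqui_def
      by (simp add: assoc_mult_mat_vec[of _ d d _ d])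
    also have "\<dots> = J *\<^sub>v ?w" by (simp add: A(3))
    finally show ?thesis using h[OF v w] by simp
  qed
  ultimately show ?thesis by (simp add: GU_GF_def)
qed

section \<open>The invariant sesquilinear form\<close>

lemma mat_trace_map:
  assumes A: "A \<in> carrier_mat d d"
  shows "mat_trace (map_mat F A) = mat_trace (A ^\<^sub>m q)"
proof -
  obtain es where es: "\<And>k. mat_trace (A ^\<^sub>m k) = (\<Sum>e\<leftarrow>es. e ^ k)"
    using eigenvalue_list[OF A] by metis
  have "mat_trace (map_mat F A) = F (mat_trace A)"
    using A by (simp add: mat_trace_def hom_distribs)
  also have "mat_trace A = (\<Sum>e\<leftarrow>es. e)" using es[of 1] A by simp
  also have "F \<dots> = (\<Sum>e\<leftarrow>es. e ^ q)" by (induction es) (simp_all add: hom_distribs F_eq[symmetric])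
  finally show ?thesis by (simp add: es)
qed

text \<open>Summing the matrix unit at \<open>(a,b)\<close> over the action of \<open>H\<close> on
  forms gives the invariant \<open>M a b\<close>. By \<open>tr\<close> and
  \<open>character_norm\<close> the entries \<open>M a b $$ (a,b)\<close> add up to
  \<open>order H\<close>, so some \<open>M a b\<close> is nonzero. Its kernel is invariant under the
  twist of \<open>\<psi>\<close>, hence zero by \<open>intertwiner_kernel\<close>.\<close>

lemma invariant_sesqui:
  assumes "matrix_rep H d \<psi>" and schur: "schur_relations H d \<psi>"
    and ord: "of_nat (order H) \<noteq> (0::'a)" and "0 < d"
    and tr: "\<And>g. g \<in> carrier H \<Longrightarrow> mat_trace (map_mat F (\<psi> g)) = mat_trace (\<psi> (inv\<^bsub>H\<^esub> g))"
  obtains M where "M \<in> carrier_mat d d" "det M \<noteq> 0" "\<And>g. g \<in> carrier H \<Longrightarrow> sesqui M (\<psi> g) = M"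
proof -
  interpret \<psi>: matrix_rep H d \<psi> by fact
  have hom: "ring_hom_on UNIV F" by unfold_locales (auto simp: hom_distribs)
  interpret F\<psi>: matrix_rep H d "\<lambda>g. map_mat F (\<psi> g)"
    by (rule \<psi>.reduction(1)[OF hom]) simp
  have F_schur: "schur_relations H d (\<lambda>g. map_mat F (\<psi> g))"
    by (rule \<psi>.reduction(2)[OF hom _ schur]) simp
  define M where "M a b = mat d d (\<lambda>(i,j). \<Sum>g\<in>carrier H. \<psi> g $$ (a,i) * F (\<psi> g $$ (b,j)))" for a b
  have M: "M a b \<in> carrier_mat d d" for a b by (simp add: M_def)
  have inv: "sesqui (M a b) (\<psi> h) = M a b" if ab: "a < d" "b < d" and h: "h \<in> carrier H" for a b h
  proof (rule eq_matI)
    fix i j assume "i < dim_row (M a b)" "j < dim_col (M a b)"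
    then have ij: "i < d" "j < d" by (auto simp: M_def)
    note hc = \<psi>.carr[OF h]
    have "sesqui (M a b) (\<psi> h) $$ (i,j) = (\<Sum>k<d. \<psi> h $$ (k,i) * (\<Sum>l<d. M a b $$ (k,l) * F (\<psi> h $$ (l,j))))"
      using ij hc M[of a b] h by (simp add: sesqui_def scalar_prod_def atLeast0LessThan)
    also have "\<dots> = (\<Sum>k<d. \<Sum>l<d. \<Sum>g\<in>carrier H. \<psi> g $$ (a,k) * \<psi> h $$ (k,i) * F (\<psi> g $$ (b,l) * \<psi> h $$ (l,j)))"
      by (simp add: M_def sum_distrib_left sum_distrib_right hom_distribs ac_simps)
    also have "\<dots> = (\<Sum>g\<in>carrier H. \<Sum>k<d. \<Sum>l<d. \<psi> g $$ (a,k) * \<psi> h $$ (k,i) * F (\<psi> g $$ (b,l) * \<psi> h $$ (l,j)))"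
      by (rule sym, subst sum.swap, rule sum.cong[OF refl], subst sum.swap, rule refl)
    also have "\<dots> = (\<Sum>g\<in>carrier H. \<psi> (g \<otimes>\<^bsub>H\<^esub> h) $$ (a,i) * F (\<psi> (g \<otimes>\<^bsub>H\<^esub> h) $$ (b,j)))"
      using ab ij h by (intro sum.cong) (simp_all add: \<psi>.mult_nth hom_sum sum_product)
    also have "\<dots> = (\<Sum>g\<in>carrier H. \<psi> g $$ (a,i) * F (\<psi> g $$ (b,j)))"
      by (rule sum.reindex_bij_betw)
        (rule bij_betwI[where g = "\<lambda>g. g \<otimes>\<^bsub>H\<^esub> inv\<^bsub>H\<^esub> h"], auto simp: h \<psi>.m_assoc)
    also have "\<dots> = M a b $$ (i,j)" using ij by (simp add: M_def)
    finally show "sesqui (M a b) (\<psi> h) $$ (i,j) = M a b $$ (i,j)" .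
  qed (use \<psi>.carr[OF h] in \<open>auto simp: sesqui_def M_def\<close>)
  have "\<exists>a<d. \<exists>b<d. M a b \<noteq> 0\<^sub>m d d"
  proof (rule ccontr)
    assume "\<not> ?thesis"
    then have "M a b $$ (a,b) = 0" if "a < d" "b < d" for a b using that by simp
    then have z: "(\<Sum>g\<in>carrier H. \<psi> g $$ (a,a) * F (\<psi> g $$ (b,b))) = 0" if "a < d" "b < d" for a b
      using that by (simp add: M_def)
    have "of_nat (order H) = (\<Sum>g\<in>carrier H. mat_trace (\<psi> g) * mat_trace (map_mat F (\<psi> g)))"
      using \<psi>.character_norm[OF schur ord \<open>0 < d\<close>] by (simp add: tr)
    also have "\<dots> = (\<Sum>g\<in>carrier H. \<Sum>a<d. \<Sum>b<d. \<psi> g $$ (a,a) * F (\<psi> g $$ (b,b)))"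
      by (intro sum.cong) (simp_all add: mat_trace_def sum_product)
    also have "\<dots> = (\<Sum>a<d. \<Sum>b<d. \<Sum>g\<in>carrier H. \<psi> g $$ (a,a) * F (\<psi> g $$ (b,b)))"
      by (subst sum.swap, rule sum.cong[OF refl], subst sum.swap, rule refl)
    also have "\<dots> = 0" using z by simp
    finally show False using ord by simp
  qed
  then obtain a b where ab: "a < d" "b < d" "M a b \<noteq> 0\<^sub>m d d" by blast
  have "det (M a b) \<noteq> 0"
  proof
    assume "det (M a b) = 0"
    then obtain v where v: "v \<in> carrier_vec d" "v \<noteq> 0\<^sub>v d" "M a b *\<^sub>v v = 0\<^sub>v d"
      using det_0_iff_vec_prod_zero_field[OF M] by blast
    \<comment> \<open>By invariance, the transpose of \<open>\<psi> g\<close> maps this vector to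
      \<open>M a b *\<^sub>v v = 0\<close>, and that transpose is invertible.\<close>
    have "M a b *\<^sub>v (map_mat F (\<psi> g) *\<^sub>v v) = 0\<^sub>v d" if g: "g \<in> carrier H" for g
    proof -
      note gc = \<psi>.carr[OF g] and ic = \<psi>.carr[OF \<psi>.inv_closed[OF g]]
      have Fg: "map_mat F (\<psi> g) \<in> carrier_mat d d" using gc by simp
      have uc: "M a b *\<^sub>v (map_mat F (\<psi> g) *\<^sub>v v) \<in> carrier_vec d"
        by (rule mult_mat_vec_carrier[OF M mult_mat_vec_carrier[OF Fg v(1)]])
      have T: "(\<psi> (inv\<^bsub>H\<^esub> g))\<^sup>T * (\<psi> g)\<^sup>T = 1\<^sub>m d"
        using transpose_mult[OF gc ic] \<psi>.inverse(1)[OF g] by simp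
      have "(\<psi> g)\<^sup>T *\<^sub>v (M a b *\<^sub>v (map_mat F (\<psi> g) *\<^sub>v v)) = sesqui (M a b) (\<psi> g) *\<^sub>v v"
        using gc M[of a b] Fg v(1) unfolding sesqui_def by (simp add: assoc_mult_mat_vec[of _ d d _ d])
      then have 0: "(\<psi> g)\<^sup>T *\<^sub>v (M a b *\<^sub>v (map_mat F (\<psi> g) *\<^sub>v v)) = 0\<^sub>v d"
        using inv[OF ab(1,2) g] v(3) by simp
      have "M a b *\<^sub>v (map_mat F (\<psi> g) *\<^sub>v v)
        = (\<psi> (inv\<^bsub>H\<^esub> g))\<^sup>T *\<^sub>v ((\<psi> g)\<^sup>T *\<^sub>v (M a b *\<^sub>v (map_mat F (\<psi> g) *\<^sub>v v)))"
        using assoc_mult_mat_vec[of "(\<psi> (inv\<^bsub>H\<^esub> g))\<^sup>T" d d "(\<psi> g)\<^sup>T" d, OF _ _ uc] gc ic T uc by simp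
      also have "\<dots> = 0\<^sub>v d" unfolding 0 using ic by (intro eq_vecI) auto
      finally show ?thesis .
    qed
    then have "M a b = 0\<^sub>m d d"
      by (rule F\<psi>.intertwiner_kernel[OF F_schur ord M v(1,2)])
    with ab(3) show False by simp
  qed
  then show ?thesis using that[OF M] inv ab by blast
qed

end

section \<open>Recognizing the identity by its Brauer value\<close>

lemma root_lift_eq_one:
  fixes \<zeta> :: "'k::field"
  assumes "primitive_root_of_unity n \<zeta>" "x ^ n = 1"
  shows "cmod (root_lift n \<zeta> x) = 1" "root_lift n \<zeta> x = 1 \<Longrightarrow> x = 1"
proof -
  have n: "0 < n" using assms(1) by (simp add: primitive_root_of_unity_def)
  obtain i where i: "i < n" "x = \<zeta> ^ i"
    using primitive_root_powers(2)[OF assms(1)] assms(2) by blast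
  have l: "root_lift n \<zeta> x = cis (2 * pi / real n) ^ i" unfolding i(2) by (rule root_lift_power[OF assms(1)])
  show "cmod (root_lift n \<zeta> x) = 1" unfolding l by (simp add: norm_power)
  assume "root_lift n \<zeta> x = 1"
  then have "i = 0"
    using primitive_root_cis[OF n] i(1) unfolding l primitive_root_of_unity_def by (metis neq0_conv)
  then show "x = 1" by (simp add: i(2))
qed

lemma brauer_value_one:
  fixes \<zeta> :: "'k::alg_closed_field"
  assumes \<zeta>: "primitive_root_of_unity n \<zeta>"
  shows "brauer_value n \<zeta> (1\<^sub>m d) = of_nat d"
proof -
  have "diag_mat (1\<^sub>m d :: 'k mat) = replicate d 1"
    by (rule nth_equalityI) (auto simp: diag_mat_def)
  then have "char_poly (1\<^sub>m d :: 'k mat) = (\<Prod>e\<leftarrow>replicate d 1. [:- e, 1:])"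
    using char_poly_upper_triangular[OF one_carrier_mat upper_triangular_one] by metis
  then have "brauer_value n \<zeta> (1\<^sub>m d) = (\<Sum>e\<leftarrow>replicate d 1. root_lift n \<zeta> e)"
    by (rule brauer_value_eq)
  then show ?thesis using root_lift_power[OF \<zeta>, of 0] by (simp add: sum_list_replicate)
qed

text \<open>Equality case of the triangle inequality: \<open>d\<close> complex numbers of modulus 1
  with sum \<open>d\<close> are all 1. So 1 is the only eigenvalue, and
  \<open>unipotent_pow_eq_one\<close> applies.\<close>

lemma brauer_value_eq_degree:
  fixes A :: "'k::alg_closed_field mat"
  assumes \<zeta>: "primitive_root_of_unity n \<zeta>" and n: "of_nat n \<noteq> (0::'k)"
    and A: "A \<in> carrier_mat d d" "A ^\<^sub>m n = 1\<^sub>m d" and val: "brauer_value n \<zeta> A = of_nat d"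
  shows "A = 1\<^sub>m d"
proof -
  obtain es where len: "length es = d" and "\<And>k. char_poly (A ^\<^sub>m k) = (\<Prod>e\<leftarrow>es. [:- (e ^ k), 1:])"
    using eigenvalue_list[OF A(1)] by metis
  from this(2)[of 1] have cp: "char_poly A = (\<Prod>e\<leftarrow>es. [:- e, 1:])" using A by simp
  have root: "poly (char_poly A) e = 0 \<longleftrightarrow> e \<in> set es" for e
    unfolding cp by (auto simp: poly_prod_list prod_list_zero_iff)
  have pow: "e ^ n = 1" if "e \<in> set es" for e
    using pow_one_imp_eigenvalue_pow_one[OF A] root that by blast
  define L where "L = map (root_lift n \<zeta>) es"
  have "sum_list L = of_nat (length L)"
    using val brauer_value_eq[OF cp] len by (simp add: L_def)
  moreover have "\<forall>z\<in>set L. cmod z = 1" using root_lift_eq_one(1)[OF \<zeta> pow] by (auto simp: L_def)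
  ultimately have "\<forall>z\<in>set L. z = 1"
  proof -
    assume s: "sum_list L = of_nat (length L)" and m: "\<forall>z\<in>set L. cmod z = 1"
    have "(\<Sum>z\<leftarrow>L. 1 - Re z) = real (length L) - Re (sum_list L)"
      by (induction L) auto
    then have "(\<Sum>z\<leftarrow>L. 1 - Re z) = 0" by (simp add: s)
    moreover have nn: "0 \<le> 1 - Re z" if "z \<in> set L" for z using m that complex_Re_le_cmod[of z] by auto
    ultimately have "1 - Re z = 0" if "z \<in> set L" for z
    proof -
      have "\<forall>x\<in>set (map (\<lambda>z. 1 - Re z) L). 0 \<le> x" using nn by auto
      then have "\<forall>x\<in>set (map (\<lambda>z. 1 - Re z) L). x = 0"
        using sum_list_nonneg_eq_0_iff[of "map (\<lambda>z. 1 - Re z) L"] \<open>(\<Sum>z\<leftarrow>L. 1 - Re z) = 0\<close> by blast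
      then show ?thesis using that by simp
    qed
    then have "Re z = 1" if "z \<in> set L" for z using that by force
    then show ?thesis using m by (auto simp: complex_eq_iff cmod_def) 
  qed
  then have "root_lift n \<zeta> e = 1" if "e \<in> set es" for e using that by (simp add: L_def)
  then have "e = 1" if "e \<in> set es" for e using root_lift_eq_one(2)[OF \<zeta> pow[OF that]] that by blast
  then show ?thesis using unipotent_pow_eq_one[OF A n] root by blast
qed

section \<open>Embedding into the unitary group\<close>

theorem theorem1p1:
  fixes H :: "('h, 'b) monoid_scheme"
    and \<chi> :: "'h \<Rightarrow> complex"
    and d q q' :: nat
    and \<zeta> :: "'k::alg_closed_field"
    and \<zeta>' :: "'l::alg_closed_field"
    and h :: "'l vec \<Rightarrow> 'l vec \<Rightarrow> 'l"
  assumes "group H" and "finite (carrier H)"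
    and "irreducible_character H d \<chi>"
    and "primepow q" and "primepow q'"
    and "[int q' = - int q] (mod int (order H))"
    and "coprime q (order H)"
    and "CHAR('k) = aprimedivisor q"
    and "primitive_root_of_unity (prime_to_part CHAR('k) (order H)) \<zeta>"
    and "CHAR('l) = aprimedivisor q'"
    and "primitive_root_of_unity (prime_to_part CHAR('l) (order H)) \<zeta>'"
    and "hermitian_form d q' h" and "nondegenerate_form d q' h"
    and "embeds_with_brauer_character H d (GL_GF d q) \<zeta> \<chi>"
  shows "embeds_with_brauer_character H d (GU_GF d q' h) \<zeta>' \<chi>"
proof -
  let ?n = "order H"
  interpret H: group H by fact
  have fin: "finite (carrier H)" by fact
  have n: "0 < ?n" using H.order_gt_0_iff_finite fin by blast

  interpret k: alg_closed_frobenius_power "\<lambda>x::'k. x ^ q" q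
    unfolding alg_closed_frobenius_power_def using frobenius_powerI assms(4,8) by blast
  interpret l: alg_closed_frobenius_power "\<lambda>x::'l. x ^ q'" q'
    unfolding alg_closed_frobenius_power_def using frobenius_powerI assms(5,10) by blast

  have n_dvd: "?n dvd q' + q"
  proof -
    have "int ?n dvd int q' - (- int q)" using assms(6) by (simp add: cong_iff_dvd_diff)
    then have "int ?n dvd int (q' + q)" by simp
    then show ?thesis by (simp only: int_dvd_int_iff)
  qed
  have "coprime q' ?n"
  proof (rule coprimeI)
    fix c assume c: "c dvd q'" "c dvd ?n"
    then have "c dvd q' + q" using n_dvd dvd_trans by blast
    then have "c dvd q" using c(1) by (simp add: dvd_add_right_iff)
    then show "is_unit c" using c(2) assms(7) coprime_common_divisor by blast
  qed
  have p: "prime CHAR('k)" and p': "prime CHAR('l)" by (rule k.char_prime, rule l.char_prime)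
  have "CHAR('k) dvd q" "CHAR('l) dvd q'"
    using aprimedivisor_dvd'[of q] aprimedivisor_dvd'[of q'] k.q_gt_1 l.q_gt_1 assms(8,10) by simp_all
  then have ndvd: "\<not> CHAR('k) dvd ?n" "\<not> CHAR('l) dvd ?n"
    using p p' assms(7) \<open>coprime q' ?n\<close> by (metis coprime_common_divisor not_prime_unit)+
  have part: "prime_to_part CHAR('k) ?n = ?n" "prime_to_part CHAR('l) ?n = ?n"
    using ndvd by (simp_all add: prime_to_part_def not_dvd_imp_multiplicity_0)
  have nk: "of_nat ?n \<noteq> (0::'k)" and nl: "of_nat ?n \<noteq> (0::'l)"
    using ndvd by (simp_all add: of_nat_eq_0_iff_char_dvd)
  have \<zeta>: "primitive_root_of_unity ?n \<zeta>" and \<zeta>': "primitive_root_of_unity ?n \<zeta>'"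
    using assms(9,11) part by simp_all
  \<comment> \<open>The characteristic does not divide \<open>order H\<close>, so every element is
    regular and the hypothesis on Brauer values covers all of \<open>H\<close>.\<close>
  have ord_coprime: "coprime (group.ord H g) CHAR('k)" if "g \<in> carrier H" for g
    using p ndvd(1) H.ord_dvd_group_order[OF that] by (metis coprime_commute dvd_trans prime_imp_coprime)

  obtain \<rho> where \<rho>: "irreducible_rep H d \<rho>" "\<And>g. g \<in> carrier H \<Longrightarrow> \<chi> g = mat_trace (\<rho> g)"
    using assms(3) unfolding irreducible_character_def by blast
  have d: "0 < d" using \<rho>(1) by (simp add: irreducible_rep_def)
  obtain \<phi> where \<phi>: "\<phi> \<in> hom H (GL d)" "inj_on \<phi> (carrier H)" "\<phi> ` carrier H \<subseteq> GL_GF d q"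
    "\<And>g. g \<in> carrier H \<Longrightarrow> brauer_value ?n \<zeta> (\<phi> g) = \<chi> g"
    using assms(14) ord_coprime part unfolding embeds_with_brauer_character_def by auto
  interpret \<phi>: matrix_rep H d \<phi> using matrix_rep_iff_hom_GL[OF assms(1,2)] \<phi>(1) by blast
  obtain \<psi> :: "'h \<Rightarrow> 'l mat" and T where \<psi>: "matrix_rep H d \<psi>" "schur_relations H d \<psi>"
    "\<And>g. g \<in> carrier H \<Longrightarrow> brauer_value ?n \<zeta>' (\<psi> g) = mat_trace (\<rho> g)"
    "\<And>g. g \<in> carrier H \<Longrightarrow> mat_trace (\<psi> g) = T (mat_trace (\<rho> g))"
    using irreducible_rep_reduction[OF assms(1,2) \<rho>(1) nl \<zeta>'] by metis
  interpret \<psi>: matrix_rep H d \<psi> by fact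

  have \<chi>_pow: "\<chi> (g [^]\<^bsub>H\<^esub> q) = \<chi> g" if g: "g \<in> carrier H" for g
  proof -
    have "\<phi> g \<in> GL_GF d q" using \<phi>(3) g by blast
    then have "map_mat (\<lambda>x. x ^ q) (\<phi> g) = \<phi> g"
      using g by (intro eq_matI) (auto simp: GL_GF_def GF_def)
    then have "char_poly (\<phi> (g [^]\<^bsub>H\<^esub> q)) = char_poly (\<phi> g)"
      using k.char_poly_pow_fixed[OF \<phi>.carr[OF g]] \<phi>.pow[OF g] by simp
    then show ?thesis using \<phi>(4)[OF g] \<phi>(4)[of "g [^]\<^bsub>H\<^esub> q"] g by (simp add: brauer_value_def)
  qed
  have "mat_trace (map_mat (\<lambda>x. x ^ q') (\<psi> g)) = mat_trace (\<psi> (inv\<^bsub>H\<^esub> g))" if g: "g \<in> carrier H" for g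
  proof -
    let ?i = "inv\<^bsub>H\<^esub> g"
    obtain c where c: "q' + q = ?n * c" using n_dvd by (elim dvdE)
    have "g [^]\<^bsub>H\<^esub> q' \<otimes>\<^bsub>H\<^esub> g [^]\<^bsub>H\<^esub> q = (g [^]\<^bsub>H\<^esub> ?n) [^]\<^bsub>H\<^esub> c"
      using g by (simp add: H.nat_pow_mult H.nat_pow_pow c)
    also have "\<dots> = \<one>\<^bsub>H\<^esub>" using g H.pow_order_eq_1 by simp
    finally have "g [^]\<^bsub>H\<^esub> q' = inv\<^bsub>H\<^esub> (g [^]\<^bsub>H\<^esub> q)" using g by (intro H.inv_equality[symmetric]) auto
    also have "\<dots> = ?i [^]\<^bsub>H\<^esub> q" using g by (simp add: H.nat_pow_inv)
    finally have pow: "g [^]\<^bsub>H\<^esub> q' = ?i [^]\<^bsub>H\<^esub> q" .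
    have "mat_trace (map_mat (\<lambda>x. x ^ q') (\<psi> g)) = mat_trace (\<psi> (g [^]\<^bsub>H\<^esub> q'))"
      using l.mat_trace_map[OF \<psi>.carr[OF g]] \<psi>.pow[OF g] by simp
    also have "\<dots> = mat_trace (\<psi> ?i)"
      using \<psi>(4)[of "?i [^]\<^bsub>H\<^esub> q"] \<psi>(4)[of ?i] \<rho>(2)[of "?i [^]\<^bsub>H\<^esub> q"] \<rho>(2)[of ?i] \<chi>_pow[of ?i] g
      by (simp add: pow)
    finally show ?thesis .
  qed
  then obtain M where M: "M \<in> carrier_mat d d" "det M \<noteq> 0"
    "\<And>g. g \<in> carrier H \<Longrightarrow> l.sesqui M (\<psi> g) = M"
    using l.invariant_sesqui[OF \<psi>(1,2) nl d] by metis
  obtain S R where S: "S \<in> carrier_mat d d" "R \<in> carrier_mat d d" "S * R = 1\<^sub>m d" "R * S = 1\<^sub>m d"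
    "M = S\<^sup>T * map_mat (\<lambda>x. x ^ q') S"
    by (rule l.unitary_lang[OF M(1,2)])
  obtain J where J: "J \<in> carrier_mat d d" "det J \<noteq> 0" "J\<^sup>T = map_mat (\<lambda>x. x ^ q') J"
    "\<And>v w. v \<in> GF_vec d (q'\<^sup>2) \<Longrightarrow> w \<in> GF_vec d (q'\<^sup>2) \<Longrightarrow> h v w = v \<bullet> (J *\<^sub>v map_vec (\<lambda>x. x ^ q') w)"
    using l.gram_matrix[OF assms(12,13)] by metis
  obtain U V where U: "U \<in> carrier_mat d d" "V \<in> carrier_mat d d" "U * V = 1\<^sub>m d" "V * U = 1\<^sub>m d"
    "J = U\<^sup>T * map_mat (\<lambda>x. x ^ q') U"
    by (rule l.unitary_lang[OF J(1,2)])

  note assoc = assoc_mult_mat[of _ d d _ d _ d]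
  \<comment> \<open>The factorizations carry the identity form to \<open>M\<close> by
    \<open>S\<close> and to \<open>J\<close> by \<open>U\<close>. Hence \<open>P\<close>, the
    inverse of \<open>S\<close> times \<open>U\<close>, satisfies \<open>sesqui M P = J\<close>, and
    conjugation by it turns isometries of \<open>M\<close> into isometries of
    \<open>J\<close>.\<close>
  define P where "P = R * U"
  define Q where "Q = V * S"
  have PQ: "P \<in> carrier_mat d d" "Q \<in> carrier_mat d d" using S U by (simp_all add: P_def Q_def)
  have "P * Q = R * (U * V) * S" "Q * P = V * (S * R) * U"
    using S(1,2) U(1,2) by (simp_all add: P_def Q_def assoc)
  then have PQ1: "P * Q = 1\<^sub>m d" "Q * P = 1\<^sub>m d"
    unfolding U(3) S(3) using S(1,2,4) U(1,2,4) by simp_all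
  define \<theta> where "\<theta> g = Q * \<psi> g * P" for g
  interpret \<theta>: matrix_rep H d \<theta> unfolding \<theta>_def by (rule \<psi>.conjugate[OF PQ PQ1])
  have one: "l.sesqui (1\<^sub>m d) X = X\<^sup>T * map_mat (\<lambda>x. x ^ q') X" if "X \<in> carrier_mat d d" for X
    using that by (simp add: l.sesqui_def)
  have I: "1\<^sub>m d \<in> carrier_mat d d" by simp
  have inv: "l.sesqui J (\<theta> g) = J" if g: "g \<in> carrier H" for g
  proof -
    note gc = \<psi>.carr[OF g] and tc = \<theta>.carr[OF g]
    have "U * \<theta> g = (U * V) * (S * (\<psi> g * P))"
      using S(1) U(1,2) PQ(1) gc by (simp add: \<theta>_def Q_def assoc)
    then have eq: "U * \<theta> g = S * (\<psi> g * P)" using S(1) PQ(1) gc by (simp add: U(3))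
    have "S * P = (S * R) * U" using S(1,2) U(1) by (simp add: P_def assoc)
    then have SP: "S * P = U" using U(1) by (simp add: S(3))
    have MS: "M = l.sesqui (1\<^sub>m d) S" and JU: "J = l.sesqui (1\<^sub>m d) U"
      using one S(1,5) U(1,5) by simp_all
    have "l.sesqui J (\<theta> g) = l.sesqui (1\<^sub>m d) (S * (\<psi> g * P))"
      unfolding JU by (simp add: l.sesqui_sesqui[OF I U(1) tc] eq)
    also have "\<dots> = l.sesqui (l.sesqui M (\<psi> g)) P"
      unfolding MS using l.sesqui_sesqui[OF I S(1) mult_carrier_mat[OF gc PQ(1)]]
        l.sesqui_sesqui[OF l.sesqui_carrier[OF I S(1)] gc PQ(1)] by simp
    also have "\<dots> = l.sesqui (1\<^sub>m d) (S * P)"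
      unfolding M(3)[OF g] unfolding MS by (rule l.sesqui_sesqui[OF I S(1) PQ(1)])
    also have "\<dots> = J" unfolding SP JU ..
    finally show ?thesis .
  qed
  have hom: "\<theta> \<in> hom H (GL d)" using matrix_rep_iff_hom_GL[OF assms(1,2)] \<theta>.matrix_rep_axioms by blast
  have GU: "\<theta> g \<in> GU_GF d q' h" if g: "g \<in> carrier H" for g
    using l.unitary_in_GU_GF[OF J _ \<theta>.carr[OF g] inv[OF g]] hom g by (auto simp: hom_def)
  have brauer: "brauer_value ?n \<zeta>' (\<theta> g) = \<chi> g" if g: "g \<in> carrier H" for g
  proof -
    have "similar_mat (\<theta> g) (\<psi> g)"
      unfolding \<theta>_def using PQ PQ1 \<psi>.carr[OF g] by (intro similar_matI[of _ _ Q P d]) auto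
    then have "char_poly (\<theta> g) = char_poly (\<psi> g)" by (rule char_poly_similar)
    then show ?thesis using \<psi>(3)[OF g] \<rho>(2)[OF g] by (simp add: brauer_value_def)
  qed
  \<comment> \<open>Faithfulness passes from \<open>\<phi>\<close> to \<open>\<theta>\<close>
    through the common character: \<open>\<theta> u = 1\<close> gives \<open>\<chi> u = d\<close>,
    which forces \<open>\<phi> u = 1\<close>.\<close>
  have "inj_on \<theta> (carrier H)"
  proof (rule inj_onI)
    fix x y assume xy: "x \<in> carrier H" "y \<in> carrier H" "\<theta> x = \<theta> y"
    define u where "u = x \<otimes>\<^bsub>H\<^esub> inv\<^bsub>H\<^esub> y"
    have u: "u \<in> carrier H" using xy by (simp add: u_def)
    have "\<theta> u = 1\<^sub>m d" using xy \<theta>.inverse(1)[of y] by (simp add: u_def \<theta>.mult)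
    then have "\<chi> u = of_nat d" using brauer[OF u] brauer_value_one[OF \<zeta>'] by simp
    then have "\<phi> u = 1\<^sub>m d"
      using brauer_value_eq_degree[OF \<zeta> nk \<phi>.carr[OF u] \<phi>.pow_order[OF u]] \<phi>(4)[OF u] by simp
    then have "u = \<one>\<^bsub>H\<^esub>" using inj_onD[OF \<phi>(2), of u "\<one>\<^bsub>H\<^esub>"] u \<phi>.one by simp
    then show "x = y" using xy H.inv_solve_right'[of "\<one>\<^bsub>H\<^esub>" x y] by (simp add: u_def)
  qed
  then show ?thesis
    unfolding embeds_with_brauer_character_def using hom GU brauer part by (intro bexI[of _ \<theta>]) auto
qed

end
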